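(* Let $I\subset[n]$, $|I|=k$. Then the restriction $c^*w_I^+$ of the normalized weight function $w_I^+$ to $\hat E_T(X_{k,n})$ is a meromorphic section of the admissible bundle $p_T^*\mathcal L_I\otimes\mathcal T_{k,n}$ for some line bundle $\mathcal L_I$ on $\hat E_T(\mathrm{pt})$. Moreover $\psi_I\,c^*w_I^+$ is holomorphic.
   Context: Fix $\tau$ in the upper half plane, $q=e^{2\pi i\tau}$, $E=\mathbb C/(\mathbb Z+\tau\mathbb Z)$, $\theta(z)=\frac{\sin\pi z}{\pi}\prod_{j\ge1}\frac{(1-q^je^{2\pi iz})(1-q^je^{-2\pi iz})}{(1-q^j)^2}$. For an integral symmetric $p\times p$ matrix $N$ (identified with the quadratic form $N(x)=x^tNx$) and $v\in\mathbb C^p$ let $\mathcal L(N,v)$ be the line bundle on $E^p$ whose sections are functions $f$ on $\mathbb C^p$ with $f(x+e_j)=(-1)^{N_{jj}}f(x)$ and $f(x+\tau e_j)=(-1)^{N_{jj}}e^{-2\pi i(\sum_kN_{jk}x_k+v_j)-\pi i\tau N_{jj}}f(x)$. $[n]=\{1,\dots,n\}$, $\bar K=[n]\smallsetminus K$, $z_K=(z_a)_{a\in K}$, $E^{(m)}=E^m/S_m$. $\hat E_T(\mathrm{pt})=E^n\times E\times E$ with coordinates $(z_1,\dots,z_n,y,\lambda)$ on its universal cover. The extended $T$-equivariant elliptic cohomology scheme of $X_{k,n}=T^*\mathrm{Gr}(k,n)$, $T=U(1)^n\times U(1)$, is $\hat E_T(X_{k,n})=(E^{(k)}\times E^{(n-k)})\times_{E^{(n)}}E^n\times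 E\times E$, with projection $p_T$ to $\hat E_T(\mathrm{pt})$ and projection $\hat\chi$ to $E^{(k)}\times E^{(n-k)}\times E\times E$. It is the union of the components $Y_K=\iota_K\hat E_T(\mathrm{pt})$, $K\subset[n]$, $|K|=k$, $\iota_K(z,y,\lambda)=(z_K,z_{\bar K},z,y,\lambda)$. The twisting bundle is $\mathcal T_{k,n}=\hat\chi^*\mathcal L(N_{k,n},0)$ with $N_{k,n}(t,s,y,\lambda)=2\sum_{i=1}^kt_i(\lambda+(n-k)y)+\sum_{i=1}^k\sum_{j=1}^{n-k}(t_i-s_j)^2$. Admissible line bundles on $\hat E_T(X_{k,n})$ are those of the form $p_T^*\mathcal L\otimes\mathcal T_{k,n}$ with $\mathcal L$ a line bundle on $\hat E_T(\mathrm{pt})$. A meromorphic section of a line bundle $\mathcal M$ on $\hat E_T(X_{k,n})$ is a collection of meromorphic sections $s_K$ of $\mathcal M|_{Y_K}$ which restrict to meromorphic sections on all intersections $Y_{I_1}\cap\dots\cap Y_{I_s}$ (the polar divisor contains no component of the intersection) and with $s_I=s_J$ on $Y_I\cap Y_J$; it is holomorphic if all $s_K$ are holomorphic. For $I=\{i_1<\dots<i_k\}\subset[n]$: $n(j,I)=|\{l\in I:l>j\}|$, $w(j,I)=n(j,I)-n(j,\bar I)$, $\psi_I=\psi_I(y,\lambda)=\prod_{j\in I}\theta(\lambda-(w(j,I)+1)y)\theta(\lambda-w(j,I)y)$, and $$w_I^+(t;z,y,\lambda)=\frac1{\psi_I}\sum_{\sigma\in S_k}\sigma\cdot\frac{\prod_{r=1}^k\Big(\prod_{a<i_r}\theta(t_r-z_a+y)\;\theta(\lambda+t_r-z_{i_r}-w(i_r,I)y)\prod_{a>i_r}\theta(t_r-z_a)\Big)}{\prod_{1\le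 i<j\le k}\theta(t_i-t_j)\theta(t_j-t_i+y)},$$ $\sigma$ permuting $t_1,\dots,t_k$; it is viewed as a meromorphic section of a line bundle on $E^{(k)}\times E^{(n-k)}\times E^n\times E\times E$ constant along $E^{(n-k)}$. $c:\hat E_T(X_{k,n})\hookrightarrow E^{(k)}\times E^{(n-k)}\times E^n\times E\times E$ is the canonical embedding; the restriction of $c^*w_I^+$ to $Y_J$ is $w_I^+(z_J;z,y,\lambda)$. *)

theory Defs
  imports "HOL-Analysis.Analysis"
begin

section \<open>Holomorphic and meromorphic functions of several variables\<close>

definition holo_on :: "(complex^'p::finite \<Rightarrow> complex) \<Rightarrow> (complex^'p) set \<Rightarrow> bool" where
  "holo_on f U \<longleftrightarrow> open U \<and>
     (\<forall>x\<in>U. \<exists>D. (f has_derivative D) (at x) \<and> (\<forall>c v. D (c *s v) = c * D v))"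

text \<open>A meromorphic function is represented by a total function; its values on a nowhere dense
  set are irrelevant (in particular those coming from \<open>a / 0 = 0\<close>). Two representatives of
  meromorphic functions denote the same meromorphic function iff \<open>gen_eq\<close> holds.\<close>

definition gen_eq :: "'a::topological_space set \<Rightarrow> ('a \<Rightarrow> complex) \<Rightarrow> ('a \<Rightarrow> complex) \<Rightarrow> bool" where
  "gen_eq U f g \<longleftrightarrow> interior (closure {x\<in>U. f x \<noteq> g x}) = {}"

definition mero :: "(complex^'p::finite \<Rightarrow> complex) \<Rightarrow> bool" where
  "mero f \<longleftrightarrow> (\<forall>p. \<exists>U g h. p \<in> U \<and> holo_on g U \<and> holo_on h U \<and>
      interior {x\<in>U. h x = 0} = {} \<and> gen_eq U f (\<lambda>x. g x / h x))"

definition regular_at :: "(complex^'p::finite \<Rightarrow> complex) \<Rightarrow> complex^'p \<Rightarrow> bool" where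
  "regular_at f p \<longleftrightarrow> (\<exists>U g. p \<in> U \<and> holo_on g U \<and> gen_eq U f g)"

definition mero_value :: "(complex^'p::finite \<Rightarrow> complex) \<Rightarrow> complex^'p \<Rightarrow> complex" where
  "mero_value f p = (THE v. \<exists>U g. p \<in> U \<and> holo_on g U \<and> gen_eq U f g \<and> v = g p)"

definition polar_set :: "(complex^'p::finite \<Rightarrow> complex) \<Rightarrow> (complex^'p) set" where
  "polar_set f = {p. \<not> regular_at f p}"

section \<open>Line bundles on \<open>E\<^sup>p\<close>\<close>

definition latvec :: "complex \<Rightarrow> int^'p::finite \<Rightarrow> int^'p \<Rightarrow> complex^'p" where
  "latvec \<tau> m l = (\<chi> j. of_int (m $ j) + of_int (l $ j) * \<tau>)"

text \<open>A line bundle on the complex torus \<open>E\<^sup>p\<close> is given by a factor of automorphy \<open>e\<close>: its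
  sections are the functions \<open>f\<close> on \<open>\<complex>\<^sup>p\<close> with \<open>f (x + m + l\<tau>) = e m l x * f x\<close>.\<close>

type_synonym 'p factor = "int^'p \<Rightarrow> int^'p \<Rightarrow> complex^'p \<Rightarrow> complex"

definition line_bundle :: "complex \<Rightarrow> 'p::finite factor \<Rightarrow> bool" where
  "line_bundle \<tau> e \<longleftrightarrow>
     (\<forall>m l. holo_on (e m l) UNIV \<and> (\<forall>x. e m l x \<noteq> 0)) \<and>
     (\<forall>m l m' l' x. e (m + m') (l + l') x = e m l (x + latvec \<tau> m' l') * e m' l' x)"

definition tensor :: "'p::finite factor \<Rightarrow> 'p factor \<Rightarrow> 'p factor" (infixl \<open>\<otimes>\<^sub>L\<close> 70) where
  "e \<otimes>\<^sub>L e' = (\<lambda>m l x. e m l x * e' m l x)"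

definition quad_form :: "('p::finite \<Rightarrow> 'p \<Rightarrow> int) \<Rightarrow> complex^'p \<Rightarrow> complex" where
  "quad_form N x = (\<Sum>i\<in>UNIV. \<Sum>j\<in>UNIV. of_int (N i j) * x $ i * x $ j)"

text \<open>The factor of \<open>\<L>(N,v)\<close>; the lemmas \<open>LB_axis\<close> and \<open>line_bundle_LB\<close> below show that it is
  the one prescribed by the multipliers for the translations by \<open>e\<^sub>j\<close> and \<open>\<tau> e\<^sub>j\<close>.\<close>

definition LB :: "complex \<Rightarrow> ('p::finite \<Rightarrow> 'p \<Rightarrow> int) \<Rightarrow> complex^'p \<Rightarrow> 'p factor" where
  "LB \<tau> N v m l x =
     (- 1) powi (\<Sum>j\<in>UNIV. N j j * (m $ j + l $ j)) *
     exp (- (2 * pi * \<i> * (\<Sum>j\<in>UNIV. of_int (l $ j) *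
                ((\<Sum>k\<in>UNIV. of_int (N j k) * x $ k) + v $ j)))
          - pi * \<i> * \<tau> * (\<Sum>j\<in>UNIV. \<Sum>k\<in>UNIV. of_int (N j k * l $ j * l $ k)))"

definition mero_sect :: "complex \<Rightarrow> 'p::finite factor \<Rightarrow> (complex^'p \<Rightarrow> complex) \<Rightarrow> bool" where
  "mero_sect \<tau> e f \<longleftrightarrow> mero f \<and>
     (\<forall>m l. gen_eq UNIV (\<lambda>x. f (x + latvec \<tau> m l)) (\<lambda>x. e m l x * f x))"

definition holo_sect :: "complex \<Rightarrow> 'p::finite factor \<Rightarrow> (complex^'p \<Rightarrow> complex) \<Rightarrow> bool" where
  "holo_sect \<tau> e f \<longleftrightarrow> mero_sect \<tau> e f \<and> (\<forall>x. regular_at f x)"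

section \<open>Irreducible components of analytic subsets of \<open>E\<^sup>p\<close>\<close>

text \<open>Subsets of \<open>E\<^sup>p\<close> are represented by their lattice-invariant preimages in \<open>\<complex>\<^sup>p\<close>.\<close>

definition analytic_subset :: "complex \<Rightarrow> (complex^'p::finite) set \<Rightarrow> bool" where
  "analytic_subset \<tau> A \<longleftrightarrow>
     (\<forall>m l x. x + latvec \<tau> m l \<in> A \<longleftrightarrow> x \<in> A) \<and>
     (\<forall>p. \<exists>U F. open U \<and> p \<in> U \<and> finite F \<and> (\<forall>f\<in>F. holo_on f U) \<and>
        A \<inter> U = {x\<in>U. \<forall>f\<in>F. f x = 0})"

definition irreducible_subset :: "complex \<Rightarrow> (complex^'p::finite) set \<Rightarrow> bool" where
  "irreducible_subset \<tau> A \<longleftrightarrow> analytic_subset \<tau> A \<and> A \<noteq> {} \<and>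
     (\<forall>B C. analytic_subset \<tau> B \<longrightarrow> analytic_subset \<tau> C \<longrightarrow> A = B \<union> C \<longrightarrow> A = B \<or> A = C)"

definition irred_component :: "complex \<Rightarrow> (complex^'p::finite) set \<Rightarrow> (complex^'p) set \<Rightarrow> bool" where
  "irred_component \<tau> Z X \<longleftrightarrow> irreducible_subset \<tau> Z \<and> Z \<subseteq> X \<and>
     (\<forall>W. irreducible_subset \<tau> W \<longrightarrow> Z \<subseteq> W \<longrightarrow> W \<subseteq> X \<longrightarrow> W = Z)"

section \<open>The scheme \<open>E\<^sub>T(X\<^sub>k\<^sub>,\<^sub>n)\<close> and its line bundles\<close>

text \<open>\<open>[n]\<close> is a finite linearly ordered type \<open>'n\<close> with \<open>n = CARD('n)\<close>. The index type
  \<open>'n coord\<close> serves both for the coordinates \<open>(z\<^sub>1,\<dots>,z\<^sub>n,y,\<lambda>)\<close> and for the coordinates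
  \<open>(t\<^sub>1,\<dots>,t\<^sub>k,s\<^sub>1,\<dots>,s\<^sub>n\<^sub>-\<^sub>k,y,\<lambda>)\<close>: in the second case the \<open>k\<close> smallest elements of \<open>'n\<close> index the
  \<open>t\<^sub>i\<close> and the remaining ones index the \<open>s\<^sub>j\<close>.\<close>

datatype 'n coord = Pt 'n | Yc | Lc

lemma UNIV_coord: "(UNIV :: 'n coord set) = insert Yc (insert Lc (range Pt))"
  by (auto intro: coord.exhaust)

instance coord :: (finite) finite
  by standard (simp add: UNIV_coord)

definition posn :: "'n::{finite,linorder} \<Rightarrow> nat" where
  "posn a = card {b. b < a}"

text \<open>Elements of a subset of \<open>[n]\<close> in increasing order, numbered from \<open>0\<close>.\<close>

definition nth_elem :: "'n::{finite,linorder} set \<Rightarrow> nat \<Rightarrow> 'n" where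
  "nth_elem K r = sorted_list_of_set K ! r"

text \<open>The map \<open>(z,y,\<lambda>) \<mapsto> (z\<^sub>K, z\<^sub>K', y, \<lambda>)\<close> with \<open>K'\<close> the complement of \<open>K\<close>, i.e. a lift to universal
  covers of the composition of \<open>\<iota>\<^sub>K\<close> with the projection \<open>\<chi>\<close>. It is also applied to the
  integer coordinates of lattice vectors.\<close>

definition chi_iota :: "'n::{finite,linorder} set \<Rightarrow> 'a^'n coord \<Rightarrow> 'a^'n coord" where
  "chi_iota K x = (\<chi> c. case c of
      Pt j \<Rightarrow> (if posn j < card K then x $ Pt (nth_elem K (posn j))
               else x $ Pt (nth_elem (- K) (posn j - card K)))
    | Yc \<Rightarrow> x $ Yc | Lc \<Rightarrow> x $ Lc)"

text \<open>The group \<open>S\<^sub>k \<times> S\<^sub>n\<^sub>-\<^sub>k\<close>, and its action on the coordinates \<open>(t,s,y,\<lambda>)\<close>.\<close>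

definition block_perms :: "nat \<Rightarrow> ('n::{finite,linorder} \<Rightarrow> 'n) set" where
  "block_perms k = {\<sigma>. bij \<sigma> \<and> (\<forall>j. posn (\<sigma> j) < k \<longleftrightarrow> posn j < k)}"

definition perm_coord :: "('n::finite \<Rightarrow> 'n) \<Rightarrow> 'a^'n coord \<Rightarrow> 'a^'n coord" where
  "perm_coord \<sigma> x = (\<chi> c. case c of Pt j \<Rightarrow> x $ Pt (\<sigma> j) | Yc \<Rightarrow> x $ Yc | Lc \<Rightarrow> x $ Lc)"

text \<open>\<open>\<iota>\<^sub>I x\<close> and \<open>\<iota>\<^sub>J x\<close> are the same point of the scheme iff \<open>chi_iota J x\<close> and \<open>chi_iota I x\<close> are
  in one orbit of the semidirect product of \<open>S\<^sub>k \<times> S\<^sub>n\<^sub>-\<^sub>k\<close> with the lattice; this is witnessed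
  by \<open>(\<sigma>, m, l)\<close>.\<close>

definition glued :: "complex \<Rightarrow> nat \<Rightarrow> 'n::{finite,linorder} set \<Rightarrow> 'n set \<Rightarrow> ('n \<Rightarrow> 'n) \<Rightarrow>
    int^'n coord \<Rightarrow> int^'n coord \<Rightarrow> complex^'n coord \<Rightarrow> bool" where
  "glued \<tau> k I J \<sigma> m l x \<longleftrightarrow> \<sigma> \<in> block_perms k \<and>
     chi_iota J x = perm_coord \<sigma> (chi_iota I x) + latvec \<tau> m l"

text \<open>The intersection of the \<open>Y\<^sub>K\<close>, \<open>K \<in> S\<close>, for nonempty \<open>S\<close>; all \<open>Y\<^sub>K\<close> are identified with
  \<open>E\<^sup>n \<times> E \<times> E\<close> by \<open>\<iota>\<^sub>K\<close>, the inverse of the restriction of \<open>p\<^sub>T\<close>.\<close>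

definition Y_inter :: "complex \<Rightarrow> nat \<Rightarrow> 'n::{finite,linorder} set set \<Rightarrow> (complex^'n coord) set" where
  "Y_inter \<tau> k S = {x. \<forall>I\<in>S. \<forall>J\<in>S. \<exists>\<sigma> m l. glued \<tau> k I J \<sigma> m l x}"

text \<open>The symmetric integral matrix of the form \<open>N\<^sub>k\<^sub>,\<^sub>n\<close>, see lemma \<open>quad_form_N_kn\<close>.\<close>

fun N_kn :: "nat \<Rightarrow> 'n::{finite,linorder} coord \<Rightarrow> 'n coord \<Rightarrow> int" where
  "N_kn k (Pt i) (Pt j) =
     (if posn i < k \<longleftrightarrow> posn j < k
      then (if i = j then (if posn i < k then int CARD('n) - int k else int k) else 0)
      else - 1)"
| "N_kn k (Pt i) Yc = (if posn i < k then int CARD('n) - int k else 0)"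
| "N_kn k Yc (Pt i) = (if posn i < k then int CARD('n) - int k else 0)"
| "N_kn k (Pt i) Lc = (if posn i < k then 1 else 0)"
| "N_kn k Lc (Pt i) = (if posn i < k then 1 else 0)"
| "N_kn k _ _ = 0"

definition twist :: "complex \<Rightarrow> nat \<Rightarrow> 'n::{finite,linorder} coord factor" where
  "twist \<tau> k = LB \<tau> (N_kn k) 0"

text \<open>The restriction to \<open>Y\<^sub>K\<close>, i.e. the pullback by \<open>chi_iota K\<close>, which maps lattice vectors to
  lattice vectors.\<close>

definition twist_on :: "complex \<Rightarrow> nat \<Rightarrow> 'n::{finite,linorder} set \<Rightarrow> 'n coord factor" where
  "twist_on \<tau> k K m l x = twist \<tau> k (chi_iota K m) (chi_iota K l) (chi_iota K x)"

text \<open>Meromorphic sections of the admissible bundle \<open>p\<^sub>T\<^sup>*L \<otimes> T\<^sub>k\<^sub>,\<^sub>n\<close>; \<open>s K\<close> is the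
  section on \<open>Y\<^sub>K\<close>, as a function on the universal cover of \<open>E\<^sup>n \<times> E \<times> E\<close>. The last clause is
  \<open>s\<^sub>I = s\<^sub>J\<close> on \<open>Y\<^sub>I \<inter> Y\<^sub>J\<close>: an element of the fibre of the twisting bundle is an equivariant
  function on an orbit of the semidirect product of \<open>S\<^sub>k \<times> S\<^sub>n\<^sub>-\<^sub>k\<close> with the lattice (the permutations
  acting without factor), and \<open>s I\<close>, \<open>s J\<close> give its values at two points of that orbit.
  The bundle pulled back by \<open>p\<^sub>T\<close> contributes no factor, both values being taken over the same
  \<open>x\<close>.\<close>

definition admissible_mero_sect :: "complex \<Rightarrow> nat \<Rightarrow> 'n::{finite,linorder} coord factor \<Rightarrow>
    ('n set \<Rightarrow> complex^'n coord \<Rightarrow> complex) \<Rightarrow> bool" where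
  "admissible_mero_sect \<tau> k L s \<longleftrightarrow> line_bundle \<tau> L \<and>
     (\<forall>K. card K = k \<longrightarrow> mero_sect \<tau> (L \<otimes>\<^sub>L twist_on \<tau> k K) (s K)) \<and>
     (\<forall>S. S \<noteq> {} \<longrightarrow> (\<forall>K\<in>S. card K = k) \<longrightarrow>
        (\<forall>Z. irred_component \<tau> Z (Y_inter \<tau> k S) \<longrightarrow> (\<forall>K\<in>S. \<not> Z \<subseteq> polar_set (s K)))) \<and>
     (\<forall>I J \<sigma> m l x. card I = k \<longrightarrow> card J = k \<longrightarrow> glued \<tau> k I J \<sigma> m l x \<longrightarrow>
        regular_at (s I) x \<longrightarrow> regular_at (s J) x \<longrightarrow>
        mero_value (s J) x =
          twist \<tau> k m l (perm_coord \<sigma> (chi_iota I x)) * mero_value (s I) x)"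

definition admissible_holo_sect :: "complex \<Rightarrow> nat \<Rightarrow> 'n::{finite,linorder} coord factor \<Rightarrow>
    ('n set \<Rightarrow> complex^'n coord \<Rightarrow> complex) \<Rightarrow> bool" where
  "admissible_holo_sect \<tau> k L s \<longleftrightarrow> admissible_mero_sect \<tau> k L s \<and>
     (\<forall>K. card K = k \<longrightarrow> (\<forall>x. regular_at (s K) x))"

section \<open>Weight functions\<close>

definition theta :: "complex \<Rightarrow> complex \<Rightarrow> complex" where
  "theta \<tau> z = sin (of_real pi * z) / of_real pi *
     prodinf (\<lambda>j. (1 - exp (2 * pi * \<i> * \<tau>) ^ Suc j * exp (2 * pi * \<i> * z)) *
                  (1 - exp (2 * pi * \<i> * \<tau>) ^ Suc j * exp (- (2 * pi * \<i> * z))) /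
                  (1 - exp (2 * pi * \<i> * \<tau>) ^ Suc j)\<^sup>2)"

definition n_above :: "'n::{finite,linorder} \<Rightarrow> 'n set \<Rightarrow> nat" where
  "n_above j I = card {l\<in>I. l > j}"

definition w_wt :: "'n::{finite,linorder} \<Rightarrow> 'n set \<Rightarrow> int" where
  "w_wt j I = int (n_above j I) - int (n_above j (- I))"

definition psi :: "complex \<Rightarrow> 'n::{finite,linorder} set \<Rightarrow> complex \<Rightarrow> complex \<Rightarrow> complex" where
  "psi \<tau> I y lam = (\<Prod>j\<in>I. theta \<tau> (lam - (of_int (w_wt j I) + 1) * y) *
                            theta \<tau> (lam - of_int (w_wt j I) * y))"

text \<open>The variables \<open>t\<^sub>1,\<dots>,t\<^sub>k\<close> are numbered from \<open>0\<close>, as are the elements of \<open>I\<close>.\<close>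

definition w_summand :: "complex \<Rightarrow> 'n::{finite,linorder} set \<Rightarrow> (nat \<Rightarrow> complex) \<Rightarrow>
    ('n \<Rightarrow> complex) \<Rightarrow> complex \<Rightarrow> complex \<Rightarrow> complex" where
  "w_summand \<tau> I t z y lam =
     (\<Prod>r<card I.
        (\<Prod>a | a < nth_elem I r. theta \<tau> (t r - z a + y)) *
        theta \<tau> (lam + t r - z (nth_elem I r) - of_int (w_wt (nth_elem I r) I) * y) *
        (\<Prod>a | a > nth_elem I r. theta \<tau> (t r - z a))) /
     (\<Prod>j<card I. \<Prod>i<j. theta \<tau> (t i - t j) * theta \<tau> (t j - t i + y))"

definition w_plus :: "complex \<Rightarrow> 'n::{finite,linorder} set \<Rightarrow> (nat \<Rightarrow> complex) \<Rightarrow>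
    ('n \<Rightarrow> complex) \<Rightarrow> complex \<Rightarrow> complex \<Rightarrow> complex" where
  "w_plus \<tau> I t z y lam = 1 / psi \<tau> I y lam *
     (\<Sum>\<sigma> | \<sigma> permutes {..<card I}. w_summand \<tau> I (t \<circ> \<sigma>) z y lam)"

text \<open>The restriction of \<open>c\<^sup>*w\<^sub>I\<^sup>+\<close> to \<open>Y\<^sub>J\<close>, obtained by setting \<open>t = z\<^sub>J\<close>; as a meromorphic function it is
  determined by this formula off the zeros of the denominators.\<close>

definition c_w_plus :: "complex \<Rightarrow> 'n::{finite,linorder} set \<Rightarrow> 'n set \<Rightarrow> complex^'n coord \<Rightarrow> complex" where
  "c_w_plus \<tau> I J x =
     w_plus \<tau> I (\<lambda>r. x $ Pt (nth_elem J r)) (\<lambda>a. x $ Pt a) (x $ Yc) (x $ Lc)"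

section \<open>Comparison with the defining properties\<close>

lemma LB_axis:
  fixes N :: "'p::finite \<Rightarrow> 'p \<Rightarrow> int"
  shows "LB \<tau> N v (axis j 1) 0 x = (- 1) powi N j j"
    and "LB \<tau> N v 0 (axis j 1) x = (- 1) powi N j j *
      exp (- (2 * pi * \<i> * ((\<Sum>k\<in>UNIV. of_int (N j k) * x $ k) + v $ j)) - pi * \<i> * \<tau> * of_int (N j j))"
proof -
  have *: "(\<Sum>i\<in>UNIV. g i * of_int (axis j 1 $ i :: int)) = g j" for g :: "'p \<Rightarrow> complex"
    by (simp add: axis_def if_distrib cong: if_cong)
  have **: "(\<Sum>i\<in>UNIV. g i * (axis j 1 $ i :: int)) = g j" for g :: "'p \<Rightarrow> int"
    by (simp add: axis_def if_distrib cong: if_cong)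
  have q: "(\<Sum>i\<in>UNIV. \<Sum>k\<in>UNIV. of_int (N i k) * of_int (axis j 1 $ i :: int) *
      of_int (axis j 1 $ k :: int)) = (of_int (N j j) :: complex)"
    unfolding * by (simp add: *)
  show "LB \<tau> N v (axis j 1) 0 x = (- 1) powi N j j"
    by (simp add: LB_def **)
  show "LB \<tau> N v 0 (axis j 1) x = (- 1) powi N j j *
      exp (- (2 * pi * \<i> * ((\<Sum>k\<in>UNIV. of_int (N j k) * x $ k) + v $ j)) - pi * \<i> * \<tau> * of_int (N j j))"
    using *[of "\<lambda>i. (\<Sum>k\<in>UNIV. of_int (N i k) * x $ k) + v $ i"] q
    by (simp add: LB_def ** mult.commute)
qed

lemma has_derivative_vec_nth': "((\<lambda>x. x $ k) has_derivative (\<lambda>v. v $ k)) (at (x::complex^'p::finite))"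
  by (rule bounded_linear_imp_has_derivative[OF bounded_linear_vec_nth])

lemma line_bundle_LB:
  fixes N :: "'p::finite \<Rightarrow> 'p \<Rightarrow> int"
  assumes sym: "\<And>i j. N i j = N j i"
  shows "line_bundle \<tau> (LB \<tau> N v)"
proof -
  have hol: "holo_on (LB \<tau> N v m l) UNIV" for m l
  proof -
    define A where "A = (\<lambda>x::complex^'p. (\<Sum>j\<in>UNIV. of_int (l $ j) * (\<Sum>k\<in>UNIV. of_int (N j k) * x $ k)))"
    obtain c d :: complex where cd: "LB \<tau> N v m l = (\<lambda>x. c * exp (- (2 * pi * \<i> * A x) + d))"
    proof
      show "LB \<tau> N v m l = (\<lambda>x. (- 1) powi (\<Sum>j\<in>UNIV. N j j * (m $ j + l $ j)) *
        exp (- (2 * pi * \<i> * A x) + (- (2 * pi * \<i> * (\<Sum>j\<in>UNIV. of_int (l $ j) * v $ j))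
          - pi * \<i> * \<tau> * (\<Sum>j\<in>UNIV. \<Sum>k\<in>UNIV. of_int (N j k * l $ j * l $ k)))))"
        by (rule ext) (simp add: LB_def A_def distrib_left sum.distrib algebra_simps)
    qed
    have dA: "(A has_derivative A) (at x)" for x
      unfolding A_def
      by (auto intro!: derivative_eq_intros has_derivative_vec_nth' sum.cong)
    have sA: "A (r *s u) = r * A u" for r u
      by (simp add: A_def sum_distrib_left mult_ac)
    have "((\<lambda>x. c * exp (- (2 * pi * \<i> * A x) + d)) has_derivative
        (\<lambda>u. c * (exp (- (2 * pi * \<i> * A x) + d) * (- (2 * pi * \<i> * A u))))) (at x)" for x
    proof -
      have "(exp has_derivative (*) (exp y)) (at y)" for y :: complex
        using DERIV_exp[of y] by (simp add: has_field_derivative_def)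
      moreover have "((\<lambda>x. - (2 * pi * \<i> * A x) + d) has_derivative
          (\<lambda>u. - (2 * pi * \<i> * A u))) (at x)"
        by (auto intro!: derivative_eq_intros dA)
      ultimately show ?thesis
        by (intro has_derivative_mult_right) (rule has_derivative_compose)
    qed
    then show ?thesis
      unfolding holo_on_def cd
      by (intro conjI ballI open_UNIV exI) (auto simp: sA)
  qed
  have coc: "LB \<tau> N v (m + m') (l + l') x = LB \<tau> N v m l (x + latvec \<tau> m' l') * LB \<tau> N v m' l' x"
    for m m' l l' x
  proof -
    define B where "B = (\<lambda>(f::'p\<Rightarrow>complex) g. \<Sum>j\<in>UNIV. \<Sum>k\<in>UNIV. of_int (N j k) * f j * g k)"
    define i where "i = (\<lambda>(u::int^'p) j. of_int (u $ j) :: complex)"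
    define V where "V = (\<lambda>f::'p\<Rightarrow>complex. \<Sum>j\<in>UNIV. f j * v $ j)"
    define D where "D = (\<lambda>u w. (\<Sum>j\<in>UNIV. N j j * (u $ j + w $ j)) :: int)"
    have LB: "LB \<tau> N v m l x = (- 1) powi D m l *
        exp (- (2 * pi * \<i> * (B (i l) (($) x) + V (i l))) - pi * \<i> * \<tau> * B (i l) (i l))" for m l x
      by (simp add: LB_def D_def B_def V_def i_def sum_distrib_left distrib_left sum.distrib mult_ac)
    have Bl: "B (\<lambda>j. f j + f' j) g = B f g + B f' g" for f f' g
      by (simp add: B_def algebra_simps sum.distrib)
    have Br: "B f (\<lambda>j. g j + g' j) = B f g + B f g'" for f g g'
      by (simp add: B_def algebra_simps sum.distrib)
    have Bs: "B f (\<lambda>j. g j * c) = B f g * c" for f g c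
      unfolding B_def sum_distrib_right by (simp add: mult_ac)
    have Bsym: "B f g = B g f" for f g
      unfolding B_def by (subst sum.swap) (simp add: sym mult_ac)
    have Vl: "V (\<lambda>j. f j + f' j) = V f + V f'" for f f'
      by (simp add: V_def algebra_simps sum.distrib)
    have il: "i (l + l') = (\<lambda>j. i l j + i l' j)" for l l'
      by (simp add: i_def)
    have nx: "($) (x + latvec \<tau> m' l') = (\<lambda>j. x $ j + (i m' j + i l' j * \<tau>))"
      by (simp add: latvec_def i_def fun_eq_iff)
    have Bint: "B (i l) (i m') = of_int (\<Sum>j\<in>UNIV. \<Sum>k\<in>UNIV. N j k * l $ j * m' $ k)"
      by (simp add: B_def i_def)
    have one: "exp (- (2 * pi * \<i> * B (i l) (i m'))) = 1"
    proof -
      have "exp (2 * of_int n * pi * \<i>) = 1" for n :: int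
        by (rule exp_integer_2pi) simp
      from this[of "- (\<Sum>j\<in>UNIV. \<Sum>k\<in>UNIV. N j k * l $ j * m' $ k)"] show ?thesis
        unfolding Bint by (simp add: mult_ac)
    qed
    have D: "D (m + m') (l + l') = D m l + D m' l'"
      by (simp add: D_def algebra_simps sum.distrib)
    have e: "exp (a + b) = exp a" if "exp b = 1" for a b :: complex
      using that by (simp add: exp_add)
    have "exp (- (2 * pi * \<i> * (B (i l) (($) (x + latvec \<tau> m' l')) + V (i l))) - pi * \<i> * \<tau> * B (i l) (i l)) *
          exp (- (2 * pi * \<i> * (B (i l') (($) x) + V (i l'))) - pi * \<i> * \<tau> * B (i l') (i l')) =
          exp ((- (2 * pi * \<i> * (B (i (l + l')) (($) x) + V (i (l + l')))) -
                  pi * \<i> * \<tau> * B (i (l + l')) (i (l + l'))) + - (2 * pi * \<i> * B (i l) (i m')))"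
      unfolding exp_add[symmetric] nx il Bl Br Bs Vl Bsym[of "i l'" "i l"]
      by (rule arg_cong[of _ _ exp]) (simp add: algebra_simps)
    then show ?thesis
      unfolding LB D e[OF one] by (simp add: power_int_add mult_ac)
  qed
  have "LB \<tau> N v m l x \<noteq> 0" for m l x
    by (simp add: LB_def)
  with hol coc show ?thesis
    unfolding line_bundle_def by blast
qed

lemma posn_strict_mono: "a < b \<Longrightarrow> posn a < posn b"
  unfolding posn_def by (rule psubset_card_mono) (auto simp: psubset_eq)

lemma inj_posn: "inj posn"
  by (rule injI) (metis linorder_neqE less_irrefl posn_strict_mono)

lemma range_posn: "range (posn :: 'n::{finite,linorder} \<Rightarrow> nat) = {..<CARD('n)}"
proof (rule card_subset_eq)
  have "posn a < CARD('n)" for a :: 'n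
    unfolding posn_def by (rule psubset_card_mono) auto
  then show "range (posn :: 'n \<Rightarrow> nat) \<subseteq> {..<CARD('n)}" by auto
  show "card (range (posn :: 'n \<Rightarrow> nat)) = card {..<CARD('n)}"
    by (simp add: card_image inj_posn)
qed simp

lemma card_posn_less:
  assumes "k \<le> CARD('n::{finite,linorder})"
  shows "card {j::'n. posn j < k} = k"
proof -
  have "posn ` {j::'n. posn j < k} = {..<k}"
    using range_posn[where 'n='n] assms by (auto simp: set_eq_iff image_iff) (metis less_le_trans)
  then show ?thesis
    by (metis card_image card_lessThan inj_posn inj_on_subset subset_UNIV)
qed

lemma sum_coord:
  fixes f :: "'n::finite coord \<Rightarrow> 'b::comm_monoid_add"
  shows "(\<Sum>c\<in>UNIV. f c) = f Yc + (f Lc + (\<Sum>j\<in>UNIV. f (Pt j)))"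
proof -
  have "sum f (range Pt) = (\<Sum>j\<in>UNIV. f (Pt j))"
    by (simp add: sum.reindex inj_def)
  then show ?thesis
    unfolding UNIV_coord by (subst sum.insert; (subst sum.insert)?; auto)
qed

lemma N_kn_sym: "N_kn k c d = N_kn k d c"
  by (cases c; cases d) auto

lemma quad_form_N_kn:
  fixes x :: "complex^'n::{finite,linorder} coord"
  assumes k: "k \<le> CARD('n)"
  shows "quad_form (N_kn k) x =
     2 * (\<Sum>i | posn i < k. x $ Pt i * (x $ Lc + of_nat (CARD('n) - k) * x $ Yc)) +
     (\<Sum>i | posn i < k. \<Sum>j | \<not> posn j < k. (x $ Pt i - x $ Pt j)\<^sup>2)"
proof -
  define A where "A = {i::'n. posn i < k}"
  define B where "B = {i::'n. \<not> posn i < k}"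
  define u where "u = (\<lambda>i. x $ Pt i)"
  have cA: "card A = k" unfolding A_def by (rule card_posn_less[OF k])
  have B: "B = - A" by (auto simp: A_def B_def)
  have cB: "card B = CARD('n) - k"
    unfolding B Compl_eq_Diff_UNIV using cA by (simp add: card_Diff_subset)
  have split: "(\<Sum>i\<in>UNIV. f i) = (\<Sum>i\<in>A. f i) + (\<Sum>i\<in>B. f i)" for f :: "'n \<Rightarrow> complex"
    unfolding B by (metis Compl_partition finite sum.union_disjoint Compl_disjoint)
  have nA: "posn i < k" if "i \<in> A" for i using that by (simp add: A_def)
  have nB: "\<not> posn i < k" if "i \<in> B" for i using that by (simp add: B_def)
  have kk: "of_int (int CARD('n) - int k) = (of_nat (CARD('n) - k) :: complex)"
    using k by (simp add: of_nat_diff)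
  define c :: complex where "c = of_nat (CARD('n) - k)"
  define M where "M = (\<lambda>i j. of_int (N_kn k (Pt i) (Pt j)) * u i * u j)"
  have AA: "(\<Sum>i\<in>A. \<Sum>j\<in>A. M i j) = (\<Sum>i\<in>A. c * (u i)\<^sup>2)"
  proof (rule sum.cong[OF refl])
    fix i assume i: "i \<in> A"
    have "(\<Sum>j\<in>A. M i j) = (\<Sum>j\<in>A. if j = i then c * (u i)\<^sup>2 else 0)"
      by (rule sum.cong) (use i kk in \<open>auto simp: M_def nA power2_eq_square c_def\<close>)
    then show "(\<Sum>j\<in>A. M i j) = c * (u i)\<^sup>2" using i by simp
  qed
  have BB: "(\<Sum>i\<in>B. \<Sum>j\<in>B. M i j) = (\<Sum>i\<in>B. of_nat k * (u i)\<^sup>2)"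
  proof (rule sum.cong[OF refl])
    fix i assume i: "i \<in> B"
    have "(\<Sum>j\<in>B. M i j) = (\<Sum>j\<in>B. if j = i then of_nat k * (u i)\<^sup>2 else 0)"
      by (rule sum.cong) (use i in \<open>auto simp: M_def nB power2_eq_square\<close>)
    then show "(\<Sum>j\<in>B. M i j) = of_nat k * (u i)\<^sup>2" using i by simp
  qed
  have AB: "(\<Sum>i\<in>A. \<Sum>j\<in>B. M i j) = - (\<Sum>i\<in>A. \<Sum>j\<in>B. u i * u j)"
    unfolding sum_negf[symmetric] by (intro sum.cong refl) (simp add: M_def nA nB)
  have BA: "(\<Sum>i\<in>B. \<Sum>j\<in>A. M i j) = - (\<Sum>i\<in>A. \<Sum>j\<in>B. u i * u j)"
    unfolding sum_negf[symmetric] by (subst sum.swap) (intro sum.cong refl; simp add: M_def nA nB)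
  have pY: "(\<Sum>j\<in>UNIV. of_int (N_kn k Yc (Pt j)) * x $ Yc * x $ Pt j) = (\<Sum>j\<in>A. c * x $ Yc * u j)"
    "(\<Sum>j\<in>UNIV. of_int (N_kn k (Pt j) Yc) * x $ Pt j * x $ Yc) = (\<Sum>j\<in>A. c * x $ Yc * u j)"
    "(\<Sum>j\<in>UNIV. of_int (N_kn k Lc (Pt j)) * x $ Lc * x $ Pt j) = (\<Sum>j\<in>A. x $ Lc * u j)"
    "(\<Sum>j\<in>UNIV. of_int (N_kn k (Pt j) Lc) * x $ Pt j * x $ Lc) = (\<Sum>j\<in>A. x $ Lc * u j)"
    unfolding split using kk by (simp_all add: nA nB u_def c_def mult_ac)
  have "quad_form (N_kn k) x = (\<Sum>j\<in>A. c * x $ Yc * u j) + (\<Sum>j\<in>A. x $ Lc * u j) +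
      ((\<Sum>j\<in>A. c * x $ Yc * u j) + (\<Sum>j\<in>A. x $ Lc * u j)) + (\<Sum>i\<in>UNIV. \<Sum>j\<in>UNIV. M i j)"
    unfolding quad_form_def sum_coord sum.distrib pY by (simp add: M_def u_def)
  also have "(\<Sum>i\<in>UNIV. \<Sum>j\<in>UNIV. M i j) =
      (\<Sum>i\<in>A. c * (u i)\<^sup>2) + (\<Sum>i\<in>B. of_nat k * (u i)\<^sup>2) - 2 * (\<Sum>i\<in>A. \<Sum>j\<in>B. u i * u j)"
    unfolding split sum.distrib AA AB BA BB by simp
  also have "\<dots> = (\<Sum>i\<in>A. \<Sum>j\<in>B. (u i - u j)\<^sup>2)"
    by (simp add: power2_diff sum.distrib sum_subtractf cA cB c_def sum_distrib_left mult_ac)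
  finally have "quad_form (N_kn k) x = 2 * (\<Sum>i\<in>A. u i * (x $ Lc + c * x $ Yc)) +
      (\<Sum>i\<in>A. \<Sum>j\<in>B. (u i - u j)\<^sup>2)"
    by (simp add: sum.distrib distrib_left mult_ac sum_distrib_left)
  then show ?thesis by (simp add: A_def B_def u_def c_def)
qed

end

theory Submission
  imports Defs "HOL-Complex_Analysis.Complex_Singularities"
begin

text \<open>Over the common denominator \<open>D P\<close> with \<open>D = \<Prod>\<^sub>i\<^sub><\<^sub>j \<theta>(t\<^sub>i - t\<^sub>j)\<close> and \<open>P = \<Prod>\<^sub>i\<^sub>\<noteq>\<^sub>j \<theta>(t\<^sub>i - t\<^sub>j + y)\<close>, the
  symmetrised sum has an entire numerator \<open>A(t, z, y, \<lambda>)\<close>. It is alternating and quasi-periodic in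
  \<open>t\<close>, hence vanishes for \<open>t\<^sub>i - t\<^sub>j\<close> in the lattice, and \<open>A = D N\<close> with \<open>N\<close> entire. After setting \<open>t = z\<^sub>K\<close>,
  every summand either vanishes or has a numerator that cancels its denominators
  \<open>\<theta>(t\<^sub>j - t\<^sub>i + y)\<close>, so that \<open>A = P B\<close> and therefore \<open>N = P G\<^sub>K\<close> with \<open>G\<^sub>K\<close> entire: this is
  \<open>\<psi>\<^sub>I c\<^sup>*w\<^sub>I\<^sup>+\<close> on \<open>Y\<^sub>K\<close>. Since all \<open>G\<^sub>K P\<close> are restrictions of the single function \<open>N\<close>, which is symmetric
  and quasi-periodic in \<open>t\<close>, they agree on intersections, first where \<open>P \<noteq> 0\<close> and then
  everywhere by moving \<open>y\<close>. The poles in \<open>\<psi>\<^sub>I\<close> are harmless, as every irreducible component of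
  an intersection is a union of translates of a linear space that is a product with the
  \<open>(y, \<lambda>)\<close>-plane.\<close>

section \<open>Entire functions of several variables\<close>

text \<open>Dividing by D must come before the specialisation t = z_K: components are compared also
  at points where some z_a - z_b lie in the lattice, and there the restricted D may vanish. Hence N
  is built as an entire function of independent variables (t, s), z, y, \<lambda>. P is divided out
  only after restriction, where the summands supply the factors.

  Bundles are compared through quadratic forms: theta of an integral linear form f is a section for
  the form f^2. The summands can be added only if they lie in one bundle. This is what the shifts
  w(i_r, I) y achieve: in the form of a numerator the coefficient of 2 t_r y becomes n - k for every
  r. When (t, s) is a rearrangement of z, the form of N / P is that of the twist plus a form in z,
  y, \<lambda>; the latter minus the form of psi_I gives \<L>_I. For independent (t, s) extra terms
  appear. They vanish at rearrangements of z, but for a lattice translation from one rearrangement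
  to another it still has to be shown that their factor of automorphy is 1.\<close>

definition cdiff :: "(complex^'p::finite \<Rightarrow> complex) \<Rightarrow> complex^'p \<Rightarrow> bool" where
  "cdiff f x \<longleftrightarrow> (\<exists>D. (f has_derivative D) (at x) \<and> (\<forall>c v. D (c *s v) = c * D v))"

lemma holo_on_cdiff: "holo_on f U \<longleftrightarrow> open U \<and> (\<forall>x\<in>U. cdiff f x)"
  by (simp add: holo_on_def cdiff_def)

lemma cdiff_const [simp]: "cdiff (\<lambda>x. c) x"
  unfolding cdiff_def by (rule exI[of _ "\<lambda>_. 0"]) simp

lemma cdiff_nth [simp]: "cdiff (\<lambda>x. x $ i) x"
  unfolding cdiff_def by (rule exI[of _ "\<lambda>v. v $ i"]) (simp add: has_derivative_vec_nth')

lemma cdiff_add: "cdiff f x \<Longrightarrow> cdiff g x \<Longrightarrow> cdiff (\<lambda>x. f x + g x) x"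
  unfolding cdiff_def
  apply (elim exE conjE)
  subgoal for D D' by (rule exI[of _ "\<lambda>v. D v + D' v"]) (auto intro!: derivative_eq_intros simp: algebra_simps)
  done

lemma cdiff_mult: "cdiff f x \<Longrightarrow> cdiff g x \<Longrightarrow> cdiff (\<lambda>x. f x * g x) x"
  unfolding cdiff_def
  apply (elim exE conjE)
  subgoal for D D'
    by (rule exI[of _ "\<lambda>v. f x * D' v + D v * g x"]) (auto intro!: derivative_eq_intros simp: algebra_simps)
  done

lemma cdiff_chain:
  assumes "cdiff f x" "(g has_field_derivative d) (at (f x))"
  shows "cdiff (\<lambda>x. g (f x)) x"
proof -
  obtain D where D: "(f has_derivative D) (at x)" "\<And>c v. D (c *s v) = c * D v"
    using assms(1) by (auto simp: cdiff_def)
  have "((\<lambda>x. g (f x)) has_derivative (\<lambda>v. d * D v)) (at x)"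
    using has_derivative_compose[OF D(1), of g "(*) d"] assms(2)
    by (simp add: has_field_derivative_def)
  then show ?thesis unfolding cdiff_def by (intro exI[of _ "\<lambda>v. d * D v"]) (simp add: D)
qed

lemma cdiff_compose:
  fixes f :: "complex^'p::finite \<Rightarrow> complex" and h :: "complex^'q::finite \<Rightarrow> complex^'p"
  assumes h: "\<And>c. cdiff (\<lambda>x. h x $ c) x" and f: "cdiff f (h x)"
  shows "cdiff (\<lambda>x. f (h x)) x"
proof -
  obtain H where H: "\<And>c. ((\<lambda>x. h x $ c) has_derivative H c) (at x)" "\<And>c a v. H c (a *s v) = a * H c v"
    using h unfolding cdiff_def by metis
  obtain D where D: "(f has_derivative D) (at (h x))" "\<And>a v. D (a *s v) = a * D v"
    using f unfolding cdiff_def by metis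
  have "(h has_derivative (\<lambda>v. \<chi> c. H c v)) (at x)"
  proof (subst has_derivative_componentwise_within, intro ballI)
    fix b :: "complex^'p" assume "b \<in> Basis"
    then obtain c u where b: "b = axis c u" by (auto simp: Basis_vec_def)
    have "((\<lambda>x. h x $ c \<bullet> u) has_derivative (\<lambda>v. H c v \<bullet> u)) (at x)"
      by (intro has_derivative_inner_left H)
    then show "((\<lambda>x. h x \<bullet> b) has_derivative (\<lambda>v. (\<chi> c. H c v) \<bullet> b)) (at x)"
      by (simp add: b inner_axis)
  qed
  from has_derivative_compose[OF this D(1)]
  have "((\<lambda>x. f (h x)) has_derivative (\<lambda>v. D (\<chi> c. H c v))) (at x)" .
  moreover have "D (\<chi> c. H c (a *s v)) = a * D (\<chi> c. H c v)" for a v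
  proof -
    have "(\<chi> c. H c (a *s v)) = a *s (\<chi> c. H c v)" by (simp add: vec_eq_iff H)
    then show ?thesis by (simp add: D)
  qed
  ultimately show ?thesis unfolding cdiff_def by (intro exI[of _ "\<lambda>v. D (\<chi> c. H c v)"]) simp
qed

lemma cdiff_minus: "cdiff f x \<Longrightarrow> cdiff (\<lambda>x. - f x) x"
  using cdiff_mult[OF cdiff_const[of "-1"], of f x] by simp

lemma cdiff_diff: "cdiff f x \<Longrightarrow> cdiff g x \<Longrightarrow> cdiff (\<lambda>x. f x - g x) x"
  using cdiff_add[OF _ cdiff_minus, of f x g] by simp

lemma cdiff_inverse: "cdiff f x \<Longrightarrow> f x \<noteq> 0 \<Longrightarrow> cdiff (\<lambda>x. inverse (f x)) x"
  by (erule cdiff_chain) (rule DERIV_inverse)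

lemma cdiff_divide: "cdiff f x \<Longrightarrow> cdiff g x \<Longrightarrow> g x \<noteq> 0 \<Longrightarrow> cdiff (\<lambda>x. f x / g x) x"
  unfolding divide_inverse by (intro cdiff_mult cdiff_inverse)

lemma cdiff_sum: "(\<And>i. i \<in> A \<Longrightarrow> cdiff (f i) x) \<Longrightarrow> cdiff (\<lambda>x. \<Sum>i\<in>A. f i x) x"
  by (induction A rule: infinite_finite_induct) (auto intro!: cdiff_add)

lemma cdiff_prod: "(\<And>i. i \<in> A \<Longrightarrow> cdiff (f i) x) \<Longrightarrow> cdiff (\<lambda>x. \<Prod>i\<in>A. f i x) x"
  by (induction A rule: infinite_finite_induct) (auto intro!: cdiff_mult)

lemma cdiff_holomorphic:
  assumes "cdiff f x" "g holomorphic_on S" "open S" "f x \<in> S"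
  shows "cdiff (\<lambda>x. g (f x)) x"
  by (rule cdiff_chain[OF assms(1) holomorphic_derivI[OF assms(2,3,4)]])

lemma cdiff_transform:
  assumes "cdiff f x" "open U" "x \<in> U" "\<And>y. y \<in> U \<Longrightarrow> f y = g y"
  shows "cdiff g x"
  using assms unfolding cdiff_def by (metis has_derivative_transform_within_open)

lemma cdiff_continuous: "cdiff f x \<Longrightarrow> isCont f x"
  unfolding cdiff_def by (auto dest: has_derivative_continuous)

lemma holo_on_continuous: "holo_on f U \<Longrightarrow> continuous_on U f"
  by (auto simp: holo_on_cdiff intro!: continuous_at_imp_continuous_on cdiff_continuous)

abbreviation entire :: "(complex^'p::finite \<Rightarrow> complex) \<Rightarrow> bool" where
  "entire f \<equiv> holo_on f UNIV"

lemma entire_iff: "entire f \<longleftrightarrow> (\<forall>x. cdiff f x)"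
  by (simp add: holo_on_cdiff)

lemma entire_const: "entire (\<lambda>x. c)"
  and entire_nth: "entire (\<lambda>x. x $ i)"
  and entire_add: "entire f \<Longrightarrow> entire g \<Longrightarrow> entire (\<lambda>x. f x + g x)"
  and entire_diff: "entire f \<Longrightarrow> entire g \<Longrightarrow> entire (\<lambda>x. f x - g x)"
  and entire_minus: "entire f \<Longrightarrow> entire (\<lambda>x. - f x)"
  and entire_mult: "entire f \<Longrightarrow> entire g \<Longrightarrow> entire (\<lambda>x. f x * g x)"
  and entire_sum: "(\<And>i. i \<in> A \<Longrightarrow> entire (F i)) \<Longrightarrow> entire (\<lambda>x. \<Sum>i\<in>A. F i x)"
  and entire_prod: "(\<And>i. i \<in> A \<Longrightarrow> entire (F i)) \<Longrightarrow> entire (\<lambda>x. \<Prod>i\<in>A. F i x)"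
  for f g :: "complex^'p::finite \<Rightarrow> complex"
  by (auto simp: entire_iff intro!: cdiff_add cdiff_diff cdiff_minus cdiff_mult cdiff_sum cdiff_prod)

lemma entire_holomorphic:
  assumes "g holomorphic_on UNIV" "entire f"
  shows "entire (\<lambda>x. g (f x))"
  using assms by (auto simp: entire_iff intro!: cdiff_holomorphic[of f _ g UNIV])

lemmas entire_intros = entire_const entire_nth entire_add entire_diff entire_minus entire_mult
  entire_sum entire_prod

lemma entire_compose:
  assumes "entire f" "\<And>c. entire (\<lambda>x. h x $ c)"
  shows "entire (\<lambda>x. f (h x))"
  unfolding entire_iff
proof
  fix x show "cdiff (\<lambda>x. f (h x)) x"
    by (rule cdiff_compose) (use assms in \<open>auto simp: entire_iff\<close>)
qed

section \<open>Restriction to complex lines and the identity theorem\<close>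

lemma has_derivative_line: "((\<lambda>z. a + z *s b) has_derivative (\<lambda>w. w *s b)) (at z)"
  for a b :: "complex^'p::finite"
proof (subst has_derivative_componentwise_within, intro ballI)
  fix e :: "complex^'p" assume "e \<in> Basis"
  then obtain c u where e: "e = axis c u" by (auto simp: Basis_vec_def)
  show "((\<lambda>z. (a + z *s b) \<bullet> e) has_derivative (\<lambda>w. (w *s b) \<bullet> e)) (at z)"
    by (auto simp: e inner_axis intro!: derivative_eq_intros)
qed

lemma cdiff_line:
  assumes "cdiff f (a + z *s b)"
  shows "\<exists>d. ((\<lambda>z. f (a + z *s b)) has_field_derivative d) (at z)"
proof -
  obtain D where D: "(f has_derivative D) (at (a + z *s b))" "\<And>c v. D (c *s v) = c * D v"
    using assms by (auto simp: cdiff_def)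
  from has_derivative_compose[OF has_derivative_line D(1)] have
    "((\<lambda>z. f (a + z *s b)) has_derivative (\<lambda>w. D b * w)) (at z)"
    by (simp add: D(2) mult.commute)
  then show ?thesis by (auto simp: has_field_derivative_def)
qed

lemma line_holomorphic:
  assumes "\<And>z. z \<in> S \<Longrightarrow> cdiff f (a + z *s b)"
  shows "(\<lambda>z. f (a + z *s b)) holomorphic_on S"
  unfolding holomorphic_on_def field_differentiable_def
proof
  fix z assume "z \<in> S"
  from cdiff_line[OF assms[OF this]] show "\<exists>d. ((\<lambda>z. f (a + z *s b)) has_field_derivative d) (at z within S)"
    using has_field_derivative_at_within by blast
qed

lemma continuous_line: "continuous_on S (\<lambda>z. a + z *s b)" for a b :: "complex^'p::finite"
proof -
  have eq: "(\<lambda>z. a + z *s b) = (\<lambda>z. \<chi> i. a $ i + z * b $ i)"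
    by (simp add: fun_eq_iff vec_eq_iff)
  show ?thesis
    unfolding eq by (intro continuous_on_vec_lambda continuous_intros)
qed

text \<open>On the complex line joining \<open>a\<close> to \<open>x\<close> this is the identity
  theorem in one variable.\<close>

lemma entire_zero_if_zero_on_open:
  assumes f: "entire f" and U: "open U" "a \<in> U" "\<And>x. x \<in> U \<Longrightarrow> f x = 0"
  shows "f x = 0"
proof -
  define F where "F = (\<lambda>z. f (a + z *s (x - a)))"
  have hF: "F holomorphic_on UNIV"
    unfolding F_def by (rule line_holomorphic) (use f in \<open>simp add: entire_iff\<close>)
  have "open ((\<lambda>z. a + z *s (x - a)) -` U)"
    by (rule open_vimage[OF U(1) continuous_line])
  then obtain e where e: "e > 0" "ball 0 e \<subseteq> (\<lambda>z. a + z *s (x - a)) -` U"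
    using U(2) by (metis (no_types, lifting) add.right_neutral open_contains_ball vector_smult_lzero vimage_eq)
  have "F 1 = 0"
  proof (rule analytic_continuation_open[of "ball 0 e" UNIV F "\<lambda>_. 0"])
    show "ball (0::complex) e \<noteq> {}" using e(1) by auto
  qed (use e U hF in \<open>auto simp: F_def\<close>)
  then show ?thesis by (simp add: F_def)
qed

lemma interior_zeros_entire:
  assumes "entire f" "f a \<noteq> 0"
  shows "interior {x. f x = 0} = {}"
proof (rule ccontr)
  assume "interior {x. f x = 0} \<noteq> {}"
  then obtain b where "b \<in> interior {x. f x = 0}" by auto
  from entire_zero_if_zero_on_open[OF assms(1) open_interior this, of a] assms(2)
  show False using interior_subset by blast
qed

lemma closed_zeros_entire: "entire f \<Longrightarrow> closed {x. f x = 0}"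
  using continuous_closed_preimage_constant[OF holo_on_continuous, of f UNIV 0] by simp

text \<open>The set where two continuous functions differ is open, and the zeros of a nonzero entire
  function contain no nonempty open set. Cancelling an entire factor, or passing from generic to
  special points, rests on this.\<close>

lemma eq_off_zeros:
  assumes "entire h" "h a \<noteq> 0" "continuous_on U f" "continuous_on U g" "open U"
    "\<And>x. x \<in> U \<Longrightarrow> h x \<noteq> 0 \<Longrightarrow> f x = g x" "x \<in> U"
  shows "f x = (g x :: complex)"
proof (rule ccontr)
  assume ne: "f x \<noteq> g x"
  have "continuous_on U (\<lambda>x. f x - g x)" using assms by (intro continuous_intros)
  from continuous_open_preimage[OF this assms(5), of "- {0}"]
  have "open (U \<inter> (\<lambda>x. f x - g x) -` (- {0}))" by auto
  from entire_zero_if_zero_on_open[OF assms(1) this, of x a] show False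
    using ne assms by auto
qed

lemma entire_mult_cancel:
  assumes "entire h" "h a \<noteq> 0" "entire f" "entire g" "\<And>x. h x * f x = h x * g x"
  shows "f x = g x"
  by (rule eq_off_zeros[OF assms(1,2), of UNIV]) (use assms holo_on_continuous in auto)

text \<open>Entire functions have no zero divisors, so each factor may be tested at a point of its
  own.\<close>

lemma entire_prod_nonzero:
  assumes "finite A" "\<And>i. i \<in> A \<Longrightarrow> entire (f i)" "\<And>i. i \<in> A \<Longrightarrow> \<exists>a. f i a \<noteq> 0"
  shows "\<exists>a. (\<Prod>i\<in>A. f i a) \<noteq> 0"
  using assms
proof (induction A rule: finite_induct)
  case (insert i A)
  obtain a where a: "f i a \<noteq> 0" using insert.prems by blast
  obtain b where b: "(\<Prod>i\<in>A. f i b) \<noteq> 0" using insert.prems insert.IH by blast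
  have e: "entire (\<lambda>x. \<Prod>i\<in>A. f i x)" using insert by (auto intro: entire_intros)
  show ?case
  proof (rule ccontr)
    assume "\<not> ?thesis"
    then have "f i x * (\<Prod>i\<in>A. f i x) = f i x * 0" for x using insert by auto
    from entire_mult_cancel[OF _ a e entire_const this] insert.prems b show False by auto
  qed
qed auto

lemma entire_mult_nonzero:
  assumes "entire f" "entire g" "f a \<noteq> 0" "g b \<noteq> 0"
  shows "\<exists>c. f c * g c \<noteq> 0"
  using entire_mult_cancel[OF assms(1,3,2) entire_const[of 0]] assms(4)
  by (metis mult_eq_0_iff)

section \<open>Division by a function with simple zeros\<close>

definition circ :: "real \<Rightarrow> real \<Rightarrow> complex" where
  "circ r t = of_real r * exp (2 * of_real pi * \<i> * of_real t)"

lemma norm_circ [simp]: "norm (circ r t) = \<bar>r\<bar>"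
  by (simp add: circ_def norm_mult)

lemma continuous_circ [continuous_intros]:
  "continuous_on S f \<Longrightarrow> continuous_on S (\<lambda>x. circ r (f x))"
  unfolding circ_def by (intro continuous_intros)

text \<open>On the circle dz = 2 pi i z dt, which absorbs one power of the denominator: k = 0 is the
  mean value property, k = 1 gives the derivative.\<close>

lemma has_integral_circ_deriv:
  assumes "f holomorphic_on cball 0 r" "0 < r"
  shows "((\<lambda>t. f (circ r t) / circ r t ^ k) has_integral ((deriv ^^ k) f 0 / fact k)) {0..1}"
proof -
  have "((\<lambda>u. f u / (u - 0) ^ Suc k) has_contour_integral ((2 * pi * \<i>) / fact k * (deriv ^^ k) f 0)) (circlepath 0 r)"
    using assms by (intro Cauchy_has_contour_integral_higher_derivative_circlepath)
      (auto intro: holomorphic_on_imp_continuous_on holomorphic_on_subset)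
  then have "((\<lambda>t. f (circlepath 0 r t) / (circlepath 0 r t - 0) ^ Suc k *
      vector_derivative (circlepath 0 r) (at t within {0..1})) has_integral
      ((2 * pi * \<i>) / fact k * (deriv ^^ k) f 0)) {0..1}"
    by (simp add: has_contour_integral_def)
  from has_integral_mult_right[OF this, of "1 / (2 * pi * \<i>)"]
  have "((\<lambda>t. 1 / (2 * pi * \<i>) * (f (circlepath 0 r t) / (circlepath 0 r t - 0) ^ Suc k *
      vector_derivative (circlepath 0 r) (at t within {0..1}))) has_integral
      ((deriv ^^ k) f 0 / fact k)) {0..1}"
    by simp
  then show ?thesis
  proof (rule has_integral_eq[rotated])
    fix t :: real assume "t \<in> {0..1}"
    then have vd: "vector_derivative (circlepath 0 r) (at t within {0..1}) =
        2 * pi * \<i> * r * exp (2 * of_real pi * \<i> * t)"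
      using vector_derivative_circlepath01[of t 0 r] by simp
    show "1 / (2 * pi * \<i>) * (f (circlepath 0 r t) / (circlepath 0 r t - 0) ^ Suc k *
      vector_derivative (circlepath 0 r) (at t within {0..1})) = f (circ r t) / circ r t ^ k"
      using assms(2) unfolding vd by (simp add: circlepath circ_def)
  qed
qed

lemma norm_smult_axis: "norm (z *s axis i (1::complex)) \<le> norm z"
proof -
  have "norm (z *s axis i (1::complex)) \<le> (\<Sum>j\<in>UNIV. norm ((z *s axis i (1::complex)) $ j))"
    unfolding norm_vec_def by (rule L2_set_le_sum) simp
  also have "\<dots> = (\<Sum>j\<in>UNIV. if j = i then norm z else 0)"
    by (rule sum.cong) (auto simp: axis_def)
  finally show ?thesis by simp
qed

lemma vec_as_sum_axis: "v = (\<Sum>i\<in>UNIV. v $ i *s axis i (1::complex))"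
  by (simp add: vec_eq_iff axis_def if_distrib cong: if_cong)

text \<open>Cauchy's formula in each variable shows that the partial derivatives are jointly continuous,
  which is what the Leibniz rule of the library asks for.\<close>

lemma holo_on_integral:
  fixes F :: "complex^'p::finite \<Rightarrow> real \<Rightarrow> complex"
  assumes U: "open U"
    and cont: "continuous_on (U \<times> {0..1}) (\<lambda>(x, t). F x t)"
    and hol: "\<And>t. t \<in> {0..1} \<Longrightarrow> holo_on (\<lambda>x. F x t) U"
  shows "holo_on (\<lambda>x. integral {0..1} (F x)) U"
  unfolding holo_on_cdiff
proof (intro conjI ballI U)
  fix x0 assume "x0 \<in> U"
  then obtain e where e: "e > 0" "cball x0 e \<subseteq> U" using U open_contains_cball by blast
  \<comment> \<open>Half the radius leaves room to move from a point of the ball by a further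
    \<open>r\<close> in a coordinate direction.\<close>
  define r where "r = e / 2"
  have r: "r > 0" using e by (simp add: r_def)
  have inU: "x + z *s axis i 1 \<in> U" if "x \<in> ball x0 r" "norm z \<le> r" for x z i
  proof -
    have "dist x0 (x + z *s axis i 1) \<le> dist x0 x + norm (z *s axis i (1::complex))"
      by (metis dist_triangle dist_norm norm_minus_commute add_diff_cancel_left')
    also have "\<dots> \<le> r + r" using that norm_smult_axis[of z i] by (intro add_mono) auto
    finally show ?thesis using e by (auto simp: r_def)
  qed
  define pd where "pd = (\<lambda>i (x, t). integral {0..1} (\<lambda>s. F (x + circ r s *s axis i 1) t / circ r s))"
  have cont_pd: "continuous_on (ball x0 r \<times> {0..1}) (pd i)" for i
  proof -
    have "continuous_on ((ball x0 r \<times> {0..1}) \<times> cbox 0 1)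
       (\<lambda>(p, s). F (fst p + circ r s *s axis i 1) (snd p) / circ r s)"
      unfolding case_prod_beta
    proof (intro continuous_intros)
      have 1: "continuous_on ((ball x0 r \<times> {0..1}) \<times> cbox 0 1)
        (\<lambda>q. (fst (fst q) + circ r (snd q) *s axis i 1, snd (fst q)))"
      proof -
        have eq: "(\<lambda>q. fst (fst q) + circ r (snd q) *s axis i 1) =
          (\<lambda>q. \<chi> j. fst (fst q) $ j + circ r (snd q) * axis i 1 $ j)"
          by (simp add: fun_eq_iff vec_eq_iff)
        have "continuous_on ((ball x0 r \<times> {0..1}) \<times> cbox 0 1)
            (\<lambda>q. fst (fst q) + circ r (snd q) *s axis i 1)"
          unfolding eq by (intro continuous_intros continuous_on_vec_lambda)
        then show ?thesis by (intro continuous_on_Pair continuous_on_snd continuous_on_fst continuous_on_id)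
      qed
      have 2: "(\<lambda>q. (fst (fst q) + circ r (snd q) *s axis i 1, snd (fst q))) `
          ((ball x0 r \<times> {0..1}) \<times> cbox 0 1) \<subseteq> U \<times> {0..1}"
        using inU r by auto
      show "continuous_on ((ball x0 r \<times> {0..1}) \<times> cbox 0 1)
         (\<lambda>q. F (fst (fst q) + circ r (snd q) *s axis i 1) (snd (fst q)))"
        using continuous_on_compose2[OF cont 1 2] by simp
    qed (use r in \<open>auto simp: circ_def\<close>)
    from integral_continuous_on_param[OF this]
    show ?thesis by (simp add: pd_def case_prod_beta)
  qed
  have der: "((\<lambda>x. F x t) has_derivative (\<lambda>v. \<Sum>i\<in>UNIV. v $ i * pd i (x, t))) (at x)"
    if x: "x \<in> ball x0 r" and t: "t \<in> {0..1}" for x t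
  proof -
    have xU: "x \<in> U" using inU[OF x, of 0] r by simp
    have "cdiff (\<lambda>x. F x t) x" using hol[OF t] xU by (simp add: holo_on_cdiff)
    then obtain D where D: "((\<lambda>x. F x t) has_derivative D) (at x)" "\<And>c v. D (c *s v) = c * D v"
      by (auto simp: cdiff_def)
    have lin: "linear D" using D(1) has_derivative_linear by blast
    have Di: "D (axis i 1) = pd i (x, t)" for i
    proof -
      have "(\<lambda>z. F (x + z *s axis i 1) t) holomorphic_on cball 0 r"
        using inU[OF x] hol[OF t] by (intro line_holomorphic) (auto simp: holo_on_cdiff)
      from has_integral_circ_deriv[OF this r, of 1]
      have "pd i (x, t) = deriv (\<lambda>z. F (x + z *s axis i 1) t) 0"
        unfolding pd_def by (auto intro: integral_unique)
      also have "\<dots> = D (axis i 1)"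
      proof (rule DERIV_imp_deriv)
        from has_derivative_compose[OF has_derivative_line[of x "axis i 1" 0], of "\<lambda>x. F x t" D] D(1)
        show "((\<lambda>z. F (x + z *s axis i 1) t) has_field_derivative D (axis i 1)) (at 0)"
          by (simp add: has_field_derivative_def D(2) mult_commute_abs)
      qed
      finally show ?thesis by simp
    qed
    have "D v = (\<Sum>i\<in>UNIV. v $ i * pd i (x, t))" for v
    proof -
      have "D v = D (\<Sum>i\<in>UNIV. v $ i *s axis i 1)" by (simp flip: vec_as_sum_axis)
      also have "\<dots> = (\<Sum>i\<in>UNIV. v $ i * pd i (x, t))"
        by (simp add: linear_sum[OF lin] D(2) Di)
      finally show ?thesis .
    qed
    then have "D = (\<lambda>v. \<Sum>i\<in>UNIV. v $ i * pd i (x, t))" by auto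
    with D(1) show ?thesis by simp
  qed
  \<comment> \<open>The derivative as a bounded linear map, the form in which the Leibniz rule takes
    it.\<close>
  define fx :: "complex^'p \<Rightarrow> real \<Rightarrow> ((complex^'p) \<Rightarrow>\<^sub>L complex)" where
    "fx = (\<lambda>x t. \<Sum>i\<in>UNIV. blinfun_mult_right (pd i (x, t)) o\<^sub>L Blinfun (\<lambda>v. v $ i))"
  have fx: "blinfun_apply (fx x t) v = (\<Sum>i\<in>UNIV. v $ i * pd i (x, t))" for x t v
    by (simp add: fx_def blinfun.sum_left bounded_linear_Blinfun_apply bounded_linear_vec_nth mult.commute)
  have cont_fx: "continuous_on (ball x0 r \<times> cbox 0 1) (\<lambda>(x, t). fx x t)"
    unfolding fx_def case_prod_beta
    by (intro continuous_on_sum bounded_bilinear.continuous_on[OF bounded_bilinear_blinfun_compose]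
        bounded_linear.continuous_on[OF bounded_linear_blinfun_mult_right] continuous_on_const)
      (use cont_pd in \<open>simp add: cbox_interval\<close>)
  have intF: "F x integrable_on cbox 0 1" if "x \<in> ball x0 r" for x
  proof (rule integrable_continuous)
    have "x \<in> U" using inU[OF that, of 0] r by simp
    then show "continuous_on (cbox 0 1) (F x)"
      using continuous_on_compose2[OF cont continuous_on_Pair[OF continuous_on_const continuous_on_id], where s = "cbox 0 1"]
      by (auto simp: image_subset_iff)
  qed
  have "((\<lambda>x. integral (cbox 0 1) (F x)) has_derivative blinfun_apply (integral (cbox 0 1) (fx x0)))
      (at x0 within ball x0 r)"
  proof (rule leibniz_rule[OF _ intF cont_fx])
    fix x t assume "x \<in> ball x0 r" "t \<in> cbox 0 (1::real)"
    then show "((\<lambda>x. F x t) has_derivative blinfun_apply (fx x t)) (at x within ball x0 r)"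
      using der[of x t] by (simp add: fx[abs_def] has_derivative_at_withinI)
  qed (use r in auto)
  then have d: "((\<lambda>x. integral {0..1} (F x)) has_derivative blinfun_apply (integral {0..1} (fx x0))) (at x0)"
    using r by (simp add: at_within_open[of x0 "ball x0 r"])
  have "continuous_on {0..1} (fx x0)"
    using continuous_on_compose2[OF cont_fx continuous_on_Pair[OF continuous_on_const continuous_on_id], where s = "{0..1}"] r
    by (auto simp: image_subset_iff)
  then have "fx x0 integrable_on {0..1}" by (rule integrable_continuous_real)
  then have "blinfun_apply (integral {0..1} (fx x0)) v = integral {0..1} (\<lambda>t. \<Sum>i\<in>UNIV. v $ i * pd i (x0, t))" for v
    by (simp add: blinfun_apply_integral fx)
  then have "blinfun_apply (integral {0..1} (fx x0)) (c *s v) = c * blinfun_apply (integral {0..1} (fx x0)) v" for c v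
    by (simp add: sum_distrib_left[symmetric] mult.assoc)
  with d show "cdiff (\<lambda>x. integral {0..1} (F x)) x0" unfolding cdiff_def by blast
qed

text \<open>At a zero \<open>a\<close> of \<open>v\<close> both functions are divisible by z - a,
  and what is left of \<open>v\<close> is nonzero at \<open>a\<close> since the zero is simple. The
  quotient of the two difference quotients therefore extends u / v.\<close>

lemma holomorphic_divide_simple_zeros:
  assumes u: "u holomorphic_on UNIV" and v: "v holomorphic_on UNIV"
    and simple: "\<And>z. v z = 0 \<Longrightarrow> deriv v z \<noteq> 0" and van: "\<And>z. v z = 0 \<Longrightarrow> u z = 0"
  obtains k where "k holomorphic_on UNIV" "\<And>z. u z = v z * k z"
proof -
  define k where "k = (\<lambda>z. if v z = 0 then deriv u z / deriv v z else u z / v z)"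
  have "k field_differentiable at a" for a
  proof (cases "v a = 0")
    case False
    have "open {z. v z \<noteq> 0}"
      using v by (intro open_Collect_neq holomorphic_on_imp_continuous_on) auto
    moreover have "(\<lambda>z. u z / v z) field_differentiable at a"
      using u v False by (intro field_differentiable_divide) (auto simp: holomorphic_on_def)
    ultimately show ?thesis
      using False unfolding field_differentiable_def
      using has_field_derivative_transform_within_open[of "\<lambda>z. u z / v z" _ a "{z. v z \<noteq> 0}" k]
      by (auto simp: k_def)
  next
    case True
    define q where "q = (\<lambda>f z. if z = a then deriv f a else f z / (z - a) - f a / (z - a) :: complex)"
    have q: "q f holomorphic_on UNIV" if "f holomorphic_on UNIV" for f
      unfolding q_def by (rule pole_theorem[OF that]) auto
    have cq: "open {z. q v z \<noteq> 0}"
      using q[OF v] by (intro open_Collect_neq holomorphic_on_imp_continuous_on) auto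
    have a: "a \<in> {z. q v z \<noteq> 0}" using simple[OF True] by (simp add: q_def)
    have "(\<lambda>z. q u z / q v z) field_differentiable at a"
      using q[OF u] q[OF v] a by (intro field_differentiable_divide) (auto simp: holomorphic_on_def)
    then obtain d where "((\<lambda>z. q u z / q v z) has_field_derivative d) (at a)"
      by (auto simp: field_differentiable_def)
    moreover have "q u z / q v z = k z" if "z \<in> {z. q v z \<noteq> 0}" for z
      using that True van[of a] by (auto simp: q_def k_def)
    ultimately show ?thesis
      using has_field_derivative_transform_within_open[OF _ cq a] unfolding field_differentiable_def by blast
  qed
  then have "k holomorphic_on UNIV" by (simp add: holomorphic_on_def)
  moreover have "u z = v z * k z" for z using van[of z] by (simp add: k_def)
  ultimately show ?thesis by (rule that)
qed

text \<open>Since \<open>l\<close> has unit slope along \<open>e\<close>, one-variable division on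
  each line in direction \<open>e\<close> defines the quotient pointwise. Holomorphy in all
  variables comes from the mean value property: near \<open>x0\<close> the quotient is the average
  of f / h(l) over a circle in direction \<open>e\<close> that avoids the zeros, and this average is
  a holomorphic parameter integral.\<close>

lemma entire_divide_simple_zeros:
  fixes f :: "complex^'p::finite \<Rightarrow> complex"
  assumes f: "entire f" and l: "entire l" and h: "h holomorphic_on UNIV"
    and simple: "\<And>z. h z = 0 \<Longrightarrow> deriv h z \<noteq> 0"
    and dir: "\<And>x z. l (x + z *s e) = l x + z"
    and van: "\<And>x. h (l x) = 0 \<Longrightarrow> f x = 0"
  obtains g where "entire g" "\<And>x. f x = h (l x) * g x"
proof -
  have "\<exists>k. k holomorphic_on UNIV \<and> (\<forall>z. f (x + z *s e) = h (l x + z) * k z)" for x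
  proof -
    have 1: "(\<lambda>z. f (x + z *s e)) holomorphic_on UNIV"
      using f by (intro line_holomorphic) (simp add: entire_iff)
    have 2: "(\<lambda>z. h (l x + z)) holomorphic_on UNIV"
      by (rule holomorphic_on_compose_gen[OF _ h, unfolded o_def]) (auto intro!: holomorphic_intros)
    have 3: "deriv (\<lambda>z. h (l x + z)) z = deriv h (l x + z)" for z
    proof (rule DERIV_imp_deriv)
      have "(h has_field_derivative deriv h (z + l x)) (at (z + l x))"
        using h by (intro holomorphic_derivI) auto
      then show "((\<lambda>z. h (l x + z)) has_field_derivative deriv h (l x + z)) (at z)"
        by (simp add: DERIV_shift add.commute)
    qed
    show ?thesis
      using holomorphic_divide_simple_zeros[OF 1 2] simple van 3 dir by (metis (no_types, lifting))
  qed
  then obtain k where k: "\<And>x. k x holomorphic_on UNIV" "\<And>x z. f (x + z *s e) = h (l x + z) * k x z"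
    by metis
  define g where "g = (\<lambda>x. k x 0)"
  have "cdiff g x0" for x0
  proof -
    obtain b where b: "h b \<noteq> 0"
    proof (rule ccontr)
      assume "\<not> thesis"
      then have "h = (\<lambda>z. 0)" using that by blast
      then show False using simple[of 0] by simp
    qed
    have "\<forall>\<^sub>F w in at (l x0). h w \<noteq> 0 \<and> w \<in> UNIV"
      by (rule non_zero_neighbour_alt[OF h _ _ _ _ b]) auto
    then obtain d where d: "d > 0" "\<And>w. w \<noteq> l x0 \<Longrightarrow> dist w (l x0) < d \<Longrightarrow> h w \<noteq> 0"
      by (auto simp: eventually_at)
    \<comment> \<open>For \<open>l x\<close> within \<open>r\<close> of \<open>l x0\<close>, the
      circle of radius \<open>r\<close> about \<open>l x\<close> misses \<open>l x0\<close> and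
      stays in the punctured disc of radius \<open>d\<close> about it, where \<open>h\<close> has no
      zeros.\<close>
    define r where "r = d / 2"
    have r: "r > 0" using d by (simp add: r_def)
    define V where "V = {x. dist (l x) (l x0) < r}"
    have cl: "continuous_on UNIV l" using holo_on_continuous[OF l] .
    have V: "open V"
      unfolding V_def by (intro open_Collect_less continuous_intros cl)
    have nz: "h (l x + circ r t) \<noteq> 0" if "x \<in> V" for x t
    proof (rule d(2))
      have *: "dist (l x) (l x0) < r" using that by (simp add: V_def)
      have "norm (circ r t) = r" using r by simp
      then show "l x + circ r t \<noteq> l x0"
        using * by (metis add_diff_cancel_left' dist_commute dist_norm less_irrefl)
      have "dist (l x + circ r t) (l x0) \<le> norm (circ r t) + dist (l x) (l x0)"
        by (metis add.commute dist_norm group_cancel.sub1 norm_triangle_ineq)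
      then show "dist (l x + circ r t) (l x0) < d" using * r by (simp add: r_def)
    qed
    define F where "F = (\<lambda>x t. f (x + circ r t *s e) / h (l x + circ r t))"
    have gF: "integral {0..1} (F x) = g x" if "x \<in> V" for x
    proof -
      have "k x holomorphic_on cball 0 r" using k(1) holomorphic_on_subset by blast
      from has_integral_circ_deriv[OF this r, of 0]
      have "integral {0..1} (\<lambda>t. k x (circ r t)) = g x" by (simp add: g_def integral_unique)
      moreover have "F x = (\<lambda>t. k x (circ r t))"
        using nz[OF that] by (simp add: F_def k(2))
      ultimately show ?thesis by simp
    qed
    have "holo_on (\<lambda>x. integral {0..1} (F x)) V"
    proof (rule holo_on_integral[OF V])
      have *: "continuous_on (V \<times> {0..1}) (\<lambda>p. fst p + circ r (snd p) *s e)"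
      proof -
        have "(\<lambda>p. fst p + circ r (snd p) *s e) = (\<lambda>p. \<chi> j. fst p $ j + circ r (snd p) * e $ j)"
          by (simp add: fun_eq_iff vec_eq_iff)
        then show ?thesis by (simp only:) (intro continuous_intros continuous_on_vec_lambda)
      qed
      have ch: "continuous_on UNIV h" using h by (rule holomorphic_on_imp_continuous_on)
      show "continuous_on (V \<times> {0..1}) (\<lambda>(x, t). F x t)"
        unfolding F_def case_prod_beta
        by (intro continuous_intros continuous_on_compose2[OF holo_on_continuous[OF f] *]
            continuous_on_compose2[OF ch] continuous_on_compose2[OF cl]) (use nz in auto)
      fix t :: real
      show "holo_on (\<lambda>x. F x t) V"
        unfolding holo_on_cdiff F_def
      proof (intro conjI ballI V cdiff_divide)
        fix x assume "x \<in> V"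
        show "cdiff (\<lambda>x. f (x + circ r t *s e)) x"
          by (rule cdiff_compose) (use f in \<open>auto simp: entire_iff intro!: cdiff_add\<close>)
        show "cdiff (\<lambda>x. h (l x + circ r t)) x"
          by (rule cdiff_holomorphic[OF _ h]) (use l in \<open>auto simp: entire_iff intro!: cdiff_add\<close>)
        show "h (l x + circ r t) \<noteq> 0" using nz \<open>x \<in> V\<close> .
      qed
    qed
    moreover have "x0 \<in> V" using r by (simp add: V_def)
    ultimately show ?thesis
      using cdiff_transform[of "\<lambda>x. integral {0..1} (F x)" x0 V g] V gF by (auto simp: holo_on_cdiff)
  qed
  then have "entire g" by (simp add: entire_iff)
  moreover have "f x = h (l x) * g x" for x using k(2)[of x 0] by (simp add: g_def)
  ultimately show ?thesis by (rule that)
qed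

section \<open>The theta function\<close>

abbreviation nome :: "complex \<Rightarrow> complex" where
  "nome \<tau> \<equiv> exp (2 * pi * \<i> * \<tau>)"

definition theta_fac :: "complex \<Rightarrow> nat \<Rightarrow> complex \<Rightarrow> complex" where
  "theta_fac \<tau> j z = (1 - nome \<tau> ^ Suc j * exp (2 * pi * \<i> * z)) *
     (1 - nome \<tau> ^ Suc j * exp (- (2 * pi * \<i> * z))) /
     (1 - nome \<tau> ^ Suc j)\<^sup>2"

lemma theta_eq: "theta \<tau> z = sin (of_real pi * z) / of_real pi * prodinf (\<lambda>j. theta_fac \<tau> j z)"
  by (simp add: theta_def theta_fac_def)

lemma norm_nome: "norm (nome \<tau>) = exp (- (2 * pi * Im \<tau>))"
  by simp

lemma norm_nome_less: "Im \<tau> > 0 \<Longrightarrow> norm (nome \<tau>) < 1"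
  unfolding norm_nome by simp

lemma one_minus_nome_power:
  assumes "Im \<tau> > 0"
  shows "1 - norm (nome \<tau>) \<le> norm (1 - nome \<tau> ^ Suc j)"
    and "nome \<tau> ^ Suc j \<noteq> 1"
proof -
  define q where "q = nome \<tau>"
  have q: "norm q < 1" using norm_nome_less[OF assms] by (simp add: q_def)
  have "norm q * norm q ^ j \<le> norm q * 1"
    using q by (intro mult_left_mono power_le_one) auto
  then have "norm (q ^ Suc j) \<le> norm q" by (simp add: norm_mult norm_power)
  then show *: "1 - norm q \<le> norm (1 - q ^ Suc j)"
    using norm_triangle_ineq2[of 1 "q ^ Suc j"] by simp
  show "q ^ Suc j \<noteq> 1" using * q by (metis diff_gt_0_iff_gt diff_self norm_zero not_le)
qed

text \<open>With u = e^{2 pi i z} and Q = q^{j+1} one has (1 - Qu)(1 - Q/u) - (1 - Q)^2 = Q(2 - u -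
  1/u), so the deviation from 1 is dominated by a geometric series, uniformly on bounded
  sets.\<close>

lemma norm_theta_fac:
  assumes "Im \<tau> > 0" "norm z \<le> B"
  shows "norm (theta_fac \<tau> j z - 1) \<le> (2 + 2 * exp (2 * pi * B)) / (1 - norm (nome \<tau>))\<^sup>2 *
     norm (nome \<tau>) ^ Suc j"
proof -
  define q where "q = nome \<tau>"
  define Q where "Q = q ^ Suc j"
  define u where "u = exp (2 * pi * \<i> * z)"
  have Q1: "1 - Q \<noteq> 0" using one_minus_nome_power(2)[OF assms(1), of j] by (simp add: Q_def q_def)
  have ui: "exp (- (2 * pi * \<i> * z)) = inverse u" by (simp add: u_def exp_minus)
  have u0: "u \<noteq> 0" by (simp add: u_def)
  have "theta_fac \<tau> j z = (1 - Q * u) * (1 - Q * inverse u) / (1 - Q)\<^sup>2"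
    unfolding theta_fac_def ui by (simp only: q_def Q_def u_def)
  moreover have "(1 - Q * u) * (1 - Q * inverse u) - (1 - Q)\<^sup>2 = Q * (2 - u - inverse u)"
    using u0 by (simp add: field_simps power2_eq_square)
  ultimately have "theta_fac \<tau> j z - 1 = Q * (2 - u - inverse u) / (1 - Q)\<^sup>2"
    using Q1 by (metis diff_divide_distrib divide_self_if power_eq_0_iff)
  then have "norm (theta_fac \<tau> j z - 1) = norm (2 - u - inverse u) * norm Q / (norm (1 - Q))\<^sup>2"
    by (simp add: norm_mult norm_divide norm_power)
  also have "\<dots> \<le> (2 + 2 * exp (2 * pi * B)) * norm Q / (1 - norm q)\<^sup>2"
  proof (intro frac_le mult_right_mono power_mono)
    have "- Im z \<le> B" "Im z \<le> B" using abs_Im_le_cmod[of z] assms(2) by linarith+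
    then have "pi * - Im z \<le> pi * B" "pi * Im z \<le> pi * B" by (intro mult_left_mono; simp)+
    then have 1: "norm u \<le> exp (2 * pi * B)" "norm (inverse u) \<le> exp (2 * pi * B)"
      by (simp_all add: u_def mult_ac flip: exp_minus)
    have "norm (2 - u - inverse u) \<le> norm (2 - u) + norm (inverse u)" by (rule norm_triangle_ineq4)
    moreover have "norm (2 - u) \<le> norm (2::complex) + norm u" by (rule norm_triangle_ineq4)
    ultimately show "norm (2 - u - inverse u) \<le> 2 + 2 * exp (2 * pi * B)" using 1 by simp
    show "1 - norm q \<le> norm (1 - Q)" using one_minus_nome_power(1)[OF assms(1), of j] by (simp add: Q_def q_def)
    show "0 < (1 - norm q)\<^sup>2" "0 \<le> 1 - norm q"
      using norm_nome_less[OF assms(1), folded q_def] by simp_all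
    show "0 \<le> (2 + 2 * exp (2 * pi * B)) * norm Q" by (intro mult_nonneg_nonneg add_nonneg_nonneg) auto
  qed auto
  finally show ?thesis by (simp add: Q_def q_def norm_power norm_mult)
qed

lemma theta_fac_summable:
  assumes "Im \<tau> > 0"
  shows "summable (\<lambda>j. norm (theta_fac \<tau> j z - 1))"
proof (rule summable_comparison_test')
  show "summable (\<lambda>j. (2 + 2 * exp (2 * pi * norm z)) / (1 - norm (nome \<tau>))\<^sup>2 *
     norm (nome \<tau>) ^ Suc j)"
    unfolding power_Suc using norm_nome_less[OF assms]
    by (intro summable_mult summable_geometric) simp
qed (use norm_theta_fac[OF assms] in auto)

lemma theta_fac_LIMSEQ:
  assumes "Im \<tau> > 0"
  shows "(\<lambda>n. \<Prod>j<n. theta_fac \<tau> j z) \<longlonglongrightarrow> prodinf (\<lambda>j. theta_fac \<tau> j z)"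
    and "(\<lambda>j. theta_fac \<tau> j z) has_prod prodinf (\<lambda>j. theta_fac \<tau> j z)"
proof -
  have c: "convergent_prod (\<lambda>j. theta_fac \<tau> j z)"
    by (intro abs_convergent_prod_imp_convergent_prod summable_imp_abs_convergent_prod theta_fac_summable assms)
  then show "(\<lambda>j. theta_fac \<tau> j z) has_prod prodinf (\<lambda>j. theta_fac \<tau> j z)"
    by (simp add: convergent_prod_has_prod_iff)
  show "(\<lambda>n. \<Prod>j<n. theta_fac \<tau> j z) \<longlonglongrightarrow> prodinf (\<lambda>j. theta_fac \<tau> j z)"
    using convergent_prod_LIMSEQ[OF c] by (simp add: LIMSEQ_lessThan_iff_atMost)
qed

lemma holomorphic_theta_fac: "theta_fac \<tau> j holomorphic_on S"
  unfolding theta_fac_def[abs_def]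
  \<comment> \<open>A vanishing denominator makes the factor constantly 0, as division by 0 gives
    0.\<close>
  by (cases "nome \<tau> ^ Suc j = 1") (auto intro!: holomorphic_intros simp del: power_Suc)

lemma holomorphic_theta_prod:
  assumes "Im \<tau> > 0"
  shows "(\<lambda>z. prodinf (\<lambda>j. theta_fac \<tau> j z)) holomorphic_on UNIV"
proof (rule holomorphic_uniform_sequence)
  show "(\<lambda>z. \<Prod>j<n. theta_fac \<tau> j z) holomorphic_on UNIV" for n
    by (intro holomorphic_on_prod holomorphic_theta_fac)
  fix x :: complex
  define A where "A = cball x 1"
  have B: "norm z \<le> norm x + 1" if "z \<in> A" for z
    using that norm_triangle_ineq2[of z x] by (simp add: A_def dist_norm norm_minus_commute)
  have "uniformly_convergent_on A (\<lambda>N z. \<Prod>j<N. theta_fac \<tau> j z)"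
  proof (rule uniformly_convergent_on_prod')
    show "continuous_on A (theta_fac \<tau> n)" for n
      by (rule holomorphic_on_imp_continuous_on[OF holomorphic_theta_fac])
    show "uniformly_convergent_on A (\<lambda>N x. \<Sum>n<N. norm (theta_fac \<tau> n x - 1))"
    proof (rule Weierstrass_m_test')
      show "summable (\<lambda>j. (2 + 2 * exp (2 * pi * (norm x + 1))) / (1 - norm (nome \<tau>))\<^sup>2 *
         norm (nome \<tau>) ^ Suc j)"
        unfolding power_Suc using norm_nome_less[OF assms]
        by (intro summable_mult summable_geometric) simp
    qed (use norm_theta_fac[OF assms B] in auto)
  qed (simp add: A_def)
  then obtain l where l: "uniform_limit A (\<lambda>N z. \<Prod>j<N. theta_fac \<tau> j z) l sequentially"
    by (auto simp: uniformly_convergent_on_def)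
  have "l z = prodinf (\<lambda>j. theta_fac \<tau> j z)" if "z \<in> A" for z
    using tendsto_uniform_limitI[OF l that] theta_fac_LIMSEQ(1)[OF assms] LIMSEQ_unique by blast
  with l have "uniform_limit A (\<lambda>N z. \<Prod>j<N. theta_fac \<tau> j z) (\<lambda>z. prodinf (\<lambda>j. theta_fac \<tau> j z)) sequentially"
    by (subst uniform_limit_cong'[of _ _ _ _ l]) auto
  then show "\<exists>d>0. cball x d \<subseteq> UNIV \<and> uniform_limit (cball x d) (\<lambda>N z. \<Prod>j<N. theta_fac \<tau> j z)
      (\<lambda>z. prodinf (\<lambda>j. theta_fac \<tau> j z)) sequentially"
    by (intro exI[of _ 1]) (simp add: A_def)
qed simp

lemma holomorphic_theta: "Im \<tau> > 0 \<Longrightarrow> theta \<tau> holomorphic_on UNIV"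
  unfolding theta_eq[abs_def] by (intro holomorphic_intros holomorphic_theta_prod) auto

lemma theta_minus: "theta \<tau> (- z) = - theta \<tau> z"
proof -
  have "theta_fac \<tau> j (- z) = theta_fac \<tau> j z" for j by (simp add: theta_fac_def mult.commute)
  then show ?thesis by (simp add: theta_eq)
qed

lemma theta_0 [simp]: "theta \<tau> 0 = 0"
  by (simp add: theta_eq)

text \<open>Every factor of the product is 1 at 0, so theta behaves like z there. This normalisation
  yields both that theta is not identically zero and that its zeros are simple.\<close>

lemma deriv_theta_0:
  assumes "Im \<tau> > 0"
  shows "deriv (theta \<tau>) 0 = 1"
proof (rule DERIV_imp_deriv)
  define P where "P = (\<lambda>z. prodinf (\<lambda>j. theta_fac \<tau> j z))"
  have "(P has_field_derivative deriv P 0) (at 0)"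
    unfolding P_def using holomorphic_theta_prod[OF assms] by (intro holomorphic_derivI) auto
  then have "((\<lambda>z. sin (of_real pi * z) / of_real pi * P z) has_field_derivative P 0) (at 0)"
    by (auto intro!: derivative_eq_intros)
  moreover have "theta_fac \<tau> j 0 = 1" for j
    using one_minus_nome_power(2)[OF assms, of j] by (simp add: theta_fac_def power2_eq_square)
  then have "P 0 = 1" by (simp add: P_def)
  ultimately show "(theta \<tau> has_field_derivative 1) (at 0)"
    unfolding theta_eq[abs_def] P_def by simp
qed

lemma theta_add_1: "theta \<tau> (z + 1) = - theta \<tau> z"
proof -
  have e: "exp (2 * pi * \<i> * (z + 1)) = exp (2 * pi * \<i> * z)"
    by (simp add: ring_distribs exp_add)
  have "theta_fac \<tau> j (z + 1) = theta_fac \<tau> j z" for j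
    unfolding theta_fac_def exp_minus e ..
  moreover have "sin (of_real pi * (z + 1)) = - sin (of_real pi * z :: complex)"
    by (simp add: ring_distribs sin_add flip: cos_of_real sin_of_real)
  ultimately show ?thesis by (simp add: theta_eq)
qed

text \<open>The factors \<open>(1 - q\<^sup>n/u)\<close> and \<open>(1 - q\<^sup>n\<^sup>+\<^sup>1 u)\<close> left over by telescoping the
  partial products tend to \<open>1\<close>.\<close>

lemma theta_partial_shift:
  fixes z :: complex
  assumes "Im \<tau> > 0"
  defines "q \<equiv> nome \<tau>" and "u \<equiv> exp (2 * pi * \<i> * z)"
  shows "sin (of_real pi * (z + \<tau>)) * (\<Prod>j<n. theta_fac \<tau> j (z + \<tau>)) * (1 - q ^ n / u) =
    - exp (- (2 * pi * \<i> * z) - pi * \<i> * \<tau>) * (sin (of_real pi * z) * (\<Prod>j<n. theta_fac \<tau> j z)) * (1 - q ^ Suc n * u)"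
proof (induction n)
  case 0
  \<comment> \<open>In a = e^{pi i z} and b = e^{pi i \<tau>} the base case is an identity of
    rational functions, with u = a^2 and q = b^2.\<close>
  define a where "a = exp (\<i> * (pi * z))"
  define b where "b = exp (\<i> * (pi * \<tau>))"
  have nz: "a \<noteq> 0" "b \<noteq> 0" by (simp_all add: a_def b_def)
  have u: "u = a\<^sup>2" by (simp add: u_def a_def flip: exp_double) (simp add: mult_ac)
  have q: "q = b\<^sup>2" by (simp add: q_def b_def flip: exp_double) (simp add: mult_ac)
  have s1: "sin (of_real pi * z) = (a - inverse a) / (2 * \<i>)"
    by (simp add: sin_exp_eq a_def exp_minus)
  have s2: "sin (of_real pi * (z + \<tau>)) = (a * b - inverse (a * b)) / (2 * \<i>)"
    by (simp add: sin_exp_eq a_def b_def ring_distribs flip: exp_minus exp_add)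
  have "- (2 * pi * \<i> * z) - pi * \<i> * \<tau> = - (2 * (\<i> * (pi * z)) + \<i> * (pi * \<tau>))" by simp
  then have e: "exp (- (2 * pi * \<i> * z) - pi * \<i> * \<tau>) = inverse (a\<^sup>2 * b)"
    by (simp only: exp_minus exp_add exp_double a_def b_def)
  show ?case
    unfolding e s1 s2 u q using nz by (simp add: field_simps power2_eq_square)
next
  case (Suc n)
  define c where "c = (1 - q ^ Suc n)\<^sup>2"
  define S where "S = sin (of_real pi * (z + \<tau>)) * (\<Prod>j<n. theta_fac \<tau> j (z + \<tau>))"
  define T where "T = sin (of_real pi * z) * (\<Prod>j<n. theta_fac \<tau> j z)"
  define E where "E = - exp (- (2 * pi * \<i> * z) - pi * \<i> * \<tau>)"
  have nz: "u \<noteq> 0" "q \<noteq> 0" by (simp_all add: u_def q_def)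
  have eu: "exp (2 * pi * \<i> * (z + \<tau>)) = u * q"
    by (simp add: ring_distribs exp_add u_def q_def)
  have f1: "theta_fac \<tau> n (z + \<tau>) = (1 - q ^ Suc (Suc n) * u) * (1 - q ^ n / u) / c"
  proof -
    have "theta_fac \<tau> n (z + \<tau>) = (1 - q ^ Suc n * (u * q)) * (1 - q ^ Suc n * inverse (u * q)) / c"
      unfolding theta_fac_def exp_minus eu by (simp only: c_def q_def)
    also have "q ^ Suc n * (u * q) = q ^ Suc (Suc n) * u" by simp
    also have "q ^ Suc n * inverse (u * q) = q ^ n / u" using nz by (simp add: field_simps)
    finally show ?thesis .
  qed
  have f2: "theta_fac \<tau> n z = (1 - q ^ Suc n * u) * (1 - q ^ Suc n / u) / c"
    unfolding theta_fac_def exp_minus by (simp only: c_def q_def u_def divide_inverse)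
  have IH: "S * (1 - q ^ n / u) = E * T * (1 - q ^ Suc n * u)"
    using Suc by (simp only: S_def T_def E_def)
  have "S * ((1 - q ^ Suc (Suc n) * u) * (1 - q ^ n / u) / c) * (1 - q ^ Suc n / u) =
     (S * (1 - q ^ n / u)) * ((1 - q ^ Suc (Suc n) * u) * (1 - q ^ Suc n / u) / c)"
    by (simp only: mult_ac times_divide_eq_right times_divide_eq_left)
  also have "\<dots> = E * (T * ((1 - q ^ Suc n * u) * (1 - q ^ Suc n / u) / c)) * (1 - q ^ Suc (Suc n) * u)"
    unfolding IH by (simp only: mult_ac times_divide_eq_right times_divide_eq_left)
  finally show ?case
    by (simp only: S_def T_def E_def prod.lessThan_Suc f1 f2 mult.assoc)
qed

lemma theta_add_tau:
  assumes "Im \<tau> > 0"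
  shows "theta \<tau> (z + \<tau>) = - exp (- (2 * pi * \<i> * z) - pi * \<i> * \<tau>) * theta \<tau> z"
proof -
  define q where "q = nome \<tau>"
  define u where "u = exp (2 * pi * \<i> * z)"
  define E where "E = - exp (- (2 * pi * \<i> * z) - pi * \<i> * \<tau>)"
  have q: "(\<lambda>n. q ^ n) \<longlonglongrightarrow> 0"
    by (rule LIMSEQ_power_zero) (use norm_nome_less[OF assms] in \<open>simp add: q_def\<close>)
  then have q': "(\<lambda>n. q ^ Suc n) \<longlonglongrightarrow> 0" by (rule LIMSEQ_Suc)
  define L where "L = (\<lambda>z. prodinf (\<lambda>j. theta_fac \<tau> j z))"
  have "(\<lambda>n. sin (of_real pi * (z + \<tau>)) * (\<Prod>j<n. theta_fac \<tau> j (z + \<tau>)) * (1 - q ^ n / u))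
     \<longlonglongrightarrow> sin (of_real pi * (z + \<tau>)) * L (z + \<tau>) * (1 - 0 / u)"
    unfolding L_def by (intro tendsto_intros theta_fac_LIMSEQ assms q) (simp add: u_def)
  moreover have "(\<lambda>n. E * (sin (of_real pi * z) * (\<Prod>j<n. theta_fac \<tau> j z)) * (1 - q ^ Suc n * u))
     \<longlonglongrightarrow> E * (sin (of_real pi * z) * L z) * (1 - 0 * u)"
    unfolding L_def by (intro tendsto_intros theta_fac_LIMSEQ assms q')
  ultimately have "sin (of_real pi * (z + \<tau>)) * L (z + \<tau>) * (1 - 0 / u) = E * (sin (of_real pi * z) * L z) * (1 - 0 * u)"
    unfolding u_def q_def E_def theta_partial_shift[OF assms] by (rule LIMSEQ_unique)
  then show ?thesis by (simp add: theta_eq L_def E_def)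
qed

section \<open>Lattice translations and the zeros of theta\<close>

definition lattice :: "complex \<Rightarrow> complex set" where
  "lattice \<tau> = {z. \<exists>m l :: int. z = of_int m + of_int l * \<tau>}"

definition theta_mult :: "complex \<Rightarrow> int \<Rightarrow> int \<Rightarrow> complex \<Rightarrow> complex" where
  "theta_mult \<tau> m l z = (- 1) powi (m + l) * exp (- (2 * pi * \<i> * of_int l * z) - pi * \<i> * \<tau> * of_int l ^ 2)"

lemma theta_add_lattice:
  assumes "Im \<tau> > 0"
  shows "theta \<tau> (z + (of_int m + of_int l * \<tau>)) = theta_mult \<tau> m l z * theta \<tau> z"
proof -
  have 1: "theta \<tau> (z + of_nat n) = (- 1) ^ n * theta \<tau> z" for z n
  proof (induction n)
    case (Suc n)
    have "theta \<tau> (z + of_nat (Suc n)) = theta \<tau> ((z + of_nat n) + 1)" by (simp add: add_ac)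
    then show ?case unfolding theta_add_1 Suc by simp
  qed simp
  have 2: "theta \<tau> (z + of_int m) = (- 1) powi m * theta \<tau> z" for z m
  proof (cases "m \<ge> 0")
    case True
    then show ?thesis using 1[of z "nat m"] by (simp add: power_int_def)
  next
    case False
    then have "theta \<tau> z = (- 1) ^ nat (- m) * theta \<tau> (z + of_int m)"
      using 1[of "z + of_int m" "nat (- m)"] by simp
    then have "(- 1) ^ nat (- m) * theta \<tau> z = theta \<tau> (z + of_int m)"
      by (simp flip: power_add mult.assoc)
    then show ?thesis using False by (simp add: power_int_def)
  qed
  have 3: "theta \<tau> (z + of_nat n * \<tau>) = theta_mult \<tau> 0 (int n) z * theta \<tau> z" for z n
  proof (induction n)
    case 0
    then show ?case by (simp add: theta_mult_def)
  next
    case (Suc n)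
    have "theta \<tau> (z + of_nat (Suc n) * \<tau>) = theta \<tau> ((z + of_nat n * \<tau>) + \<tau>)" by (simp add: algebra_simps)
    also have "\<dots> = theta_mult \<tau> 0 (int (Suc n)) z * theta \<tau> z"
      unfolding theta_add_tau[OF assms] Suc
      by (simp add: theta_mult_def power_int_add exp_add[symmetric] algebra_simps power2_eq_square)
    finally show ?case .
  qed
  have 4: "theta \<tau> (z + of_int l * \<tau>) = theta_mult \<tau> 0 l z * theta \<tau> z" for z l
  proof (cases "l \<ge> 0")
    case True
    then show ?thesis using 3[of z "nat l"] by simp
  next
    case False
    \<comment> \<open>A negative shift is undone by the positive shift from the translated point;
      the two multipliers are inverse to each other.\<close>
    then have "theta \<tau> z = theta_mult \<tau> 0 (- l) (z + of_int l * \<tau>) * theta \<tau> (z + of_int l * \<tau>)"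
      using 3[of "z + of_int l * \<tau>" "nat (- l)"] by simp
    then have "theta_mult \<tau> 0 l z * theta \<tau> z =
      (theta_mult \<tau> 0 l z * theta_mult \<tau> 0 (- l) (z + of_int l * \<tau>)) * theta \<tau> (z + of_int l * \<tau>)"
      by simp
    also have "theta_mult \<tau> 0 l z * theta_mult \<tau> 0 (- l) (z + of_int l * \<tau>) = 1"
    proof -
      have "((- 1) powi l * (- 1) powi (- l) :: complex) = 1" by (simp flip: power_int_add)
      then show ?thesis
        by (simp add: theta_mult_def exp_add[symmetric] algebra_simps power2_eq_square mult_exp_exp)
    qed
    finally show ?thesis by simp
  qed
  have "theta \<tau> (z + (of_int m + of_int l * \<tau>)) = theta \<tau> ((z + of_int l * \<tau>) + of_int m)"
    by (simp add: algebra_simps)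
  also have "\<dots> = theta_mult \<tau> m l z * theta \<tau> z"
    unfolding 2 4 by (simp add: theta_mult_def power_int_add)
  finally show ?thesis .
qed

lemma theta_mult_nonzero: "theta_mult \<tau> m l z \<noteq> 0"
  by (simp add: theta_mult_def)

text \<open>A convergent product vanishes only through one of its factors, and a vanishing factor
  says that e^{2 pi i (z + l \<tau>)} = 1 for some integer l.\<close>

lemma theta_eq_0_iff:
  assumes "Im \<tau> > 0"
  shows "theta \<tau> z = 0 \<longleftrightarrow> z \<in> lattice \<tau>"
proof
  assume "z \<in> lattice \<tau>"
  then show "theta \<tau> z = 0"
    using theta_add_lattice[OF assms, of 0] by (auto simp: lattice_def)
next
  assume z: "theta \<tau> z = 0"
  have L: "z \<in> lattice \<tau>" if e: "exp (2 * pi * \<i> * (z + of_int l * \<tau>)) = 1" for l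
  proof -
    obtain n :: int where "Im (2 * pi * \<i> * (z + of_int l * \<tau>)) = of_int (2 * n) * pi"
      "Re (2 * pi * \<i> * (z + of_int l * \<tau>)) = 0"
      using e unfolding exp_eq_1 by blast
    then have "Re (z + of_int l * \<tau>) = n" "Im (z + of_int l * \<tau>) = 0" by auto
    then have "z + of_int l * \<tau> = of_int n" by (simp add: complex_eq_iff)
    then have "z = of_int n + of_int (- l) * \<tau>" by (simp add: algebra_simps)
    then show ?thesis unfolding lattice_def by blast
  qed
  consider "sin (of_real pi * z) = 0" | "prodinf (\<lambda>j. theta_fac \<tau> j z) = 0"
    using z by (auto simp: theta_eq)
  then show "z \<in> lattice \<tau>"
  proof cases
    case 1
    then obtain n :: int where "of_real pi * z = of_real (n * pi)" unfolding sin_eq_0 by blast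
    then have "z = of_int n" by (simp add: field_simps)
    then have "z = of_int n + of_int 0 * \<tau>" by simp
    then show ?thesis unfolding lattice_def by blast
  next
    case 2
    then obtain j where "theta_fac \<tau> j z = 0"
      using has_prod_eq_0_iff[OF theta_fac_LIMSEQ(2)[OF assms], of z] by (metis rangeE)
    then have "nome \<tau> ^ Suc j * exp (2 * pi * \<i> * z) = 1 \<or>
        nome \<tau> ^ Suc j * exp (- (2 * pi * \<i> * z)) = 1"
      using one_minus_nome_power(2)[OF assms, of j] by (auto simp: theta_fac_def)
    then show ?thesis
    proof
      assume "nome \<tau> ^ Suc j * exp (2 * pi * \<i> * z) = 1"
      then have "exp (of_nat (Suc j) * (2 * pi * \<i> * \<tau>) + 2 * pi * \<i> * z) = 1"
        by (simp only: exp_add exp_of_nat_mult)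
      then show ?thesis by (intro L[of "int (Suc j)"]) (simp add: algebra_simps)
    next
      assume "nome \<tau> ^ Suc j * exp (- (2 * pi * \<i> * z)) = 1"
      then have "exp (of_nat (Suc j) * (2 * pi * \<i> * \<tau>) + - (2 * pi * \<i> * z)) = 1"
        by (simp only: exp_add exp_of_nat_mult)
      then have "exp (- (of_nat (Suc j) * (2 * pi * \<i> * \<tau>) + - (2 * pi * \<i> * z))) = 1"
        by (simp only: exp_minus inverse_1)
      then show ?thesis by (intro L[of "- int (Suc j)"]) (simp add: algebra_simps)
    qed
  qed
qed

text \<open>Differentiating the quasi-periodicity relation at 0 transports the derivative 1 to any
  lattice point, up to a nonzero multiplier.\<close>

lemma theta_simple_zeros:
  assumes "Im \<tau> > 0" "theta \<tau> z = 0"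
  shows "deriv (theta \<tau>) z \<noteq> 0"
proof -
  obtain m l :: int where ml: "z = of_int m + of_int l * \<tau>"
    using assms theta_eq_0_iff by (auto simp: lattice_def)
  have d: "(theta \<tau> has_field_derivative deriv (theta \<tau>) w) (at w)" for w
    using holomorphic_theta[OF assms(1)] by (intro holomorphic_derivI) auto
  have "((\<lambda>w. theta \<tau> (w + z)) has_field_derivative deriv (theta \<tau>) z) (at 0)"
    using d[of "0 + z"] by (subst (asm) DERIV_shift) simp
  moreover have "((\<lambda>w. theta_mult \<tau> m l w * theta \<tau> w) has_field_derivative theta_mult \<tau> m l 0) (at 0)"
  proof -
    have "\<exists>d'. (theta_mult \<tau> m l has_field_derivative d') (at 0)"
      unfolding theta_mult_def[abs_def] by (rule exI) (auto intro!: derivative_eq_intros)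
    then obtain d' where "(theta_mult \<tau> m l has_field_derivative d') (at 0)" ..
    from DERIV_mult[OF this d[of 0]] show ?thesis
      by (simp add: deriv_theta_0[OF assms(1)])
  qed
  ultimately have "deriv (theta \<tau>) z = theta_mult \<tau> m l 0"
    unfolding ml theta_add_lattice[OF assms(1)] by (rule DERIV_unique)
  then show ?thesis by (simp add: theta_mult_nonzero)
qed

section \<open>Quadratic forms and quasi-periodic functions\<close>

definition cvec :: "int^'p::finite \<Rightarrow> complex^'p" where
  "cvec m = (\<chi> j. of_int (m $ j))"

lemma cvec_nth [simp]: "cvec m $ j = of_int (m $ j)"
  by (simp add: cvec_def)

lemma latvec_nth [simp]: "latvec \<tau> m l $ j = of_int (m $ j) + of_int (l $ j) * \<tau>"
  by (simp add: latvec_def)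

text \<open>Written through values of \<open>Q\<close> only, the factor of \<open>\<L>(Q, 0)\<close> is visibly multiplicative in \<open>Q\<close>, so
  that comparing line bundles amounts to identities between quadratic forms.\<close>

definition quad_fac :: "complex \<Rightarrow> (complex^'p::finite \<Rightarrow> complex) \<Rightarrow> 'p factor" where
  "quad_fac \<tau> Q m l x = exp (pi * \<i> * Q (cvec m + cvec l)) *
     exp (- (pi * \<i> * (Q (x + cvec l) - Q x - Q (cvec l))) - pi * \<i> * \<tau> * Q (cvec l))"

lemma quad_fac_nonzero [simp]: "quad_fac \<tau> Q m l x \<noteq> 0"
  by (simp add: quad_fac_def)

lemma quad_fac_0: "quad_fac \<tau> (\<lambda>x. 0) m l x = 1"
  by (simp add: quad_fac_def)

lemma quad_fac_add: "quad_fac \<tau> (\<lambda>x. Q x + Q' x) m l x = quad_fac \<tau> Q m l x * quad_fac \<tau> Q' m l x"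
  unfolding quad_fac_def mult_exp_exp by (rule arg_cong[of _ _ exp]) (simp add: algebra_simps)

lemma quad_fac_diff: "quad_fac \<tau> (\<lambda>x. Q x - Q' x) m l x = quad_fac \<tau> Q m l x / quad_fac \<tau> Q' m l x"
  using quad_fac_add[of \<tau> "\<lambda>x. Q x - Q' x" Q' m l x] by (simp add: field_simps)

lemma exp_pi_i_int: "exp (pi * \<i> * of_int n) = (- 1) powi n"
proof -
  have "exp (of_int n * (pi * \<i>)) = exp (pi * \<i>) powi n"
    by (rule exp_power_int[symmetric])
  then show ?thesis by (simp add: mult.commute)
qed

lemma power_int_minus_one_cong: "even (m - n) \<Longrightarrow> (- 1) powi m = ((- 1) powi n :: complex)"
  by (simp add: power_int_minus_one_minus even_diff power_int_minus_left)

section \<open>Linear and quadratic forms with integral coefficients\<close>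

definition int_lin :: "(complex^'p::finite \<Rightarrow> complex) \<Rightarrow> bool" where
  "int_lin f \<longleftrightarrow> (\<exists>a :: 'p \<Rightarrow> int. \<forall>x. f x = (\<Sum>j\<in>UNIV. of_int (a j) * x $ j))"

lemma int_lin_nth: "int_lin (\<lambda>x. x $ i)"
proof -
  have "(\<Sum>j\<in>UNIV. of_int (if j = i then 1 else 0) * x $ j) = (\<Sum>j\<in>UNIV. if j = i then x $ i else 0)" for x :: "complex^'a"
    by (rule sum.cong) auto
  then show ?thesis
    unfolding int_lin_def by (intro exI[of _ "\<lambda>j. if j = i then 1 else 0"]) simp
qed

lemma int_lin_add: "int_lin f \<Longrightarrow> int_lin g \<Longrightarrow> int_lin (\<lambda>x. f x + g x)"
  unfolding int_lin_def
  by (elim exE, rule_tac x="\<lambda>j. a j + aa j" in exI) (simp add: algebra_simps sum.distrib)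

lemma int_lin_mult: "int_lin f \<Longrightarrow> int_lin (\<lambda>x. of_int c * f x)"
  unfolding int_lin_def
  by (elim exE, rule_tac x="\<lambda>j. c * a j" in exI) (simp add: algebra_simps sum_distrib_left)

lemma int_lin_diff: "int_lin f \<Longrightarrow> int_lin g \<Longrightarrow> int_lin (\<lambda>x. f x - g x)"
  unfolding int_lin_def
  by (elim exE, rule_tac x="\<lambda>j. a j - aa j" in exI) (simp add: algebra_simps sum_subtractf)

lemmas int_lin_intros = int_lin_nth int_lin_add int_lin_diff int_lin_mult

definition int_quad :: "(complex^'p::finite \<Rightarrow> complex) \<Rightarrow> bool" where
  "int_quad Q \<longleftrightarrow> (\<exists>N. (\<forall>i j. N i j = N j i) \<and> (\<forall>x. Q x = quad_form N x))"

lemma int_quad_0: "int_quad (\<lambda>x. 0)"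
  unfolding int_quad_def by (rule exI[of _ "\<lambda>_ _. 0"]) (simp add: quad_form_def)

lemma int_quad_add: "int_quad Q \<Longrightarrow> int_quad Q' \<Longrightarrow> int_quad (\<lambda>x. Q x + Q' x)"
  unfolding int_quad_def
  by (elim exE, rule_tac x="\<lambda>i j. N i j + Na i j" in exI) (simp add: quad_form_def algebra_simps sum.distrib)

lemma int_quad_diff: "int_quad Q \<Longrightarrow> int_quad Q' \<Longrightarrow> int_quad (\<lambda>x. Q x - Q' x)"
  unfolding int_quad_def
  by (elim exE, rule_tac x="\<lambda>i j. N i j - Na i j" in exI) (simp add: quad_form_def algebra_simps sum_subtractf)

lemma int_quad_square: "int_lin f \<Longrightarrow> int_quad (\<lambda>x. (f x)\<^sup>2)"
  unfolding int_lin_def int_quad_def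
  by (elim exE, rule_tac x="\<lambda>i j. a i * a j" in exI)
    (simp add: quad_form_def power2_eq_square sum_product mult_ac)

lemma int_quad_sum: "(\<And>i. i \<in> A \<Longrightarrow> int_quad (Q i)) \<Longrightarrow> int_quad (\<lambda>x. \<Sum>i\<in>A. Q i x)"
  by (induction A rule: infinite_finite_induct) (auto intro: int_quad_0 int_quad_add)

lemmas int_quad_intros = int_quad_0 int_quad_add int_quad_diff int_quad_square int_quad_sum

lemma int_quad_continuous: "int_quad Q \<Longrightarrow> continuous_on S Q"
proof -
  assume "int_quad Q"
  then obtain N where "Q = quad_form N" unfolding int_quad_def by blast
  then show ?thesis unfolding quad_form_def by (simp add: fun_eq_iff) (intro continuous_intros)
qed

lemma quad_fac_continuous: "continuous_on UNIV Q \<Longrightarrow> continuous_on S (quad_fac \<tau> Q m l)"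
proof -
  assume Q: "continuous_on UNIV Q"
  have "continuous_on S (\<lambda>x. Q (x + v))" for v
    by (rule continuous_on_compose2[OF Q]) (auto intro!: continuous_intros)
  moreover have "continuous_on S Q" using Q continuous_on_subset by blast
  ultimately show ?thesis
    unfolding quad_fac_def by (intro continuous_intros) auto
qed

text \<open>Modulo 2 the mixed terms cancel by symmetry and w_i^2 equals w_i. This turns the sign of
  \<open>LB\<close>, whose exponent is linear in the lattice vector, into a value of the quadratic
  form.\<close>

lemma even_quad_form:
  fixes N :: "'p \<Rightarrow> 'p \<Rightarrow> int"
  assumes "\<And>i j. N i j = N j i" "finite S"
  shows "even ((\<Sum>i\<in>S. \<Sum>j\<in>S. N i j * w i * w j) - (\<Sum>i\<in>S. N i i * w i))"
  using assms(2)
proof (induction S rule: finite_induct)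
  case (insert a S)
  have sw: "(\<Sum>j\<in>S. N j a * w j * w a) = (\<Sum>j\<in>S. N a j * w a * w j)"
    by (rule sum.cong[OF refl], subst assms(1)) (simp only: mult.commute mult.left_commute)
  define D where "D = (\<Sum>i\<in>S. \<Sum>j\<in>S. N i j * w i * w j)"
  define T where "T = (\<Sum>i\<in>S. N i i * w i)"
  define R where "R = (\<Sum>j\<in>S. N a j * w a * w j)"
  have "(\<Sum>i\<in>insert a S. \<Sum>j\<in>insert a S. N i j * w i * w j) = (N a a * w a * w a + R) + (R + D)"
    using insert(1,2) sw by (simp add: sum.distrib R_def D_def)
  moreover have "(\<Sum>i\<in>insert a S. N i i * w i) = N a a * w a + T"
    using insert(1,2) by (simp add: T_def)
  moreover have "(N a a * w a * w a + R) + (R + D) - (N a a * w a + T) = (D - T) + N a a * (w a * (w a - 1)) + 2 * R"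
    by (simp add: algebra_simps)
  moreover have "even (D - T)" using insert(3) by (simp only: D_def T_def)
  moreover have "even (w a * (w a - 1))" by auto
  ultimately show ?case by (metis dvd_add dvd_mult dvd_triv_left)
qed simp

text \<open>The exponent of \<open>LB\<close> is the polarisation of the form, and its sign is -1 to
  the value of the form by \<open>even_quad_form\<close>.\<close>

lemma LB_eq_quad_fac:
  assumes "\<And>i j. N i j = N j i"
  shows "LB \<tau> N 0 m l x = quad_fac \<tau> (quad_form N) m l x"
proof -
  define B where "B = (\<lambda>f g :: complex^'a. \<Sum>j\<in>UNIV. \<Sum>k\<in>UNIV. of_int (N j k) * f $ j * g $ k)"
  have qf: "quad_form N x = B x x" for x by (simp add: quad_form_def B_def)
  have Bl: "B (f + f') g = B f g + B f' g" and Br: "B g (f + f') = B g f + B g f'" for f f' g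
    by (simp_all add: B_def algebra_simps sum.distrib)
  have Bs: "B f g = B g f" for f g
  proof -
    have "B f g = (\<Sum>k\<in>UNIV. \<Sum>j\<in>UNIV. of_int (N j k) * f $ j * g $ k)"
      unfolding B_def by (rule sum.swap)
    also have "\<dots> = B g f"
      unfolding B_def by (intro sum.cong refl, subst assms) (simp add: mult_ac)
    finally show ?thesis .
  qed
  have 1: "quad_form N (x + cvec l) - quad_form N x - quad_form N (cvec l) = 2 * B (cvec l) x"
    by (simp add: qf Bl Br Bs[of x "cvec l"])
  have 2: "quad_form N (cvec m + cvec l) = of_int (\<Sum>i\<in>UNIV. \<Sum>j\<in>UNIV. N i j * (m $ i + l $ i) * (m $ j + l $ j))"
    by (simp add: quad_form_def)
  have 3: "exp (pi * \<i> * quad_form N (cvec m + cvec l)) = (- 1) powi (\<Sum>j\<in>UNIV. N j j * (m $ j + l $ j))"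
    unfolding 2 exp_pi_i_int
    by (rule power_int_minus_one_cong)
      (use even_quad_form[of N UNIV "\<lambda>j. m $ j + l $ j"] assms in auto)
  have 4: "(\<Sum>j\<in>UNIV. of_int (l $ j) * ((\<Sum>k\<in>UNIV. of_int (N j k) * x $ k) + (0::complex^'a) $ j)) = B (cvec l) x"
    by (simp add: B_def sum_distrib_left mult_ac)
  have 5: "(\<Sum>j\<in>UNIV. \<Sum>k\<in>UNIV. of_int (N j k * l $ j * l $ k)) = quad_form N (cvec l)"
    by (simp add: quad_form_def)
  show ?thesis
    unfolding LB_def quad_fac_def 1 3 4 5 by (simp add: mult_ac)
qed

lemma int_quad_line_bundle:
  assumes "int_quad Q"
  shows "line_bundle \<tau> (quad_fac \<tau> Q)"
proof -
  obtain N where N: "\<And>i j. N i j = N j i" "\<And>x. Q x = quad_form N x"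
    using assms unfolding int_quad_def by metis
  then have "quad_fac \<tau> Q = LB \<tau> N 0"
    by (simp add: fun_eq_iff LB_eq_quad_fac[OF N(1)]) (simp add: quad_fac_def)
  then show ?thesis using line_bundle_LB[OF N(1)] by simp
qed

section \<open>Functions obeying the transformation law of sections of \<L>(Q, 0)\<close>

definition quasi_per :: "complex \<Rightarrow> (complex^'p::finite \<Rightarrow> complex) \<Rightarrow> (complex^'p \<Rightarrow> complex) \<Rightarrow> bool" where
  "quasi_per \<tau> Q f \<longleftrightarrow> (\<forall>m l x. f (x + latvec \<tau> m l) = quad_fac \<tau> Q m l x * f x)"

text \<open>An integral linear form sends lattice vectors into the lattice of theta, and the
  exponent M + L of the theta sign has the parity of (M + L)^2. Products of such thetas are thus
  governed by sums of squares.\<close>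

lemma quasi_per_theta:
  assumes "Im \<tau> > 0" "int_lin f"
  shows "quasi_per \<tau> (\<lambda>x. (f x)\<^sup>2) (\<lambda>x. theta \<tau> (f x))"
  unfolding quasi_per_def
proof (intro allI)
  fix m l x
  obtain a where a: "\<And>x. f x = (\<Sum>j\<in>UNIV. of_int (a j) * x $ j)"
    using assms(2) unfolding int_lin_def by blast
  define M where "M = (\<Sum>j\<in>UNIV. a j * m $ j)"
  define L where "L = (\<Sum>j\<in>UNIV. a j * l $ j)"
  have add: "f (u + v) = f u + f v" for u v by (simp add: a algebra_simps sum.distrib)
  have cv: "f (cvec m) = of_int M" "f (cvec l) = of_int L" by (simp_all add: a M_def L_def)
  have lv: "f (latvec \<tau> m l) = of_int M + of_int L * \<tau>"
    by (simp add: a M_def L_def algebra_simps sum.distrib sum_distrib_left)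
  have "exp (pi * \<i> * of_int ((M + L)\<^sup>2)) = (- 1) powi (M + L)"
    unfolding exp_pi_i_int by (rule power_int_minus_one_cong) (simp add: power2_eq_square)
  then have "theta_mult \<tau> M L (f x) = quad_fac \<tau> (\<lambda>x. (f x)\<^sup>2) m l x"
    by (simp add: theta_mult_def quad_fac_def add cv power2_eq_square algebra_simps)
  then show "theta \<tau> (f (x + latvec \<tau> m l)) = quad_fac \<tau> (\<lambda>x. (f x)\<^sup>2) m l x * theta \<tau> (f x)"
    unfolding add lv theta_add_lattice[OF assms(1)] by simp
qed

lemma quasi_per_const: "quasi_per \<tau> (\<lambda>x. 0) (\<lambda>x. c)"
  by (simp add: quasi_per_def quad_fac_0)

lemma quasi_per_mult: "quasi_per \<tau> Q f \<Longrightarrow> quasi_per \<tau> Q' g \<Longrightarrow> quasi_per \<tau> (\<lambda>x. Q x + Q' x) (\<lambda>x. f x * g x)"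
  by (simp add: quasi_per_def quad_fac_add)

lemma quasi_per_cmult: "quasi_per \<tau> Q f \<Longrightarrow> quasi_per \<tau> Q (\<lambda>x. c * f x)"
  by (simp add: quasi_per_def)

lemma quasi_per_sum: "(\<And>i. i \<in> A \<Longrightarrow> quasi_per \<tau> Q (f i)) \<Longrightarrow> quasi_per \<tau> Q (\<lambda>x. \<Sum>i\<in>A. f i x)"
  by (simp add: quasi_per_def sum_distrib_left)

lemma quasi_per_prod: "(\<And>i. i \<in> A \<Longrightarrow> quasi_per \<tau> (Q i) (f i)) \<Longrightarrow> quasi_per \<tau> (\<lambda>x. \<Sum>i\<in>A. Q i x) (\<lambda>x. \<Prod>i\<in>A. f i x)"
proof (induction A rule: infinite_finite_induct)
  case (insert i A)
  then show ?case by (simp add: quasi_per_mult)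
qed (simp_all add: quasi_per_const)

lemma quasi_per_cong: "quasi_per \<tau> Q f \<Longrightarrow> (\<And>x. Q x = Q' x) \<Longrightarrow> quasi_per \<tau> Q' f"
  by (simp add: quasi_per_def quad_fac_def)

lemma continuous_translate: "continuous_on UNIV f \<Longrightarrow> continuous_on UNIV (\<lambda>x. f (x + v :: complex^'p::finite))"
  by (rule continuous_on_compose2[of UNIV f]) (auto intro!: continuous_intros)

text \<open>Where \<open>g\<close> is nonzero one divides the two laws; elsewhere the law follows by
  continuity, which is why the forms are assumed continuous.\<close>

lemma quasi_per_cancel:
  assumes f: "entire f" and g: "entire g" "g a \<noteq> 0" and Q: "continuous_on UNIV Q" "continuous_on UNIV R"
    and tg: "quasi_per \<tau> R g" and tfg: "quasi_per \<tau> Q (\<lambda>x. f x * g x)"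
  shows "quasi_per \<tau> (\<lambda>x. Q x - R x) f"
  unfolding quasi_per_def
proof (intro allI)
  fix m l x
  show "f (x + latvec \<tau> m l) = quad_fac \<tau> (\<lambda>x. Q x - R x) m l x * f x"
  proof (rule eq_off_zeros[OF g, of UNIV "\<lambda>x. f (x + latvec \<tau> m l)"])
    show "continuous_on UNIV (\<lambda>x. f (x + latvec \<tau> m l))"
      by (intro continuous_translate holo_on_continuous f)
    show "continuous_on UNIV (\<lambda>x. quad_fac \<tau> (\<lambda>x. Q x - R x) m l x * f x)"
      by (intro continuous_intros quad_fac_continuous holo_on_continuous f Q)
    fix x assume "g x \<noteq> 0"
    moreover have "f (x + latvec \<tau> m l) * g (x + latvec \<tau> m l) = quad_fac \<tau> Q m l x * (f x * g x)"
      using tfg by (simp add: quasi_per_def)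
    moreover have "g (x + latvec \<tau> m l) = quad_fac \<tau> R m l x * g x" using tg by (simp add: quasi_per_def)
    ultimately show "f (x + latvec \<tau> m l) = quad_fac \<tau> (\<lambda>x. Q x - R x) m l x * f x"
      by (simp add: quad_fac_diff field_simps)
  qed auto
qed

text \<open>\<open>hi\<close> is the action of \<open>h\<close> on the integer coordinates of
  lattice vectors; an additive \<open>h\<close> respects everything \<open>quad_fac\<close> is built
  from.\<close>

lemma quasi_per_compose:
  assumes "quasi_per \<tau> Q f"
    and lat: "\<And>x m l. h (x + latvec \<tau> m l) = h x + latvec \<tau> (hi m) (hi l)"
    and add: "\<And>x y. h (x + y) = h x + h y" and cv: "\<And>m. h (cvec m) = cvec (hi m)"
  shows "quasi_per \<tau> (\<lambda>x. Q (h x)) (\<lambda>x. f (h x))"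
proof -
  have "quad_fac \<tau> (\<lambda>x. Q (h x)) m l x = quad_fac \<tau> Q (hi m) (hi l) (h x)" for m l x
    by (simp add: quad_fac_def add cv)
  then show ?thesis using assms(1) by (simp add: quasi_per_def lat)
qed

lemma theta_not_0:
  assumes "Im \<tau> > 0"
  obtains z where "theta \<tau> z \<noteq> 0"
proof (rule ccontr)
  assume "\<not> thesis"
  then have "theta \<tau> = (\<lambda>z. 0)" using that by blast
  then show False using deriv_theta_0[OF assms] by simp
qed

lemma entire_theta: "Im \<tau> > 0 \<Longrightarrow> entire f \<Longrightarrow> entire (\<lambda>x. theta \<tau> (f x))"
  by (rule entire_holomorphic[OF holomorphic_theta])

section \<open>Divisibility by an elliptic Vandermonde product\<close>

definition pairs :: "nat \<Rightarrow> (nat \<times> nat) set" where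
  "pairs k = {(i, j). i < j \<and> j < k}"

lemma finite_pairs [simp]: "finite (pairs k)"
  by (rule finite_subset[of _ "{..<k} \<times> {..<k}"]) (auto simp: pairs_def)

text \<open>The factors are divided out one at a time. The point is that the partial quotient still
  vanishes on the divisor of the next factor: on each of its hyperplanes the product of the factors
  already removed is not identically zero and can be cancelled.\<close>

lemma vandermonde_theta_dvd:
  fixes c :: "nat \<Rightarrow> 'p::finite"
  assumes \<tau>: "Im \<tau> > 0" and c: "inj_on c {..<k}" and f: "entire f"
    and van: "\<And>i j x. i < j \<Longrightarrow> j < k \<Longrightarrow> x $ c i - x $ c j \<in> lattice \<tau> \<Longrightarrow> f x = 0"
  obtains g where "entire g" "\<And>x. f x = (\<Prod>(i, j)\<in>pairs k. theta \<tau> (x $ c i - x $ c j)) * g x"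
proof -
  obtain z0 where z0: "theta \<tau> z0 \<noteq> 0" using theta_not_0[OF \<tau>] .
  have cd: "c i \<noteq> c j" if "i < k" "j < k" "i \<noteq> j" for i j
    using c that by (auto simp: inj_on_def)
  have "\<exists>g. entire g \<and> (\<forall>x. f x = (\<Prod>(i, j)\<in>F. theta \<tau> (x $ c i - x $ c j)) * g x)"
    if "finite F" "F \<subseteq> pairs k" for F
    using that
  proof (induction F rule: finite_induct)
    case empty
    then show ?case using f by (auto intro!: exI[of _ f])
  next
    case (insert p F)
    obtain a b where p: "p = (a, b)" by fastforce
    have ab: "a < b" "b < k" using insert.prems by (auto simp: p pairs_def)
    obtain g where g: "entire g" "\<And>x. f x = (\<Prod>(i, j)\<in>F. theta \<tau> (x $ c i - x $ c j)) * g x"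
      using insert by auto
    have "g x0 = 0" if x0: "theta \<tau> (x0 $ c a - x0 $ c b) = 0" for x0
    proof -
      define \<gamma> where "\<gamma> = x0 $ c a - x0 $ c b"
      \<comment> \<open>The projection onto the hyperplane where the a-th and b-th variables differ
        by \<gamma>; it fixes \<open>x0\<close>.\<close>
      define \<pi> where "\<pi> = (\<lambda>x::complex^'p. \<chi> d. if d = c a then x $ c b + \<gamma> else x $ d)"
      have \<pi>: "entire (\<lambda>x. \<pi> x $ d)" for d
        by (cases "d = c a") (auto simp: \<pi>_def intro!: entire_intros)
      have \<pi>x0: "\<pi> x0 = x0" by (auto simp: \<pi>_def vec_eq_iff \<gamma>_def)
      define h where "h = (\<lambda>x. \<Prod>(i, j)\<in>F. theta \<tau> (\<pi> x $ c i - \<pi> x $ c j))"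
      have eh: "entire h"
        unfolding h_def case_prod_beta by (intro entire_intros entire_theta \<tau> \<pi>)
      have "\<exists>x. h x \<noteq> 0"
        unfolding h_def
      proof (rule entire_prod_nonzero[OF insert.hyps(1)])
        fix q assume q: "q \<in> F"
        obtain i j where ij: "q = (i, j)" by fastforce
        have le: "i < j" "j < k" using insert.prems q by (auto simp: ij pairs_def)
        have ne: "(i, j) \<noteq> (a, b)" using q insert.hyps(2) by (auto simp: ij p)
        show "entire (\<lambda>x. case q of (i, j) \<Rightarrow> theta \<tau> (\<pi> x $ c i - \<pi> x $ c j))"
          unfolding ij by (simp, intro entire_intros entire_theta \<tau> \<pi>)
        have "\<exists>x. \<pi> x $ c i - \<pi> x $ c j = z0"
        proof -
          \<comment> \<open>On that hyperplane only the difference belonging to (a, b) is constant.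
            Any other one can be given the value \<open>z0\<close> through a variable other than the
            dependent a-th one.\<close>
          consider "i \<noteq> a" "j \<noteq> a" | "i = a" "j \<noteq> b" | "j = a" using ne by blast
          then show ?thesis
          proof cases
            case 1
            then show ?thesis
              using le ab cd[of i j] cd[of i a] cd[of j a]
              by (intro exI[of _ "axis (c i) z0"]) (auto simp: \<pi>_def axis_def)
          next
            case 2
            then show ?thesis
              using le ab cd[of j b] cd[of j a] cd[of a b]
              by (intro exI[of _ "axis (c b) (z0 - \<gamma>)"]) (auto simp: \<pi>_def axis_def)
          next
            case 3
            then show ?thesis
              using le ab cd[of i a] cd[of i b] cd[of a b]
              by (intro exI[of _ "axis (c i) (z0 + \<gamma>)"]) (auto simp: \<pi>_def axis_def)
          qed
        qed
        then show "\<exists>x. (case q of (i, j) \<Rightarrow> theta \<tau> (\<pi> x $ c i - \<pi> x $ c j)) \<noteq> 0"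
          using z0 by (auto simp: ij)
      qed
      then obtain x1 where x1: "h x1 \<noteq> 0" ..
      have "h x * g (\<pi> x) = h x * 0" for x
      proof -
        have "\<pi> x $ c a - \<pi> x $ c b = \<gamma>" using cd[of a b] ab by (simp add: \<pi>_def)
        then have "f (\<pi> x) = 0" using van[of a b "\<pi> x"] ab x0 theta_eq_0_iff[OF \<tau>] by (simp add: \<gamma>_def)
        then show ?thesis using g(2)[of "\<pi> x"] by (simp add: h_def)
      qed
      from entire_mult_cancel[OF eh x1 entire_compose[OF g(1) \<pi>] entire_const this, of x0]
      show ?thesis by (simp add: \<pi>x0)
    qed
    note van_g = this
    have dir: "(x + z *s axis (c a) 1) $ c a - (x + z *s axis (c a) 1) $ c b = x $ c a - x $ c b + z"
      for x :: "complex^'p" and z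
      using cd[of a b] ab by (simp add: axis_def)
    have l: "entire (\<lambda>x. x $ c a - x $ c b)" by (intro entire_intros)
    obtain g' where "entire g'" "\<And>x. g x = theta \<tau> (x $ c a - x $ c b) * g' x"
      using entire_divide_simple_zeros[OF g(1) l holomorphic_theta[OF \<tau>] theta_simple_zeros[OF \<tau>] dir van_g]
      by blast
    then show ?case using g(2) insert.hyps by (auto simp: p mult_ac intro!: exI[of _ g'])
  qed
  from this[of "pairs k"] show ?thesis using that by auto
qed

section \<open>Irreducible components of the intersections\<close>

lemma lattice_0: "0 \<in> lattice \<tau>"
  unfolding lattice_def by (intro CollectI exI[of _ 0]) simp

lemma lattice_minus: "x \<in> lattice \<tau> \<Longrightarrow> - x \<in> lattice \<tau>"
  unfolding lattice_def
  by (elim CollectE exE, rule CollectI, rule_tac x="- m" in exI, rule_tac x="- l" in exI) simp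

lemma lattice_add: "x \<in> lattice \<tau> \<Longrightarrow> y \<in> lattice \<tau> \<Longrightarrow> x + y \<in> lattice \<tau>"
  unfolding lattice_def
  by (elim CollectE exE, rule CollectI, rule_tac x="m + ma" in exI, rule_tac x="l + la" in exI)
    (simp add: algebra_simps)

lemma lattice_diff: "x \<in> lattice \<tau> \<Longrightarrow> y \<in> lattice \<tau> \<Longrightarrow> x - y \<in> lattice \<tau>"
  using lattice_add[OF _ lattice_minus, of x \<tau> y] by simp

lemma latvec_in_lattice: "latvec \<tau> m l $ j \<in> lattice \<tau>"
  by (auto simp: lattice_def)

lemma analytic_subset_local:
  assumes "analytic_subset \<tau> A"
  shows "\<exists>U F. open U \<and> p \<in> U \<and> finite F \<and> (\<forall>f\<in>F. holo_on f U) \<and> A \<inter> U = {x\<in>U. \<forall>f\<in>F. f x = 0}"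
  using assms by (simp add: analytic_subset_def)

lemma analytic_subset_Int:
  assumes "analytic_subset \<tau> A" "analytic_subset \<tau> B"
  shows "analytic_subset \<tau> (A \<inter> B)"
  unfolding analytic_subset_def
proof (intro conjI allI)
  fix p
  obtain U F where 1: "open U" "p \<in> U" "finite F" "\<forall>f\<in>F. holo_on f U" "A \<inter> U = {x\<in>U. \<forall>f\<in>F. f x = 0}"
    using analytic_subset_local[OF assms(1), of p] by (elim exE conjE) (rule that)
  obtain V G where 2: "open V" "p \<in> V" "finite G" "\<forall>f\<in>G. holo_on f V" "B \<inter> V = {x\<in>V. \<forall>f\<in>G. f x = 0}"
    using analytic_subset_local[OF assms(2), of p] by (elim exE conjE) (rule that)
  note * = 1 2
  have "A \<inter> B \<inter> (U \<inter> V) = (A \<inter> U) \<inter> (B \<inter> V)" by blast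
  also have "\<dots> = {x\<in>U \<inter> V. \<forall>f\<in>F \<union> G. f x = 0}" unfolding *(5,10) by blast
  finally have "A \<inter> B \<inter> (U \<inter> V) = {x\<in>U \<inter> V. \<forall>f\<in>F \<union> G. f x = 0}" .
  moreover have "open (U \<inter> V)" "p \<in> U \<inter> V" "finite (F \<union> G)" using * by auto
  moreover have "\<forall>f\<in>F \<union> G. holo_on f (U \<inter> V)"
    using *(1,4,6,9) by (simp add: holo_on_cdiff open_Int ball_Un)
  ultimately show "\<exists>U F. open U \<and> p \<in> U \<and> finite F \<and> (\<forall>f\<in>F. holo_on f U) \<and> A \<inter> B \<inter> U = {x\<in>U. \<forall>f\<in>F. f x = 0}"
    by blast
qed (use assms in \<open>auto simp: analytic_subset_def\<close>)

text \<open>Locally a union is cut out by the products of an equation of one set with an equation of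
  the other.\<close>

lemma analytic_subset_Un:
  assumes "analytic_subset \<tau> A" "analytic_subset \<tau> B"
  shows "analytic_subset \<tau> (A \<union> B)"
  unfolding analytic_subset_def
proof (intro conjI allI)
  fix p
  obtain U F where 1: "open U" "p \<in> U" "finite F" "\<forall>f\<in>F. holo_on f U" "A \<inter> U = {x\<in>U. \<forall>f\<in>F. f x = 0}"
    using analytic_subset_local[OF assms(1), of p] by (elim exE conjE) (rule that)
  obtain V G where 2: "open V" "p \<in> V" "finite G" "\<forall>f\<in>G. holo_on f V" "B \<inter> V = {x\<in>V. \<forall>f\<in>G. f x = 0}"
    using analytic_subset_local[OF assms(2), of p] by (elim exE conjE) (rule that)
  note * = 1 2
  define H where "H = (\<lambda>(f, g) x. f x * g x) ` (F \<times> G)"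
  have "holo_on h (U \<inter> V)" if "h \<in> H" for h
    using that * by (auto simp: H_def holo_on_cdiff intro!: cdiff_mult)
  moreover have "(A \<union> B) \<inter> (U \<inter> V) = {x\<in>U \<inter> V. \<forall>h\<in>H. h x = 0}"
  proof -
    have "(A \<union> B) \<inter> (U \<inter> V) = ((A \<inter> U) \<inter> V) \<union> (U \<inter> (B \<inter> V))" by blast
    also have "\<dots> = {x\<in>U \<inter> V. \<forall>h\<in>H. h x = 0}"
      unfolding *(5,10) H_def by fastforce
    finally show ?thesis .
  qed
  moreover have "open (U \<inter> V)" "p \<in> U \<inter> V" "finite H" using * by (auto simp: H_def)
  ultimately show "\<exists>U F. open U \<and> p \<in> U \<and> finite F \<and> (\<forall>f\<in>F. holo_on f U) \<and> (A \<union> B) \<inter> U = {x\<in>U. \<forall>f\<in>F. f x = 0}"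
    by blast
qed (use assms in \<open>auto simp: analytic_subset_def\<close>)

lemma analytic_subset_Union:
  assumes "finite \<A>" "\<A> \<noteq> {}" "\<And>A. A \<in> \<A> \<Longrightarrow> analytic_subset \<tau> A"
  shows "analytic_subset \<tau> (\<Union>\<A>)"
  using assms by (induction \<A> rule: finite_ne_induct) (auto intro: analytic_subset_Un)

lemma irreducible_subset_finite_Union:
  assumes Z: "irreducible_subset \<tau> Z" and fin: "finite \<A>"
    and an: "\<And>A. A \<in> \<A> \<Longrightarrow> analytic_subset \<tau> A" and sub: "Z \<subseteq> \<Union>\<A>"
  shows "\<exists>A\<in>\<A>. Z \<subseteq> A"
  using fin an sub
proof (induction \<A> rule: finite_induct)
  case empty
  then show ?case using Z by (auto simp: irreducible_subset_def)
next
  case (insert A \<A>)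
  show ?case
  proof (cases "\<A> = {}")
    case True
    then show ?thesis using insert.prems by auto
  next
    case False
    have aZ: "analytic_subset \<tau> Z" using Z by (simp add: irreducible_subset_def)
    have "analytic_subset \<tau> A" "\<And>A. A \<in> \<A> \<Longrightarrow> analytic_subset \<tau> A" using insert.prems by auto
    then have "analytic_subset \<tau> (Z \<inter> A)" "analytic_subset \<tau> (Z \<inter> \<Union>\<A>)"
      using insert.hyps False by (intro analytic_subset_Int analytic_subset_Union aZ; simp)+
    moreover have "Z = (Z \<inter> A) \<union> (Z \<inter> \<Union>\<A>)" using insert.prems by auto
    ultimately have "Z = Z \<inter> A \<or> Z = Z \<inter> \<Union>\<A>"
      using Z unfolding irreducible_subset_def by blast
    then show ?thesis
    proof
      assume "Z = Z \<inter> \<Union>\<A>"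
      then have "Z \<subseteq> \<Union>\<A>" by blast
      then have "\<exists>A\<in>\<A>. Z \<subseteq> A" using insert.IH insert.prems(1) by simp
      then show ?thesis by blast
    qed blast
  qed
qed

text \<open>A complex line not contained in an analytic set meets it in a discrete set. Near each
  parameter the local equations either vanish identically along the line or have no accumulating
  common zeros; so the interior of the parameter set and the complement of its limit points are
  open, disjoint and cover the connected plane.\<close>

lemma analytic_subset_line:
  assumes A: "analytic_subset \<tau> A" and out: "u + z0 *s w \<notin> A"
  shows "\<exists>e>0. \<forall>z. z \<noteq> z1 \<longrightarrow> dist z z1 < e \<longrightarrow> u + z *s w \<notin> A"
proof -
  define T where "T = {z. u + z *s w \<in> A}"
  define S1 where "S1 = interior T"
  define S2 where "S2 = - {z. z islimpt T}"
  have "z \<in> S1 \<union> S2" for z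
  proof -
    obtain U F where U: "open U" "u + z *s w \<in> U" "finite F" "\<forall>f\<in>F. holo_on f U" "A \<inter> U = {x\<in>U. \<forall>f\<in>F. f x = 0}"
      using analytic_subset_local[OF A, of "u + z *s w"] by (elim exE conjE) (rule that)
    have "open ((\<lambda>z. u + z *s w) -` U)" by (rule open_vimage[OF U(1) continuous_line])
    then obtain e where e: "e > 0" "ball z e \<subseteq> (\<lambda>z. u + z *s w) -` U"
      using U(2) by (metis open_contains_ball vimage_eq)
    have hol: "(\<lambda>z. f (u + z *s w)) holomorphic_on ball z e" if "f \<in> F" for f
      using e U(4) that by (intro line_holomorphic) (auto simp: holo_on_cdiff)
    show ?thesis
    proof (cases "\<forall>f\<in>F. \<forall>z'\<in>ball z e. f (u + z' *s w) = 0")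
      case True
      then have "ball z e \<subseteq> T" using e U(5) by (auto simp: T_def)
      then show ?thesis using e(1) by (auto simp: S1_def mem_interior)
    next
      case False
      then obtain f b where f: "f \<in> F" "b \<in> ball z e" "f (u + b *s w) \<noteq> 0" by blast
      have "\<forall>\<^sub>F z' in at z. f (u + z' *s w) \<noteq> 0 \<and> z' \<in> ball z e"
        by (rule non_zero_neighbour_alt[OF hol[OF f(1)] _ _ _ f(2,3)]) (use e in auto)
      then obtain d where d: "d > 0" "\<And>z'. z' \<noteq> z \<Longrightarrow> dist z' z < d \<Longrightarrow> f (u + z' *s w) \<noteq> 0 \<and> z' \<in> ball z e"
        by (auto simp: eventually_at)
      have "z' \<notin> T" if "z' \<in> ball z d - {z}" for z'
      proof -
        have "f (u + z' *s w) \<noteq> 0" "z' \<in> ball z e" using that d(2)[of z'] by (auto simp: dist_commute)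
        moreover have "u + z' *s w \<in> U" using \<open>z' \<in> ball z e\<close> e(2) by blast
        ultimately show ?thesis using U(5) f(1) by (auto simp: T_def)
      qed
      then have "\<not> z islimpt T"
        using d(1) unfolding islimpt_approachable by (metis DiffI dist_commute mem_ball singletonD)
      then show ?thesis by (simp add: S2_def)
    qed
  qed
  then have cover: "S1 \<union> S2 = UNIV" by auto
  moreover have "open S1" "open S2" by (simp_all add: S1_def S2_def open_Compl closed_limpts)
  moreover have "S1 \<inter> S2 = {}" by (auto simp: S1_def S2_def interior_limit_point)
  ultimately have "S1 = {} \<or> S2 = {}"
    using connected_UNIV[where 'a = complex] unfolding connected_def by blast
  moreover have "z0 \<notin> S1" using out interior_subset by (fastforce simp: S1_def T_def)
  ultimately have "\<not> z1 islimpt T" using cover by (auto simp: S2_def)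
  then show ?thesis by (auto simp: islimpt_approachable T_def)
qed

text \<open>A generalised diagonal of E^n times the (y, \<lambda>)-plane, as a lattice-invariant set
  upstairs. That y and \<lambda> stay free is what keeps it out of the poles.\<close>

definition coset_set :: "complex \<Rightarrow> ('n::finite \<times> 'n) set \<Rightarrow> (complex^'n coord) set" where
  "coset_set \<tau> R = {x. \<forall>(a, b)\<in>R. x $ Pt a - x $ Pt b \<in> lattice \<tau>}"

definition lattice_rel :: "complex \<Rightarrow> complex^'n::finite coord \<Rightarrow> ('n \<times> 'n) set" where
  "lattice_rel \<tau> x = {(a, b). x $ Pt a - x $ Pt b \<in> lattice \<tau>}"

lemma analytic_coset_set:
  fixes R :: "('n::finite \<times> 'n) set"
  assumes \<tau>: "Im \<tau> > 0"
  shows "analytic_subset \<tau> (coset_set \<tau> R)"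
  unfolding analytic_subset_def
proof (intro conjI allI)
  fix m l and x :: "complex^'n coord"
  have "(x + latvec \<tau> m l) $ Pt a - (x + latvec \<tau> m l) $ Pt b \<in> lattice \<tau> \<longleftrightarrow> x $ Pt a - x $ Pt b \<in> lattice \<tau>" for a b
  proof -
    have d: "latvec \<tau> m l $ Pt a - latvec \<tau> m l $ Pt b \<in> lattice \<tau>"
      by (intro lattice_diff latvec_in_lattice)
    have e: "(x + latvec \<tau> m l) $ Pt a - (x + latvec \<tau> m l) $ Pt b =
      (x $ Pt a - x $ Pt b) + (latvec \<tau> m l $ Pt a - latvec \<tau> m l $ Pt b)" by simp
    show ?thesis unfolding e using lattice_add[OF _ d] lattice_diff[OF _ d] by (metis add_diff_cancel_right')
  qed
  then show "x + latvec \<tau> m l \<in> coset_set \<tau> R \<longleftrightarrow> x \<in> coset_set \<tau> R"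
    unfolding coset_set_def by blast
next
  fix p :: "complex^'n coord"
  show "\<exists>U F. open U \<and> p \<in> U \<and> finite F \<and> (\<forall>f\<in>F. holo_on f U) \<and> coset_set \<tau> R \<inter> U = {x\<in>U. \<forall>f\<in>F. f x = 0}"
    by (intro exI[of _ UNIV] exI[of _ "(\<lambda>(a, b) x. theta \<tau> (x $ Pt a - x $ Pt b)) ` R"])
      (auto simp: coset_set_def theta_eq_0_iff[OF \<tau>] intro!: entire_theta[OF \<tau>] entire_intros)
qed

text \<open>Modulo the lattice every point moves into one linear space \<open>V\<close>. If the set
  were the union of two proper analytic subsets, the line in \<open>V\<close> through a point
  outside the first and a point outside the second would meet both in discrete sets, which cannot
  cover it.\<close>

lemma irreducible_coset_set:
  fixes x0 :: "complex^'n::finite coord"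
  assumes \<tau>: "Im \<tau> > 0"
  shows "irreducible_subset \<tau> (coset_set \<tau> (lattice_rel \<tau> x0))"
proof -
  define R where "R = lattice_rel \<tau> x0"
  define A where "A = coset_set \<tau> R"
  define V where "V = {x :: complex^'n coord. \<forall>(a, b)\<in>R. x $ Pt a = x $ Pt b}"
  have "x0 \<in> A" by (auto simp: A_def coset_set_def R_def lattice_rel_def)
  have refl: "(a, a) \<in> R" for a by (simp add: R_def lattice_rel_def lattice_0)
  have sym: "(b, a) \<in> R" if "(a, b) \<in> R" for a b
    using that lattice_minus by (fastforce simp: R_def lattice_rel_def)
  have trans: "(a, c) \<in> R" if "(a, b) \<in> R" "(b, c) \<in> R" for a b c
    using that lattice_add by (fastforce simp: R_def lattice_rel_def)
  \<comment> \<open>A representative of each class of coordinates that agree modulo the lattice.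
    Translating every coordinate onto that of its representative leads into
    \<open>V\<close>.\<close>
  define \<rho> where "\<rho> = (\<lambda>a. SOME b. (a, b) \<in> R)"
  have \<rho>: "(a, \<rho> a) \<in> R" for a
    unfolding \<rho>_def by (rule someI[of _ a]) (rule refl)
  have \<rho>_eq: "\<rho> a = \<rho> b" if "(a, b) \<in> R" for a b
  proof -
    have "(a, c) \<in> R \<longleftrightarrow> (b, c) \<in> R" for c using that sym trans by blast
    then show ?thesis by (simp add: \<rho>_def)
  qed
  have toV: "\<exists>m l. x + latvec \<tau> m l \<in> V" if "x \<in> A" for x
  proof -
    have "\<exists>m l. x $ Pt (\<rho> a) - x $ Pt a = of_int m + of_int l * \<tau>" for a
      using that sym[OF \<rho>] unfolding A_def coset_set_def lattice_def by blast
    then obtain m l where ml: "\<And>a. x $ Pt (\<rho> a) - x $ Pt a = of_int (m a) + of_int (l a) * \<tau>"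
      by metis
    define M :: "int^'n coord" where "M = (\<chi> c. case c of Pt a \<Rightarrow> m a | _ \<Rightarrow> 0)"
    define L :: "int^'n coord" where "L = (\<chi> c. case c of Pt a \<Rightarrow> l a | _ \<Rightarrow> 0)"
    have "(x + latvec \<tau> M L) $ Pt a = x $ Pt (\<rho> a)" for a
      using ml[of a] by (simp add: M_def L_def algebra_simps)
    then have "x + latvec \<tau> M L \<in> V" unfolding V_def using \<rho>_eq by auto
    then show ?thesis by blast
  qed
  have "A = B \<or> A = C" if BC: "analytic_subset \<tau> B" "analytic_subset \<tau> C" "A = B \<union> C" for B C
  proof (rule ccontr)
    assume "\<not> (A = B \<or> A = C)"
    then obtain b c where bc: "b \<in> A" "b \<notin> B" "c \<in> A" "c \<notin> C" using BC(3) by blast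
    obtain m l m' l' where "b + latvec \<tau> m l \<in> V" "c + latvec \<tau> m' l' \<in> V"
      using toV bc by metis
    moreover define b' where "b' = b + latvec \<tau> m l"
    moreover define c' where "c' = c + latvec \<tau> m' l'"
    ultimately have V': "b' \<in> V" "c' \<in> V" by simp_all
    have nb: "b' \<notin> B" "c' \<notin> C" using bc BC(1,2) by (simp_all add: analytic_subset_def b'_def c'_def)
    define w where "w = b' - c'"
    have "c' + z *s w \<in> A" for z
    proof -
      have "(c' + z *s w) $ Pt a = (c' + z *s w) $ Pt b" if "(a, b) \<in> R" for a b
      proof -
        have "b' $ Pt a = b' $ Pt b" "c' $ Pt a = c' $ Pt b" using V' that by (auto simp: V_def)
        then show ?thesis by (simp add: w_def)
      qed
      then have "c' + z *s w \<in> V" by (auto simp: V_def)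
      then show ?thesis by (auto simp: V_def A_def coset_set_def lattice_0)
    qed
    moreover obtain e where e: "e > 0" "\<And>z. z \<noteq> 0 \<Longrightarrow> dist z 0 < e \<Longrightarrow> c' + z *s w \<notin> B"
      using analytic_subset_line[OF BC(1), of c' 1 w 0] nb by (auto simp: w_def)
    moreover obtain d where d: "d > 0" "\<And>z. z \<noteq> 0 \<Longrightarrow> dist z 0 < d \<Longrightarrow> c' + z *s w \<notin> C"
      using analytic_subset_line[OF BC(2), of c' 0 w 0] nb by auto
    moreover have "of_real (min d e / 2) \<noteq> (0::complex)" "norm (of_real (min d e / 2) :: complex) < d"
      "norm (of_real (min d e / 2) :: complex) < e"
      using e(1) d(1) by (auto simp: min_def)
    ultimately show False using BC(3) by (metis UnE dist_0_norm dist_commute)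
  qed
  then show ?thesis
    using analytic_coset_set[OF \<tau>, of R] \<open>x0 \<in> A\<close> unfolding irreducible_subset_def A_def R_def by blast
qed

definition chi_idx :: "'n::{finite,linorder} set \<Rightarrow> 'n \<Rightarrow> 'n" where
  "chi_idx K j = (if posn j < card K then nth_elem K (posn j) else nth_elem (- K) (posn j - card K))"

lemma chi_iota_nth [simp]:
  "chi_iota K x $ Pt j = x $ Pt (chi_idx K j)" "chi_iota K x $ Yc = x $ Yc" "chi_iota K x $ Lc = x $ Lc"
  by (simp_all add: chi_iota_def chi_idx_def)

lemma perm_coord_nth [simp]:
  "perm_coord \<sigma> x $ Pt j = x $ Pt (\<sigma> j)" "perm_coord \<sigma> x $ Yc = x $ Yc" "perm_coord \<sigma> x $ Lc = x $ Lc"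
  by (simp_all add: perm_coord_def)

text \<open>Being glued at \<open>x0\<close> is a system of congruences between coordinates, all
  recorded in \<open>lattice_rel\<close>. A point satisfying them is glued by the same permutations,
  with lattice vectors of its own.\<close>

lemma coset_set_subset_Y_inter:
  fixes x0 :: "complex^'n::{finite,linorder} coord"
  assumes "x0 \<in> Y_inter \<tau> k S"
  shows "coset_set \<tau> (lattice_rel \<tau> x0) \<subseteq> Y_inter \<tau> k S"
proof
  fix x assume x: "x \<in> coset_set \<tau> (lattice_rel \<tau> x0)"
  show "x \<in> Y_inter \<tau> k S"
    unfolding Y_inter_def
  proof (intro CollectI ballI)
    fix I J assume "I \<in> S" "J \<in> S"
    then obtain \<sigma> m l where g: "glued \<tau> k I J \<sigma> m l x0"
      using assms unfolding Y_inter_def by blast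
    have "x $ Pt (chi_idx J j) - x $ Pt (chi_idx I (\<sigma> j)) \<in> lattice \<tau>" for j
    proof -
      have "x0 $ Pt (chi_idx J j) = x0 $ Pt (chi_idx I (\<sigma> j)) + latvec \<tau> m l $ Pt j"
        using g unfolding glued_def by (metis chi_iota_nth(1) perm_coord_nth(1) vector_add_component)
      then have "(chi_idx J j, chi_idx I (\<sigma> j)) \<in> lattice_rel \<tau> x0"
        using latvec_in_lattice[of \<tau> m l "Pt j"] by (simp add: lattice_rel_def)
      then show ?thesis using x by (auto simp: coset_set_def)
    qed
    then have "\<exists>m l. x $ Pt (chi_idx J j) - x $ Pt (chi_idx I (\<sigma> j)) = of_int m + of_int l * \<tau>" for j
      by (simp add: lattice_def)
    then obtain m' l' where ml: "\<And>j. x $ Pt (chi_idx J j) - x $ Pt (chi_idx I (\<sigma> j)) = of_int (m' j) + of_int (l' j) * \<tau>"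
      by metis
    define M :: "int^'n coord" where "M = (\<chi> c. case c of Pt a \<Rightarrow> m' a | _ \<Rightarrow> 0)"
    define L :: "int^'n coord" where "L = (\<chi> c. case c of Pt a \<Rightarrow> l' a | _ \<Rightarrow> 0)"
    have "chi_iota J x $ c = (perm_coord \<sigma> (chi_iota I x) + latvec \<tau> M L) $ c" for c
    proof (cases c)
      case (Pt j)
      then show ?thesis using ml[of j] by (simp add: M_def L_def algebra_simps)
    qed (simp_all add: M_def L_def)
    then have "glued \<tau> k I J \<sigma> M L x" using g by (simp add: glued_def vec_eq_iff)
    then show "\<exists>\<sigma> m l. glued \<tau> k I J \<sigma> m l x" by blast
  qed
qed

text \<open>There are finitely many relations on [n], so the intersection is a finite union of
  irreducible coset sets. A component lies in one of them and equals it by maximality.\<close>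

lemma irred_component_Y_inter:
  assumes \<tau>: "Im \<tau> > 0" and Z: "irred_component \<tau> Z (Y_inter \<tau> k S)"
  obtains R where "Z = coset_set \<tau> R"
proof -
  define \<A> where "\<A> = (\<lambda>x. coset_set \<tau> (lattice_rel \<tau> x)) ` Y_inter \<tau> k S"
  have "finite \<A>"
    by (rule finite_subset[of _ "range (coset_set \<tau>)"]) (auto simp: \<A>_def)
  moreover have "Z \<subseteq> \<Union>\<A>"
  proof
    fix x assume "x \<in> Z"
    then have "x \<in> Y_inter \<tau> k S" using Z by (auto simp: irred_component_def)
    moreover have "x \<in> coset_set \<tau> (lattice_rel \<tau> x)" by (auto simp: coset_set_def lattice_rel_def)
    ultimately show "x \<in> \<Union>\<A>" by (auto simp: \<A>_def)
  qed
  moreover have "irreducible_subset \<tau> Z" using Z by (simp add: irred_component_def)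
  ultimately obtain A where "A \<in> \<A>" "Z \<subseteq> A"
    using irreducible_subset_finite_Union[of \<tau> Z \<A>] analytic_coset_set[OF \<tau>] by (auto simp: \<A>_def)
  then have "\<exists>R. Z = coset_set \<tau> R"
    using Z irreducible_coset_set[OF \<tau>] coset_set_subset_Y_inter
    unfolding irred_component_def \<A>_def by (smt (verit) imageE)
  then show ?thesis using that by blast
qed

section \<open>Admissible sections from entire functions\<close>

lemma continuous_on_vecI: "(\<And>c. continuous_on S (\<lambda>x. f x $ c)) \<Longrightarrow> continuous_on S f"
  using continuous_on_vec_lambda[of S "\<lambda>c x. f x $ c"] by simp

section \<open>Representatives of meromorphic functions and their values\<close>

lemma gen_eqI:
  assumes "entire h" "h a \<noteq> 0" "\<And>x. x \<in> U \<Longrightarrow> h x \<noteq> 0 \<Longrightarrow> f x = g x"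
  shows "gen_eq U f g"
proof -
  have "closure {x\<in>U. f x \<noteq> g x} \<subseteq> {x. h x = 0}"
    using assms by (intro closure_minimal closed_zeros_entire) auto
  from interior_mono[OF this] show ?thesis
    unfolding gen_eq_def interior_zeros_entire[OF assms(1,2)] by simp
qed

lemma open_nonzero: "open U \<Longrightarrow> continuous_on U f \<Longrightarrow> open {x\<in>U. f x \<noteq> (0::complex)}"
proof -
  assume "open U" "continuous_on U f"
  then have "open (U \<inter> f -` (- {0}))" by (intro continuous_open_preimage) auto
  moreover have "U \<inter> f -` (- {0}) = {x\<in>U. f x \<noteq> 0}" by auto
  ultimately show ?thesis by simp
qed

text \<open>Two holomorphic representatives can differ only on an open set covered by two closed
  sets without interior, hence nowhere.\<close>

lemma mero_value_eq:
  assumes "p \<in> U" "holo_on g U" "gen_eq U f g"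
  shows "mero_value f p = g p"
  unfolding mero_value_def
proof (rule the_equality)
  show "\<exists>U g'. p \<in> U \<and> holo_on g' U \<and> gen_eq U f g' \<and> g p = g' p" using assms by blast
  fix v assume "\<exists>U g. p \<in> U \<and> holo_on g U \<and> gen_eq U f g \<and> v = g p"
  then obtain V h where h: "p \<in> V" "holo_on h V" "gen_eq V f h" "v = h p" by blast
  define W where "W = {x\<in>U \<inter> V. g x - h x \<noteq> 0}"
  have "open W"
    unfolding W_def
  proof (rule open_nonzero)
    show "open (U \<inter> V)" using assms(2) h(2) by (auto simp: holo_on_def)
    show "continuous_on (U \<inter> V) (\<lambda>x. g x - h x)"
      using holo_on_continuous[OF assms(2)] holo_on_continuous[OF h(2)]
      by (intro continuous_intros) (auto intro: continuous_on_subset)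
  qed
  have "W \<subseteq> closure {x\<in>U. f x \<noteq> g x} \<union> closure {x\<in>V. f x \<noteq> h x}"
  proof
    fix x assume "x \<in> W"
    then have "x \<in> {x\<in>U. f x \<noteq> g x} \<or> x \<in> {x\<in>V. f x \<noteq> h x}" by (auto simp: W_def)
    then show "x \<in> closure {x\<in>U. f x \<noteq> g x} \<union> closure {x\<in>V. f x \<noteq> h x}"
      by (elim disjE) (rule UnI1 UnI2, erule subsetD[OF closure_subset])+
  qed
  with \<open>open W\<close> have "W \<subseteq> interior (closure {x\<in>U. f x \<noteq> g x} \<union> closure {x\<in>V. f x \<noteq> h x})"
    by (rule interior_maximal[rotated])
  also have "\<dots> = {}"
    using assms(3) h(3) by (subst interior_closed_Un_empty_interior) (auto simp: gen_eq_def)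
  finally show "v = g p" using assms(1) h(1,4) by (auto simp: W_def)
qed

text \<open>The denominator \<phi> may vanish at \<open>p\<close> although \<open>s\<close> is
  regular there. By density the relation \<open>g * \<phi> = G\<close> still holds on a whole
  neighbourhood, and it is all that gluing needs.\<close>

lemma regular_quotient:
  assumes G: "entire G" and \<phi>: "entire \<phi>" "\<phi> a \<noteq> 0" and H: "entire H" "H b \<noteq> 0"
    and s: "\<And>x. H x \<noteq> 0 \<Longrightarrow> s x = G x / \<phi> x" and reg: "regular_at s p"
  obtains U g where "p \<in> U" "open U" "continuous_on U g" "mero_value s p = g p"
    "\<And>x. x \<in> U \<Longrightarrow> g x * \<phi> x = G x"
proof -
  obtain U g where g: "p \<in> U" "holo_on g U" "gen_eq U s g" using reg by (auto simp: regular_at_def)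
  have U: "open U" using g(2) by (simp add: holo_on_def)
  obtain c where c: "H c * \<phi> c \<noteq> 0" using entire_mult_nonzero[OF H(1) \<phi>(1) H(2) \<phi>(2)] by blast
  have ent: "entire (\<lambda>x. H x * \<phi> x)" using H \<phi> by (intro entire_intros)
  have cg: "continuous_on U g" using g(2) by (rule holo_on_continuous)
  define W where "W = {x\<in>U. g x * \<phi> x - G x \<noteq> 0}"
  have "open W"
    unfolding W_def by (intro open_nonzero U continuous_intros cg)
      (use holo_on_continuous[OF \<phi>(1)] holo_on_continuous[OF G] in \<open>auto intro: continuous_on_subset\<close>)
  have "W \<subseteq> closure {x\<in>U. s x \<noteq> g x} \<union> {x. H x * \<phi> x = 0}"
  proof
    fix x assume x: "x \<in> W"
    show "x \<in> closure {x\<in>U. s x \<noteq> g x} \<union> {x. H x * \<phi> x = 0}"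
    proof (cases "H x * \<phi> x = 0")
      case False
      then have "s x * \<phi> x = G x" using s[of x] by simp
      then have "s x \<noteq> g x" using x by (auto simp: W_def)
      then have "x \<in> {x\<in>U. s x \<noteq> g x}" using x by (simp add: W_def)
      then show ?thesis by (rule UnI1[OF subsetD[OF closure_subset]])
    qed simp
  qed
  with \<open>open W\<close> have "W \<subseteq> interior (closure {x\<in>U. s x \<noteq> g x} \<union> {x. H x * \<phi> x = 0})"
    by (rule interior_maximal[rotated])
  also have "\<dots> = {}"
    using g(3) interior_zeros_entire[OF ent c]
    by (subst interior_closed_Un_empty_interior) (auto simp: gen_eq_def)
  finally have "g x * \<phi> x = G x" if "x \<in> U" for x using that by (auto simp: W_def)
  then show ?thesis using that[OF g(1) U cg mero_value_eq[OF g]] by blast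
qed

section \<open>Restriction of the twist to components, and gluing data\<close>

lemma chi_iota_add: "chi_iota K (x + y) = chi_iota K x + chi_iota K y"
proof -
  have "chi_iota K (x + y) $ c = (chi_iota K x + chi_iota K y) $ c" for c by (cases c) auto
  then show ?thesis by (simp add: vec_eq_iff)
qed

lemma chi_iota_cvec: "chi_iota K (cvec m) = cvec (chi_iota K m)"
proof -
  have "chi_iota K (cvec m) $ c = cvec (chi_iota K m) $ c" for c by (cases c) auto
  then show ?thesis by (simp add: vec_eq_iff)
qed

lemma chi_iota_latvec: "chi_iota K (latvec \<tau> m l) = latvec \<tau> (chi_iota K m) (chi_iota K l)"
proof -
  have "chi_iota K (latvec \<tau> m l) $ c = latvec \<tau> (chi_iota K m) (chi_iota K l) $ c" for c by (cases c) auto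
  then show ?thesis by (simp add: vec_eq_iff)
qed

lemma twist_eq_quad_fac: "twist \<tau> k m l x = quad_fac \<tau> (quad_form (N_kn k)) m l x"
  unfolding twist_def by (rule LB_eq_quad_fac) (rule N_kn_sym)

lemma twist_on_eq_quad_fac: "twist_on \<tau> k K m l x = quad_fac \<tau> (\<lambda>x. quad_form (N_kn k) (chi_iota K x)) m l x"
  unfolding twist_on_def twist_eq_quad_fac by (simp add: quad_fac_def chi_iota_add chi_iota_cvec)

lemma int_quad_quad_form: "(\<And>i j. N i j = N j i) \<Longrightarrow> int_quad (quad_form N)"
  unfolding int_quad_def by blast

lemma glued_YL:
  assumes "glued \<tau> k I J \<sigma> m l x"
  shows "latvec \<tau> m l $ Yc = 0" "latvec \<tau> m l $ Lc = 0"
proof -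
  have "chi_iota J x $ c = (perm_coord \<sigma> (chi_iota I x) + latvec \<tau> m l) $ c" for c
    using assms by (simp add: glued_def)
  from this[of Yc] this[of Lc] show "latvec \<tau> m l $ Yc = 0" "latvec \<tau> m l $ Lc = 0" by simp_all
qed

text \<open>Gluing constrains only the z; so y and \<lambda> can be moved with the gluing data kept
  fixed.\<close>

lemma glued_cong:
  assumes "glued \<tau> k I J \<sigma> m l x" "\<And>j. x' $ Pt j = x $ Pt j"
  shows "glued \<tau> k I J \<sigma> m l x'"
proof -
  have "chi_iota J x' $ c = (perm_coord \<sigma> (chi_iota I x') + latvec \<tau> m l) $ c" for c
  proof (cases c)
    case (Pt j)
    have "chi_iota J x $ Pt j = (perm_coord \<sigma> (chi_iota I x) + latvec \<tau> m l) $ Pt j"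
      using assms(1) by (simp add: glued_def)
    then show ?thesis using assms(2) by (simp add: Pt)
  qed (use glued_YL[OF assms(1)] in simp_all)
  then show ?thesis using assms(1) by (simp add: glued_def vec_eq_iff)
qed

text \<open>Reduces admissibility to entire numerators \<open>G K\<close> over a common denominator
  \<phi> in y and \<lambda>. Off the zeros of \<open>H K\<close> the total function
  \<open>s K\<close> agrees with the quotient; \<open>W K\<close> marks where the numerators are
  known to glue, and may vanish somewhere but never for all (y, \<lambda>) over a given z. It is
  applied with \<phi> = psi_I and with \<phi> = 1.\<close>

lemma admissible_mero_sectI:
  fixes G s :: "'n::{finite,linorder} set \<Rightarrow> complex^'n coord \<Rightarrow> complex"
  assumes \<tau>: "Im \<tau> > 0" and Q: "int_quad Q"
    and G: "\<And>K. card K = k \<Longrightarrow> entire (G K)"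
    and tG: "\<And>K. card K = k \<Longrightarrow> quasi_per \<tau> (\<lambda>x. Q x + R x + quad_form (N_kn k) (chi_iota K x)) (G K)"
    and \<phi>: "entire \<phi>" "\<phi> x0 \<noteq> 0" and t\<phi>: "quasi_per \<tau> R \<phi>"
    and \<phi>_cong: "\<And>x y. x $ Yc = y $ Yc \<Longrightarrow> x $ Lc = y $ Lc \<Longrightarrow> \<phi> x = \<phi> y"
    and H: "\<And>K. card K = k \<Longrightarrow> entire (H K)" "\<And>K. card K = k \<Longrightarrow> \<exists>a. H K a \<noteq> 0"
    and s: "\<And>K x. card K = k \<Longrightarrow> H K x \<noteq> 0 \<Longrightarrow> s K x = G K x / \<phi> x"
    and W: "\<And>K. card K = k \<Longrightarrow> entire (W K)"
      "\<And>K x. card K = k \<Longrightarrow> \<exists>x'. (\<forall>j. x' $ Pt j = x $ Pt j) \<and> W K x' \<noteq> 0"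
    and glue: "\<And>I J \<sigma> m l x. card I = k \<Longrightarrow> card J = k \<Longrightarrow> glued \<tau> k I J \<sigma> m l x \<Longrightarrow>
      W I x \<noteq> 0 \<Longrightarrow> G J x = twist \<tau> k m l (perm_coord \<sigma> (chi_iota I x)) * G I x"
  shows "admissible_mero_sect \<tau> k (quad_fac \<tau> Q) s"
  unfolding admissible_mero_sect_def
proof (intro conjI allI impI ballI)
  show "line_bundle \<tau> (quad_fac \<tau> Q)" by (rule int_quad_line_bundle[OF Q])
next
  fix K :: "'n set" assume K: "card K = k"
  obtain a where a: "H K a \<noteq> 0" using H(2)[OF K] ..
  have "mero (s K)"
    unfolding mero_def
  proof
    fix p
    have "gen_eq UNIV (s K) (\<lambda>x. G K x / \<phi> x)" by (rule gen_eqI[OF H(1)[OF K] a]) (use s K in auto)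
    then show "\<exists>U g h. p \<in> U \<and> holo_on g U \<and> holo_on h U \<and> interior {x\<in>U. h x = 0} = {} \<and>
        gen_eq U (s K) (\<lambda>x. g x / h x)"
      using G[OF K] \<phi>(1) interior_zeros_entire[OF \<phi>]
      by (intro exI[of _ UNIV] exI[of _ "G K"] exI[of _ \<phi>]) simp
  qed
  moreover have "gen_eq UNIV (\<lambda>x. s K (x + latvec \<tau> m l)) (\<lambda>x. (quad_fac \<tau> Q \<otimes>\<^sub>L twist_on \<tau> k K) m l x * s K x)" for m l
  proof -
    have 1: "entire (\<lambda>x. H K (x + latvec \<tau> m l))"
      by (rule entire_compose[OF H(1)[OF K]]) (auto intro!: entire_intros)
    have "H K ((a - latvec \<tau> m l) + latvec \<tau> m l) \<noteq> 0" using a by simp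
    from entire_mult_nonzero[OF H(1)[OF K] 1 a this]
    obtain c where c: "H K c * H K (c + latvec \<tau> m l) \<noteq> 0" by blast
    show ?thesis
    proof (rule gen_eqI[OF entire_mult[OF H(1)[OF K] 1] c])
      fix x assume "H K x * H K (x + latvec \<tau> m l) \<noteq> 0"
      then have "s K x = G K x / \<phi> x" "s K (x + latvec \<tau> m l) = G K (x + latvec \<tau> m l) / \<phi> (x + latvec \<tau> m l)"
        using s[OF K] by auto
      moreover have "G K (x + latvec \<tau> m l) = quad_fac \<tau> (\<lambda>x. Q x + R x + quad_form (N_kn k) (chi_iota K x)) m l x * G K x"
        "\<phi> (x + latvec \<tau> m l) = quad_fac \<tau> R m l x * \<phi> x"
        using tG[OF K] t\<phi> by (simp_all add: quasi_per_def)
      ultimately show "s K (x + latvec \<tau> m l) = (quad_fac \<tau> Q \<otimes>\<^sub>L twist_on \<tau> k K) m l x * s K x"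
        by (simp add: tensor_def twist_on_eq_quad_fac quad_fac_add)
    qed
  qed
  ultimately show "mero_sect \<tau> (quad_fac \<tau> Q \<otimes>\<^sub>L twist_on \<tau> k K) (s K)"
    by (simp add: mero_sect_def)
next
  fix S :: "'n set set" and Z :: "(complex^'n coord) set" and K :: "'n set"
  assume "\<forall>K\<in>S. card K = k" "irred_component \<tau> Z (Y_inter \<tau> k S)" "K \<in> S"
  then have K: "card K = k" by blast
  obtain a where a: "H K a \<noteq> 0" using H(2)[OF K] ..
  obtain E where Z: "Z = coset_set \<tau> E"
    using irred_component_Y_inter[OF \<tau> \<open>irred_component \<tau> Z (Y_inter \<tau> k S)\<close>] .
  \<comment> \<open>With all z equal to 0 every congruence holds, so this point lies on every
    component; its (y, \<lambda>) is taken off the zeros of \<phi>.\<close>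
  define p :: "complex^'n coord" where "p = (\<chi> c. case c of Pt j \<Rightarrow> 0 | _ \<Rightarrow> x0 $ c)"
  have p: "p $ Pt j = 0" "p $ Yc = x0 $ Yc" "p $ Lc = x0 $ Lc" for j by (simp_all add: p_def)
  have "p \<in> Z" by (auto simp: Z coset_set_def p lattice_0)
  moreover have "regular_at (s K) p"
    unfolding regular_at_def
  proof (intro exI conjI)
    have "\<phi> p = \<phi> x0" by (rule \<phi>_cong) (simp_all add: p)
    then show "p \<in> {x. \<phi> x \<noteq> 0}" using \<phi>(2) by simp
    have "open {x. \<phi> x \<noteq> 0}" using open_nonzero[OF open_UNIV holo_on_continuous[OF \<phi>(1)]] by simp
    then show "holo_on (\<lambda>x. G K x / \<phi> x) {x. \<phi> x \<noteq> 0}"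
      using G[OF K] \<phi>(1) by (auto simp: holo_on_cdiff intro!: cdiff_divide)
    show "gen_eq {x. \<phi> x \<noteq> 0} (s K) (\<lambda>x. G K x / \<phi> x)"
      by (rule gen_eqI[OF H(1)[OF K] a]) (use s K in auto)
  qed
  ultimately show "\<not> Z \<subseteq> polar_set (s K)" by (auto simp: polar_set_def)
next
  fix I J :: "'n set" and \<sigma> m l and x :: "complex^'n coord"
  assume I: "card I = k" and J: "card J = k" and gl: "glued \<tau> k I J \<sigma> m l x"
    and reg: "regular_at (s I) x" "regular_at (s J) x"
  obtain a b where ab: "H I a \<noteq> 0" "H J b \<noteq> 0" using H(2) I J by metis
  obtain U g where g: "x \<in> U" "open U" "continuous_on U g" "mero_value (s I) x = g x"
    "\<And>x. x \<in> U \<Longrightarrow> g x * \<phi> x = G I x"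
    using regular_quotient[OF G[OF I] \<phi> H(1)[OF I] ab(1) s[OF I] reg(1)] by blast
  obtain V h where h: "x \<in> V" "open V" "continuous_on V h" "mero_value (s J) x = h x"
    "\<And>x. x \<in> V \<Longrightarrow> h x * \<phi> x = G J x"
    using regular_quotient[OF G[OF J] \<phi> H(1)[OF J] ab(2) s[OF J] reg(2)] by blast
  \<comment> \<open>Freezing z at its value in \<open>x\<close> preserves the gluing relation. Near
    \<open>x\<close> the values can then be compared at generic (y, \<lambda>), where \<phi> and
    \<open>W I\<close> are nonzero, and carried back by continuity.\<close>
  define \<pi> where "\<pi> = (\<lambda>x'::complex^'n coord. \<chi> c. case c of Pt j \<Rightarrow> x $ Pt j | _ \<Rightarrow> x' $ c)"
  have \<pi>n: "\<pi> x' $ Pt j = x $ Pt j" "\<pi> x' $ Yc = x' $ Yc" "\<pi> x' $ Lc = x' $ Lc" for x' j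
    by (simp_all add: \<pi>_def)
  have \<pi>x: "\<pi> x = x"
  proof -
    have "\<pi> x $ c = x $ c" for c by (cases c) (simp_all add: \<pi>n)
    then show ?thesis by (simp add: vec_eq_iff)
  qed
  have c\<pi>: "continuous_on S \<pi>" for S
  proof (rule continuous_on_vecI)
    fix c show "continuous_on S (\<lambda>x. \<pi> x $ c)" by (cases c) (auto simp: \<pi>n intro!: continuous_intros)
  qed
  define C where "C = (\<lambda>y. twist \<tau> k m l (perm_coord \<sigma> (chi_iota I y)))"
  have cC: "continuous_on S C" for S
  proof -
    have "continuous_on S (\<lambda>y. perm_coord \<sigma> (chi_iota I y))"
    proof (rule continuous_on_vecI)
      fix c show "continuous_on S (\<lambda>y. perm_coord \<sigma> (chi_iota I y) $ c)"
        by (cases c) (auto intro!: continuous_intros)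
    qed
    moreover have "continuous_on UNIV (twist \<tau> k m l)"
      unfolding twist_eq_quad_fac[abs_def] by (intro quad_fac_continuous int_quad_continuous int_quad_quad_form N_kn_sym)
    ultimately show ?thesis unfolding C_def by (auto intro: continuous_on_compose2)
  qed
  have W\<pi>: "entire (\<lambda>y. W I (\<pi> y))"
  proof (rule entire_compose[OF W(1)[OF I]])
    fix c show "entire (\<lambda>x. \<pi> x $ c)" by (cases c) (auto simp: \<pi>n intro!: entire_intros)
  qed
  obtain x' where x': "\<And>j. x' $ Pt j = x $ Pt j" "W I x' \<noteq> 0" using W(2)[OF I] by blast
  have "\<pi> x' $ c = x' $ c" for c by (cases c) (simp_all add: \<pi>n x')
  then have "W I (\<pi> x') \<noteq> 0" using x'(2) by (metis vec_eq_iff)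
  from entire_mult_nonzero[OF \<phi>(1) W\<pi> \<phi>(2) this]
  obtain c0 where c0: "\<phi> c0 * W I (\<pi> c0) \<noteq> 0" by blast
  define O' where "O' = \<pi> -` (U \<inter> V)"
  have "open O'" unfolding O'_def using g(2) h(2) c\<pi> by (intro open_vimage) auto
  have "h (\<pi> x) = C (\<pi> x) * g (\<pi> x)"
  proof (rule eq_off_zeros[OF entire_mult[OF \<phi>(1) W\<pi>] c0, of O' "\<lambda>x. h (\<pi> x)" "\<lambda>x. C (\<pi> x) * g (\<pi> x)"])
    show "continuous_on O' (\<lambda>x. h (\<pi> x))"
      by (rule continuous_on_compose2[OF h(3) c\<pi>]) (auto simp: O'_def)
    show "continuous_on O' (\<lambda>x. C (\<pi> x) * g (\<pi> x))"
      by (intro continuous_intros continuous_on_compose2[OF g(3) c\<pi>] continuous_on_compose2[OF cC c\<pi>])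
        (auto simp: O'_def)
    fix y assume "y \<in> O'" "\<phi> y * W I (\<pi> y) \<noteq> 0"
    then have y: "y \<in> O'" "\<phi> y \<noteq> 0" "W I (\<pi> y) \<noteq> 0" by auto
    have "\<phi> (\<pi> y) = \<phi> y" by (rule \<phi>_cong) (simp_all add: \<pi>n)
    moreover have "glued \<tau> k I J \<sigma> m l (\<pi> y)" by (rule glued_cong[OF gl]) (simp add: \<pi>n)
    from glue[OF I J this y(3)] have "G J (\<pi> y) = C (\<pi> y) * G I (\<pi> y)" by (simp add: C_def)
    moreover have "g (\<pi> y) * \<phi> (\<pi> y) = G I (\<pi> y)" "h (\<pi> y) * \<phi> (\<pi> y) = G J (\<pi> y)"
      using y g(5) h(5) by (auto simp: O'_def)
    ultimately have "h (\<pi> y) * \<phi> y = (C (\<pi> y) * g (\<pi> y)) * \<phi> y" by (metis mult.assoc)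
    then show "h (\<pi> y) = C (\<pi> y) * g (\<pi> y)" using y(2) by simp
  qed (use \<open>open O'\<close> g(1) h(1) \<pi>x in \<open>auto simp: O'_def\<close>)
  then show "mero_value (s J) x = twist \<tau> k m l (perm_coord \<sigma> (chi_iota I x)) * mero_value (s I) x"
    unfolding \<pi>x g(4) h(4) C_def .
qed

section \<open>Permutations and orderings\<close>

definition sort_pair :: "(nat \<Rightarrow> nat) \<Rightarrow> nat \<times> nat \<Rightarrow> nat \<times> nat" where
  "sort_pair \<sigma> = (\<lambda>(i, j). if \<sigma> i < \<sigma> j then (\<sigma> i, \<sigma> j) else (\<sigma> j, \<sigma> i))"

lemma bij_betw_sort_pair:
  assumes \<sigma>: "\<sigma> permutes {..<k}"
  shows "bij_betw (sort_pair \<sigma>) (pairs k) (pairs k)"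
proof -
  have inj: "\<sigma> i = \<sigma> j \<longleftrightarrow> i = j" for i j using permutes_inj[OF \<sigma>] by (auto dest: injD)
  have lt: "\<sigma> i < k \<longleftrightarrow> i < k" for i using permutes_in_image[OF \<sigma>, of i] by simp
  have "inj_on (sort_pair \<sigma>) (pairs k)"
    by (auto simp: inj_on_def sort_pair_def pairs_def inj split: if_splits)
  moreover have "sort_pair \<sigma> ` pairs k \<subseteq> pairs k"
    using inj lt by (auto simp: sort_pair_def pairs_def not_less order.order_iff_strict split: if_splits)
  ultimately show ?thesis
    by (simp add: bij_betw_def endo_inj_surj)
qed

lemma prod_pairs_permute:
  assumes \<sigma>: "\<sigma> permutes {..<k}" and sym: "\<And>i j. h i j = h j i"
  shows "(\<Prod>(i, j)\<in>pairs k. h (\<sigma> i) (\<sigma> j)) = (\<Prod>(i, j)\<in>pairs k. h i j :: complex)"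
proof -
  have "(\<Prod>(i, j)\<in>pairs k. h (\<sigma> i) (\<sigma> j)) = (\<Prod>p\<in>pairs k. (\<lambda>(i, j). h i j) (sort_pair \<sigma> p))"
    by (rule prod.cong) (auto simp: sort_pair_def sym)
  then show ?thesis by (simp only: prod.reindex_bij_betw[OF bij_betw_sort_pair[OF \<sigma>]])
qed

lemma sum_pairs_permute:
  assumes \<sigma>: "\<sigma> permutes {..<k}" and sym: "\<And>i j. h i j = h j i"
  shows "(\<Sum>(i, j)\<in>pairs k. h (\<sigma> i) (\<sigma> j)) = (\<Sum>(i, j)\<in>pairs k. h i j :: complex)"
proof -
  have "(\<Sum>(i, j)\<in>pairs k. h (\<sigma> i) (\<sigma> j)) = (\<Sum>p\<in>pairs k. (\<lambda>(i, j). h i j) (sort_pair \<sigma> p))"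
    by (rule sum.cong) (auto simp: sort_pair_def sym)
  then show ?thesis by (simp only: sum.reindex_bij_betw[OF bij_betw_sort_pair[OF \<sigma>]])
qed

text \<open>The sign of \<sigma> as a product over inversions, the shape in which it comes out of an
  antisymmetric product over pairs.\<close>

definition perm_sgn :: "nat \<Rightarrow> (nat \<Rightarrow> nat) \<Rightarrow> complex" where
  "perm_sgn k \<sigma> = (\<Prod>(i, j)\<in>pairs k. if \<sigma> i < \<sigma> j then 1 else - 1)"

lemma perm_sgn_square: "perm_sgn k \<sigma> * perm_sgn k \<sigma> = 1"
  unfolding perm_sgn_def prod.distrib[symmetric] by (rule prod.neutral) auto

lemma perm_sgn_nonzero: "perm_sgn k \<sigma> \<noteq> 0"
  using perm_sgn_square[of k \<sigma>] by auto

lemma prod_pairs_antisym: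
  assumes \<sigma>: "\<sigma> permutes {..<k}" and anti: "\<And>i j. h j i = - h i j"
  shows "(\<Prod>(i, j)\<in>pairs k. h (\<sigma> i) (\<sigma> j)) = perm_sgn k \<sigma> * (\<Prod>(i, j)\<in>pairs k. h i j)"
proof -
  have "h (\<sigma> i) (\<sigma> j) = (if \<sigma> i < \<sigma> j then 1 else - 1) * (\<lambda>(i, j). h i j) (sort_pair \<sigma> (i, j))" for i j
    using anti[of "\<sigma> j" "\<sigma> i"] by (simp add: sort_pair_def)
  then have "(\<Prod>(i, j)\<in>pairs k. h (\<sigma> i) (\<sigma> j)) =
    perm_sgn k \<sigma> * (\<Prod>p\<in>pairs k. (\<lambda>(i, j). h i j) (sort_pair \<sigma> p))"
    unfolding perm_sgn_def prod.distrib[symmetric] by (intro prod.cong) auto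
  then show ?thesis by (simp only: prod.reindex_bij_betw[OF bij_betw_sort_pair[OF \<sigma>]])
qed

text \<open>Both sides are the factor by which the nonzero Vandermonde product of the numbers 0,
  ..., k - 1 changes, read off in one step or in two.\<close>

lemma perm_sgn_comp:
  assumes "\<rho> permutes {..<k}" "\<sigma> permutes {..<k}"
  shows "perm_sgn k (\<rho> \<circ> \<sigma>) = perm_sgn k \<rho> * perm_sgn k \<sigma>"
proof -
  define d :: "nat \<Rightarrow> nat \<Rightarrow> complex" where "d = (\<lambda>i j. of_nat i - of_nat j)"
  have d: "d j i = - d i j" for i j by (simp add: d_def)
  have nz: "(\<Prod>(i, j)\<in>pairs k. d i j) \<noteq> 0"
    unfolding prod_zero_iff[OF finite_pairs] by (auto simp: d_def pairs_def)
  have "perm_sgn k (\<rho> \<circ> \<sigma>) * (\<Prod>(i, j)\<in>pairs k. d i j) = (\<Prod>(i, j)\<in>pairs k. d (\<rho> (\<sigma> i)) (\<rho> (\<sigma> j)))"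
    using prod_pairs_antisym[where h = d, OF permutes_compose[OF assms(2,1)] d] by simp
  also have "\<dots> = perm_sgn k \<sigma> * (perm_sgn k \<rho> * (\<Prod>(i, j)\<in>pairs k. d i j))"
    unfolding prod_pairs_antisym[where h = d, OF assms(1) d, symmetric]
    by (rule prod_pairs_antisym[OF assms(2)]) (rule d)
  finally show ?thesis using nz by (simp add: mult_ac)
qed

lemma perm_sgn_transpose_01:
  assumes "2 \<le> k"
  shows "perm_sgn k (Transposition.transpose 0 1) = - 1"
proof -
  have "perm_sgn k (Transposition.transpose 0 1) = (\<Prod>p\<in>pairs k. if p = (0, 1) then - 1 else 1)"
    unfolding perm_sgn_def by (intro prod.cong) (auto simp: pairs_def Transposition.transpose_def split: if_splits)
  also have "\<dots> = - 1" using assms by (subst prod.delta[OF finite_pairs]) (auto simp: pairs_def)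
  finally show ?thesis .
qed

lemma perm_sgn_transpose:
  assumes "a < b" "b < k"
  shows "perm_sgn k (Transposition.transpose a b) = - 1"
proof -
  \<comment> \<open>\<rho> carries 0 to a and 1 to b, so it conjugates the transposition of 0 and 1,
    which has a single inversion, into the given one.\<close>
  define \<rho> where "\<rho> = Transposition.transpose 0 a \<circ> Transposition.transpose 1 (Transposition.transpose 0 a b)"
  have tr: "Transposition.transpose i j permutes {..<k}" if "i < k" "j < k" for i j
    using that by (intro permutes_swap_id) auto
  have e: "Transposition.transpose 0 a b = b" using assms by (simp add: Transposition.transpose_def)
  then have k: "2 \<le> k" "Transposition.transpose 0 a b < k" "Transposition.transpose 0 a b \<noteq> 0"
    using assms by simp_all
  have \<rho>: "\<rho> permutes {..<k}"
    unfolding \<rho>_def using k assms by (intro permutes_compose tr) auto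
  have \<rho>01: "\<rho> 0 = a" "\<rho> 1 = b" using assms by (simp_all add: \<rho>_def e)
  have inj: "\<rho> i = \<rho> j \<longleftrightarrow> i = j" for i j using permutes_inj[OF \<rho>] by (auto dest: injD)
  have "Transposition.transpose a b \<circ> \<rho> = \<rho> \<circ> Transposition.transpose 0 1"
  proof
    fix x
    show "(Transposition.transpose a b \<circ> \<rho>) x = (\<rho> \<circ> Transposition.transpose 0 1) x"
      using \<rho>01 inj[of x 0] inj[of x 1] by (auto simp: Transposition.transpose_def)
  qed
  then have "perm_sgn k (Transposition.transpose a b) * perm_sgn k \<rho> = perm_sgn k \<rho> * perm_sgn k (Transposition.transpose 0 1)"
    using perm_sgn_comp[OF tr \<rho>, of a b] perm_sgn_comp[OF \<rho> tr, of 0 1] assms by simp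
  then show ?thesis using perm_sgn_transpose_01[OF k(1)] perm_sgn_nonzero[of k \<rho>] by simp
qed

lemma prod_pairs_nested: "(\<Prod>j<k. \<Prod>i<j. h i j) = (\<Prod>(i, j)\<in>pairs k. h i j)"
proof -
  have "(\<Prod>j<k. \<Prod>i<j. h i j) = (\<Prod>(j, i)\<in>Sigma {..<k} (\<lambda>j. {..<j}). h i j)"
    by (rule prod.Sigma) auto
  also have "\<dots> = (\<Prod>(i, j)\<in>pairs k. h i j)"
    by (rule prod.reindex_bij_witness[of _ "\<lambda>(i, j). (j, i)" "\<lambda>(i, j). (j, i)"]) (auto simp: pairs_def)
  finally show ?thesis .
qed

lemma sum_pairs_nested: "(\<Sum>j<k. \<Sum>i<j. h i j) = (\<Sum>(i, j)\<in>pairs k. h i j)"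
proof -
  have "(\<Sum>j<k. \<Sum>i<j. h i j) = (\<Sum>(j, i)\<in>Sigma {..<k} (\<lambda>j. {..<j}). h i j)"
    by (rule sum.Sigma) auto
  also have "\<dots> = (\<Sum>(i, j)\<in>pairs k. h i j)"
    by (rule sum.reindex_bij_witness[of _ "\<lambda>(i, j). (j, i)" "\<lambda>(i, j). (j, i)"]) (auto simp: pairs_def)
  finally show ?thesis .
qed

text \<open>t_r is the first entry of k - 1 - r pairs and the second entry of r pairs.\<close>

lemma sum_pairs_diff: "(\<Sum>(i, j)\<in>pairs k. t i - t j) = (\<Sum>r<k. (of_nat k - 1 - 2 * of_nat r) * (t r :: complex))"
proof (induction k)
  case (Suc k)
  have "(\<Sum>(i, j)\<in>pairs (Suc k). t i - t j) = (\<Sum>r<k. (of_nat k - 1 - 2 * of_nat r) * t r) + (\<Sum>i<k. t i - t k)"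
    unfolding Suc[symmetric] by (simp flip: sum_pairs_nested)
  also have "\<dots> = (\<Sum>r<k. (of_nat k - 1 - 2 * of_nat r) * t r + t r) - of_nat k * t k"
    by (simp add: sum.distrib sum_subtractf)
  also have "\<dots> = (\<Sum>r<Suc k. (of_nat (Suc k) - 1 - 2 * of_nat r) * t r)"
    by (simp add: algebra_simps)
  finally show ?case .
qed (simp add: pairs_def)

lemma sum_square_diff_pairs:
  "(\<Sum>i<k. \<Sum>j<k. (t i - t j)\<^sup>2) = 2 * (\<Sum>(i, j)\<in>pairs k. (t i - t j)\<^sup>2 :: complex)"
proof (induction k)
  case (Suc k)
  have "(\<Sum>i<k. (t k - t i)\<^sup>2) = (\<Sum>i<k. (t i - t k)\<^sup>2)" by (simp add: power2_commute)
  with Suc show ?case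
    by (simp add: sum.distrib flip: sum_pairs_nested)
qed (simp add: pairs_def)

section \<open>Increasing enumeration of subsets of [n]\<close>

lemma nth_elem_mem: "r < card K \<Longrightarrow> nth_elem K r \<in> K"
  unfolding nth_elem_def by (metis finite length_sorted_list_of_set nth_mem set_sorted_list_of_set)

lemma nth_elem_mono: "r < s \<Longrightarrow> s < card K \<Longrightarrow> nth_elem K r < nth_elem K s"
  unfolding nth_elem_def
  by (metis length_sorted_list_of_set sorted_wrt_nth_less strict_sorted_list_of_set)

lemma nth_elem_less_iff: "r < card K \<Longrightarrow> s < card K \<Longrightarrow> nth_elem K r < nth_elem K s \<longleftrightarrow> r < s"
  by (metis linorder_neqE_nat nth_elem_mono order_less_asym less_irrefl)

lemma inj_on_nth_elem: "inj_on (nth_elem K) {..<card K}"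
  by (rule inj_onI) (metis lessThan_iff linorder_neqE_nat nth_elem_mono less_irrefl)

lemma bij_betw_nth_elem: "bij_betw (nth_elem K) {..<card K} K"
  unfolding bij_betw_def
proof
  show "nth_elem K ` {..<card K} = K"
    by (rule card_subset_eq) (auto simp: nth_elem_mem card_image[OF inj_on_nth_elem])
qed (rule inj_on_nth_elem)

lemma posn_less_card: "posn (a :: 'n::{finite,linorder}) < CARD('n)"
  using range_posn[where 'n='n] by blast

lemma posn_nth_elem_UNIV:
  assumes "r < CARD('n::{finite,linorder})"
  shows "posn (nth_elem (UNIV :: 'n set) r) = r"
proof -
  have "{b. b < nth_elem (UNIV :: 'n set) r} = nth_elem UNIV ` {..<r}"
  proof (intro set_eqI iffI)
    fix b :: 'n assume b: "b \<in> {b. b < nth_elem UNIV r}"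
    obtain s where s: "s < CARD('n)" "b = nth_elem UNIV s"
      using bij_betw_nth_elem[of "UNIV :: 'n set"] by (metis UNIV_I bij_betw_def imageE lessThan_iff)
    then show "b \<in> nth_elem UNIV ` {..<r}"
      using b assms nth_elem_less_iff[of s "UNIV :: 'n set" r] by auto
  qed (use assms nth_elem_mono in auto)
  then show ?thesis
    unfolding posn_def using assms
    by (simp, subst card_image) (auto intro: inj_on_subset[OF inj_on_nth_elem])
qed

lemma nth_elem_UNIV_posn: "nth_elem UNIV (posn a) = a"
  using posn_nth_elem_UNIV[OF posn_less_card[of a]] inj_posn by (auto dest: injD)

lemma n_above_nth_elem:
  assumes "r < card I"
  shows "n_above (nth_elem I r) I = card I - 1 - r"
proof -
  have "{l\<in>I. l > nth_elem I r} = nth_elem I ` {r<..<card I}"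
  proof (intro set_eqI iffI)
    fix b assume b: "b \<in> {l\<in>I. l > nth_elem I r}"
    then obtain s where "s < card I" "b = nth_elem I s"
      using bij_betw_nth_elem[of I] by (metis (no_types, lifting) bij_betw_def imageE lessThan_iff mem_Collect_eq)
    then show "b \<in> nth_elem I ` {r<..<card I}"
      using b nth_elem_less_iff[OF assms, of s] by auto
  qed (use assms nth_elem_mono nth_elem_mem in auto)
  then show ?thesis
    unfolding n_above_def
    by (simp, subst card_image) (auto intro: inj_on_subset[OF inj_on_nth_elem])
qed

text \<open>Above i_r there are k - 1 - r elements of I, and the remaining elements above are
  counted through the position of i_r. So the weight depends only on r and that position, in just
  the way that makes the linear terms in \<open>summand_form\<close> independent of r.\<close>

lemma w_wt_nth_elem:
  fixes I :: "'n::{finite,linorder} set"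
  assumes "r < card I"
  shows "w_wt (nth_elem I r) I = 2 * (int (card I) - 1 - int r) - int CARD('n) + 1 + int (posn (nth_elem I r))"
proof -
  define j where "j = nth_elem I r"
  have "(UNIV :: 'n set) = {b. b < j} \<union> ({j} \<union> ({l\<in>I. l > j} \<union> {l\<in>- I. l > j}))" by auto
  moreover have "card ({b. b < j} \<union> ({j} \<union> ({l\<in>I. l > j} \<union> {l\<in>- I. l > j}))) =
      posn j + (1 + (n_above j I + n_above j (- I)))"
    unfolding posn_def n_above_def by (subst card_Un_disjoint; auto)+
  ultimately have "CARD('n) = posn j + (1 + (n_above j I + n_above j (- I)))" by simp
  moreover have "n_above j I = card I - 1 - r" unfolding j_def by (rule n_above_nth_elem[OF assms])
  ultimately show ?thesis using assms by (simp add: w_wt_def of_nat_diff flip: j_def)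
qed

lemma bij_chi_idx: "bij (chi_idx (K :: 'n::{finite,linorder} set))"
proof -
  have cK: "card (- K) = CARD('n) - card K" by (simp add: Compl_eq_Diff_UNIV card_Diff_subset)
  have "inj (chi_idx K)"
  proof (rule injI)
    fix a b assume eq: "chi_idx K a = chi_idx K b"
    have mem: "posn j < card K \<Longrightarrow> chi_idx K j \<in> K" "\<not> posn j < card K \<Longrightarrow> chi_idx K j \<in> - K" for j
      using posn_less_card[of j] nth_elem_mem[of "posn j" K] nth_elem_mem[of "posn j - card K" "- K"] cK
      by (auto simp: chi_idx_def)
    have iff: "posn a < card K \<longleftrightarrow> posn b < card K"
      using mem eq by (metis ComplD)
    have "posn a = posn b"
    proof (cases "posn a < card K")
      case True
      then have "nth_elem K (posn a) = nth_elem K (posn b)" using eq iff by (simp add: chi_idx_def)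
      then show ?thesis using inj_onD[OF inj_on_nth_elem, of K] True iff by auto
    next
      case False
      then have e: "nth_elem (- K) (posn a - card K) = nth_elem (- K) (posn b - card K)"
        using eq iff by (simp add: chi_idx_def)
      have "posn a - card K = posn b - card K"
        by (rule inj_onD[OF inj_on_nth_elem e]) (use False iff cK posn_less_card[of a] posn_less_card[of b] in auto)
      then show ?thesis using False iff by simp
    qed
    then show "a = b" using inj_posn by (auto dest: injD)
  qed
  then show ?thesis by (simp add: bij_def finite_UNIV_inj_surj)
qed

lemma sum_chi_iota: "(\<Sum>c\<in>UNIV. h (chi_iota K x $ Pt c)) = (\<Sum>a\<in>UNIV. h (x $ Pt a))"
  using sum.reindex_bij_betw[OF bij_chi_idx[of K], of "\<lambda>a. h (x $ Pt a)"] by simp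

lemma of_int_lattice_eq_0:
  assumes "Im \<tau> > 0" "of_int m + of_int l * \<tau> = (0::complex)"
  shows "m = 0" "l = 0"
proof -
  have "Im (of_int m + of_int l * \<tau>) = 0" using assms(2) by simp
  then show "l = 0" using assms(1) by simp
  then show "m = 0" using assms(2) by simp
qed

text \<open>If \<open>v'\<close> is both a rearrangement and a lattice translate of \<open>v\<close>, then \<open>l\<close> is the difference
  of the function \<open>\<lfloor>Im / Im \<tau>\<rfloor>\<close> at \<open>v'\<close> and \<open>v\<close>, and the sum telescopes up to an even integer.\<close>

lemma rearranged_translate_even:
  fixes v v' :: "'c::finite \<Rightarrow> complex"
  assumes \<tau>: "Im \<tau> > 0" and v': "\<And>c. v' c = v c + (of_int (m c) + of_int (l c) * \<tau>)"
    and re: "\<And>h :: complex \<Rightarrow> complex. (\<Sum>c\<in>UNIV. h (v' c)) = (\<Sum>c\<in>UNIV. h (v c))"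
  shows "\<exists>N :: int. (\<Sum>c\<in>UNIV. 2 * of_int (l c) * v c + \<tau> * (of_int (l c))\<^sup>2) = 2 * of_int N"
proof -
  define L where "L = (\<lambda>w. \<lfloor>Im w / Im \<tau>\<rfloor>)"
  define \<beta> where "\<beta> = (\<lambda>w. w - of_int (L w) * \<tau>)"
  \<comment> \<open>The summand 2 l v + \<tau> l^2, taken for the shift of the strip representative
    \<open>\<beta> w\<close> by \<open>L w\<close> periods.\<close>
  define h where "h = (\<lambda>w. 2 * of_int (L w) * \<beta> w + \<tau> * (of_int (L w))\<^sup>2)"
  have Lv': "L (v' c) = L (v c) + l c" for c
  proof -
    have "Im (v' c) / Im \<tau> = Im (v c) / Im \<tau> + of_int (l c)"
      using \<tau> by (simp add: v' field_simps)
    then show ?thesis by (simp add: L_def)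
  qed
  have "2 * of_int (l c) * v c + \<tau> * (of_int (l c))\<^sup>2 =
      h (v' c) - h (v c) - 2 * of_int (L (v' c) * m c)" for c
  proof -
    have 1: "\<beta> (v' c) = \<beta> (v c) + of_int (m c)"
      unfolding \<beta>_def Lv' by (simp add: v' algebra_simps)
    have 2: "v c = \<beta> (v c) + of_int (L (v c)) * \<tau>" by (simp add: \<beta>_def)
    have "h (v' c) - h (v c) - 2 * of_int (L (v' c) * m c) =
      2 * of_int (l c) * (\<beta> (v c) + of_int (L (v c)) * \<tau>) + \<tau> * (of_int (l c))\<^sup>2"
      unfolding h_def 1 Lv' by (simp add: algebra_simps power2_eq_square)
    then show ?thesis using 2 by simp
  qed
  then have "(\<Sum>c\<in>UNIV. 2 * of_int (l c) * v c + \<tau> * (of_int (l c))\<^sup>2) =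
      (\<Sum>c\<in>UNIV. h (v' c)) - (\<Sum>c\<in>UNIV. h (v c)) - 2 * of_int (\<Sum>c\<in>UNIV. L (v' c) * m c)"
    by (simp add: sum_subtractf sum_distrib_left)
  also have "\<dots> = 2 * of_int (- (\<Sum>c\<in>UNIV. L (v' c) * m c))"
    unfolding re by simp
  finally show ?thesis by blast
qed

section \<open>The numerator of the weight function\<close>

definition weight_num :: "complex \<Rightarrow> 'n::{finite,linorder} set \<Rightarrow> (nat \<Rightarrow> complex) \<Rightarrow>
    ('n \<Rightarrow> complex) \<Rightarrow> complex \<Rightarrow> complex \<Rightarrow> complex" where
  "weight_num \<tau> I t z y lam =
     (\<Prod>r<card I.
        (\<Prod>a | a < nth_elem I r. theta \<tau> (t r - z a + y)) *
        theta \<tau> (lam + t r - z (nth_elem I r) - of_int (w_wt (nth_elem I r) I) * y) *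
        (\<Prod>a | a > nth_elem I r. theta \<tau> (t r - z a)))"

definition theta_vdm :: "complex \<Rightarrow> nat \<Rightarrow> (nat \<Rightarrow> complex) \<Rightarrow> complex" where
  "theta_vdm \<tau> k t = (\<Prod>(i, j)\<in>pairs k. theta \<tau> (t i - t j))"

text \<open>The y-shifted factors as they stand in the denominator of a summand.
  \<open>theta_dn\<close> supplies the opposite ones: only their product \<open>theta_sh\<close> is
  symmetric in t.\<close>

definition theta_up :: "complex \<Rightarrow> nat \<Rightarrow> (nat \<Rightarrow> complex) \<Rightarrow> complex \<Rightarrow> complex" where
  "theta_up \<tau> k t y = (\<Prod>(i, j)\<in>pairs k. theta \<tau> (t j - t i + y))"

definition theta_dn :: "complex \<Rightarrow> nat \<Rightarrow> (nat \<Rightarrow> complex) \<Rightarrow> complex \<Rightarrow> complex" where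
  "theta_dn \<tau> k t y = (\<Prod>(i, j)\<in>pairs k. theta \<tau> (t i - t j + y))"

definition theta_sh :: "complex \<Rightarrow> nat \<Rightarrow> (nat \<Rightarrow> complex) \<Rightarrow> complex \<Rightarrow> complex" where
  "theta_sh \<tau> k t y = (\<Prod>(i, j)\<in>pairs k. theta \<tau> (t j - t i + y) * theta \<tau> (t i - t j + y))"

text \<open>The common numerator of the summands of the weight function over the denominator
  \<open>theta_vdm * theta_sh\<close>, which is alternating in \<open>t\<close>.\<close>

definition alt_num :: "complex \<Rightarrow> 'n::{finite,linorder} set \<Rightarrow> (nat \<Rightarrow> complex) \<Rightarrow>
    ('n \<Rightarrow> complex) \<Rightarrow> complex \<Rightarrow> complex \<Rightarrow> complex" where
  "alt_num \<tau> I t z y lam = (\<Sum>\<sigma> | \<sigma> permutes {..<card I}.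
     perm_sgn (card I) \<sigma> * (weight_num \<tau> I (t \<circ> \<sigma>) z y lam * theta_dn \<tau> (card I) (t \<circ> \<sigma>) y))"

lemma w_summand_eq:
  "w_summand \<tau> I t z y lam = weight_num \<tau> I t z y lam / (theta_vdm \<tau> (card I) t * theta_up \<tau> (card I) t y)"
  by (simp add: w_summand_def weight_num_def theta_vdm_def theta_up_def prod_pairs_nested prod.distrib case_prod_beta)

lemma theta_sh_eq: "theta_sh \<tau> k t y = theta_up \<tau> k t y * theta_dn \<tau> k t y"
  by (simp add: theta_sh_def theta_up_def theta_dn_def prod.distrib case_prod_beta)

lemma theta_vdm_permute:
  assumes "\<sigma> permutes {..<k}"
  shows "theta_vdm \<tau> k (t \<circ> \<sigma>) = perm_sgn k \<sigma> * theta_vdm \<tau> k t"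
  unfolding theta_vdm_def o_def
proof (rule prod_pairs_antisym[OF assms])
  show "theta \<tau> (t j - t i) = - theta \<tau> (t i - t j)" for i j
    unfolding theta_minus[symmetric] by simp
qed

lemma theta_sh_permute:
  assumes "\<sigma> permutes {..<k}"
  shows "theta_sh \<tau> k (t \<circ> \<sigma>) y = theta_sh \<tau> k t y"
  unfolding theta_sh_def o_def by (rule prod_pairs_permute[OF assms]) (rule mult.commute)

lemma pairs_cong_prod:
  assumes "\<And>r. r < k \<Longrightarrow> t r = t' r"
  shows "theta_vdm \<tau> k t = theta_vdm \<tau> k t'" "theta_up \<tau> k t y = theta_up \<tau> k t' y" "theta_dn \<tau> k t y = theta_dn \<tau> k t' y" "theta_sh \<tau> k t y = theta_sh \<tau> k t' y"
  unfolding theta_vdm_def theta_up_def theta_dn_def theta_sh_def using assms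
  by (auto simp: pairs_def intro!: prod.cong)

lemma weight_num_cong: "(\<And>r. r < card I \<Longrightarrow> t r = t' r) \<Longrightarrow> weight_num \<tau> I t z y lam = weight_num \<tau> I t' z y lam"
  unfolding weight_num_def by (intro prod.cong) auto

lemma alt_num_cong:
  assumes "\<And>r. r < card I \<Longrightarrow> t r = t' r"
  shows "alt_num \<tau> I t z y lam = alt_num \<tau> I t' z y lam"
  unfolding alt_num_def
proof (rule sum.cong[OF refl])
  fix \<sigma> assume "\<sigma> \<in> {\<sigma>. \<sigma> permutes {..<card I}}"
  then have "(t \<circ> \<sigma>) r = (t' \<circ> \<sigma>) r" if "r < card I" for r
    using that assms permutes_in_image[of \<sigma> "{..<card I}" r] by simp
  then show "perm_sgn (card I) \<sigma> * (weight_num \<tau> I (t \<circ> \<sigma>) z y lam * theta_dn \<tau> (card I) (t \<circ> \<sigma>) y) =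
      perm_sgn (card I) \<sigma> * (weight_num \<tau> I (t' \<circ> \<sigma>) z y lam * theta_dn \<tau> (card I) (t' \<circ> \<sigma>) y)"
    using weight_num_cong[of I "t \<circ> \<sigma>" "t' \<circ> \<sigma>"] pairs_cong_prod(3)[of "card I" "t \<circ> \<sigma>" "t' \<circ> \<sigma>"] by presburger
qed

lemma alt_num_permute:
  assumes \<rho>: "\<rho> permutes {..<card I}"
  shows "alt_num \<tau> I (t \<circ> \<rho>) z y lam = perm_sgn (card I) \<rho> * alt_num \<tau> I t z y lam"
proof -
  define F where "F = (\<lambda>\<sigma>. weight_num \<tau> I (t \<circ> \<sigma>) z y lam * theta_dn \<tau> (card I) (t \<circ> \<sigma>) y)"
  define e where "e = perm_sgn (card I)"
  have "alt_num \<tau> I t z y lam = (\<Sum>\<sigma> | \<sigma> permutes {..<card I}. e \<sigma> * F \<sigma>)" by (simp add: alt_num_def F_def e_def)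
  also have "\<dots> = (\<Sum>\<sigma> | \<sigma> permutes {..<card I}. e (\<rho> \<circ> \<sigma>) * F (\<rho> \<circ> \<sigma>))"
    by (rule setum_permutations_compose_left[OF \<rho>])
  also have "\<dots> = (\<Sum>\<sigma> | \<sigma> permutes {..<card I}. e \<rho> * (e \<sigma> * F (\<rho> \<circ> \<sigma>)))"
    by (rule sum.cong) (simp_all add: e_def perm_sgn_comp[OF \<rho>])
  also have "\<dots> = e \<rho> * alt_num \<tau> I (t \<circ> \<rho>) z y lam"
    by (simp add: alt_num_def F_def e_def sum_distrib_left o_assoc)
  finally have "e \<rho> * alt_num \<tau> I t z y lam = (e \<rho> * e \<rho>) * alt_num \<tau> I (t \<circ> \<rho>) z y lam" by simp
  then show ?thesis by (simp add: e_def perm_sgn_square)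
qed

text \<open>The transposition of the two equal variables fixes t but changes the sign.\<close>

lemma alt_num_eq_0:
  assumes "a < b" "b < card I" "t a = t b"
  shows "alt_num \<tau> I t z y lam = 0"
proof -
  have "Transposition.transpose a b permutes {..<card I}" using assms by (intro permutes_swap_id) auto
  moreover have "t \<circ> Transposition.transpose a b = t"
    using assms(3) by (auto simp: Transposition.transpose_def)
  ultimately show ?thesis
    using alt_num_permute[of "Transposition.transpose a b" I \<tau> t z y lam] perm_sgn_transpose[OF assms(1,2)] by simp
qed

text \<open>Permuting t changes \<open>theta_vdm\<close> by a sign, which is its own inverse, and
  splits the symmetric \<open>theta_sh\<close> into the permuted \<open>theta_up\<close> and
  \<open>theta_dn\<close>; this brings all summands over one denominator.\<close>

lemma sum_w_summand:
  assumes nz: "theta_vdm \<tau> (card I) t \<noteq> 0" "theta_sh \<tau> (card I) t y \<noteq> 0"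
  shows "(\<Sum>\<sigma> | \<sigma> permutes {..<card I}. w_summand \<tau> I (t \<circ> \<sigma>) z y lam) =
    alt_num \<tau> I t z y lam / (theta_vdm \<tau> (card I) t * theta_sh \<tau> (card I) t y)"
  unfolding alt_num_def sum_divide_distrib
proof (rule sum.cong[OF refl])
  fix \<sigma> assume "\<sigma> \<in> {\<sigma>. \<sigma> permutes {..<card I}}"
  then have \<sigma>: "\<sigma> permutes {..<card I}" by simp
  define e where "e = perm_sgn (card I) \<sigma>"
  have e: "e * e = 1" "e \<noteq> 0" by (simp_all add: e_def perm_sgn_square perm_sgn_nonzero)
  have P: "theta_sh \<tau> (card I) t y = theta_up \<tau> (card I) (t \<circ> \<sigma>) y * theta_dn \<tau> (card I) (t \<circ> \<sigma>) y"
    using theta_sh_permute[OF \<sigma>] theta_sh_eq by metis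
  have D: "theta_vdm \<tau> (card I) (t \<circ> \<sigma>) = e * theta_vdm \<tau> (card I) t" by (simp add: e_def theta_vdm_permute[OF \<sigma>])
  have i: "1 / e = e" using e by (simp add: divide_eq_eq)
  have "w_summand \<tau> I (t \<circ> \<sigma>) z y lam =
    1 / e * (weight_num \<tau> I (t \<circ> \<sigma>) z y lam / (theta_vdm \<tau> (card I) t * theta_up \<tau> (card I) (t \<circ> \<sigma>) y))"
    by (simp add: w_summand_eq D)
  also have "\<dots> = e * (weight_num \<tau> I (t \<circ> \<sigma>) z y lam * theta_dn \<tau> (card I) (t \<circ> \<sigma>) y) / (theta_vdm \<tau> (card I) t * theta_sh \<tau> (card I) t y)"
    unfolding i using nz by (simp add: P field_simps)
  finally show "w_summand \<tau> I (t \<circ> \<sigma>) z y lam = perm_sgn (card I) \<sigma> *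
    (weight_num \<tau> I (t \<circ> \<sigma>) z y lam * theta_dn \<tau> (card I) (t \<circ> \<sigma>) y) / (theta_vdm \<tau> (card I) t * theta_sh \<tau> (card I) t y)"
    by (simp add: e_def)
qed

text \<open>The part of the form that survives on the base in z, y, \<lambda>. Its term - y^2 for
  each pair is the balance of + y^2 from \<open>theta_dn\<close> and - 2 y^2 from dividing by
  \<open>theta_sh\<close>.\<close>

definition quad_rest :: "'n::{finite,linorder} set \<Rightarrow> ('n \<Rightarrow> complex) \<Rightarrow> complex \<Rightarrow> complex \<Rightarrow> complex" where
  "quad_rest I z y lam = (\<Sum>r<card I. (\<Sum>a | a < nth_elem I r. (z a - y)\<^sup>2 - (z a)\<^sup>2) +
       (lam - z (nth_elem I r) - of_int (w_wt (nth_elem I r) I) * y)\<^sup>2 - (z (nth_elem I r))\<^sup>2) -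
     (\<Sum>p\<in>pairs (card I). y\<^sup>2)"

definition quad_num :: "'n::{finite,linorder} set \<Rightarrow> (nat \<Rightarrow> complex) \<Rightarrow> ('n \<Rightarrow> complex) \<Rightarrow> complex \<Rightarrow> complex \<Rightarrow> complex" where
  "quad_num I t z y lam = (\<Sum>r<card I. \<Sum>a\<in>UNIV. (t r - z a)\<^sup>2) + (\<Sum>(i, j)\<in>pairs (card I). (t i - t j)\<^sup>2) +
     2 * (\<Sum>r<card I. t r) * (lam + of_int (int CARD('n) - int (card I)) * y) +
     quad_rest I z y lam + 2 * (\<Sum>p\<in>pairs (card I). y\<^sup>2)"

text \<open>The coefficient of 2 t_r y is the position of i_r minus w(i_r, I), plus k - 1 - 2r from
  \<open>theta_dn\<close>; this is n - k for every r. Hence the form is symmetric in t and common to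
  all summands.\<close>

lemma summand_form:
  fixes I :: "'n::{finite,linorder} set"
  shows "(\<Sum>r<card I. (\<Sum>a | a < nth_elem I r. (t r - z a + y)\<^sup>2) +
      (lam + t r - z (nth_elem I r) - of_int (w_wt (nth_elem I r) I) * y)\<^sup>2 +
      (\<Sum>a | a > nth_elem I r. (t r - z a)\<^sup>2)) + (\<Sum>(i, j)\<in>pairs (card I). (t i - t j + y)\<^sup>2) = quad_num I t z y lam"
proof -
  define k where "k = card I"
  define S where "S = (\<lambda>r. (\<Sum>a | a < nth_elem I r. (z a - y)\<^sup>2 - (z a)\<^sup>2) +
       (lam - z (nth_elem I r) - of_int (w_wt (nth_elem I r) I) * y)\<^sup>2 - (z (nth_elem I r))\<^sup>2)"
  have 1: "(\<Sum>a | a < nth_elem I r. (t r - z a + y)\<^sup>2) +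
      (lam + t r - z (nth_elem I r) - of_int (w_wt (nth_elem I r) I) * y)\<^sup>2 +
      (\<Sum>a | a > nth_elem I r. (t r - z a)\<^sup>2) =
      (\<Sum>a\<in>UNIV. (t r - z a)\<^sup>2) + S r + 2 * t r * (lam + of_int (int CARD('n) - int k) * y)
        - 2 * y * ((of_nat k - 1 - 2 * of_nat r) * t r)"
    if r: "r < k" for r
  proof -
    define i where "i = nth_elem I r"
    have U: "(UNIV :: 'n set) = {a. a < i} \<union> ({i} \<union> {a. a > i})" by auto
    have "(\<Sum>a\<in>UNIV. (t r - z a)\<^sup>2) = (\<Sum>a | a < i. (t r - z a)\<^sup>2) + ((t r - z i)\<^sup>2 + (\<Sum>a | a > i. (t r - z a)\<^sup>2))"
      unfolding U by (subst sum.union_disjoint; auto)+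
    moreover have "(\<Sum>a | a < i. (t r - z a + y)\<^sup>2) =
      (\<Sum>a | a < i. (t r - z a)\<^sup>2) + of_nat (posn i) * (2 * t r * y) + (\<Sum>a | a < i. (z a - y)\<^sup>2 - (z a)\<^sup>2)"
    proof -
      have "(t r - z a + y)\<^sup>2 = (t r - z a)\<^sup>2 + (2 * t r * y) + ((z a - y)\<^sup>2 - (z a)\<^sup>2)" for a
        by (simp add: power2_eq_square algebra_simps)
      then show ?thesis by (simp add: sum.distrib posn_def)
    qed
    moreover have w: "of_int (w_wt i I) = 2 * (of_nat k - 1 - of_nat r) - of_nat CARD('n) + 1 + (of_nat (posn i) :: complex)"
      using w_wt_nth_elem[of r I] r by (simp add: i_def k_def)
    ultimately show ?thesis
      unfolding S_def i_def[symmetric] w by (simp add: power2_eq_square algebra_simps)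
  qed
  have 2: "(\<Sum>(i, j)\<in>pairs k. (t i - t j + y)\<^sup>2) =
    (\<Sum>(i, j)\<in>pairs k. (t i - t j)\<^sup>2) + 2 * y * (\<Sum>r<k. (of_nat k - 1 - 2 * of_nat r) * t r) + (\<Sum>p\<in>pairs k. y\<^sup>2)"
    unfolding sum_pairs_diff[symmetric] sum_distrib_left sum.distrib[symmetric]
    by (intro sum.cong) (auto simp: power2_eq_square algebra_simps)
  have 3: "(\<Sum>r<card I. (\<Sum>a | a < nth_elem I r. (t r - z a + y)\<^sup>2) +
      (lam + t r - z (nth_elem I r) - of_int (w_wt (nth_elem I r) I) * y)\<^sup>2 +
      (\<Sum>a | a > nth_elem I r. (t r - z a)\<^sup>2)) =
    (\<Sum>r<k. \<Sum>a\<in>UNIV. (t r - z a)\<^sup>2) + (\<Sum>r<k. S r) + 2 * (\<Sum>r<k. t r) * (lam + of_int (int CARD('n) - int k) * y)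
      - 2 * y * (\<Sum>r<k. (of_nat k - 1 - 2 * of_nat r) * t r)"
    unfolding k_def[symmetric]
    by (subst sum.cong[OF refl 1]) (auto simp: sum.distrib sum_subtractf sum_distrib_left sum_distrib_right mult.assoc)
  show ?thesis
    unfolding 3 unfolding 2[unfolded k_def] quad_num_def quad_rest_def
    unfolding S_def[symmetric] k_def[symmetric] by (simp add: algebra_simps)
qed

lemma quad_num_permute:
  assumes \<sigma>: "\<sigma> permutes {..<card I}"
  shows "quad_num I (t \<circ> \<sigma>) z y lam = quad_num I t z y lam"
proof -
  have "(\<Sum>r<card I. h ((t \<circ> \<sigma>) r)) = (\<Sum>r<card I. h (t r))" for h :: "complex \<Rightarrow> complex"
    using sum.permute[OF \<sigma>, of "h \<circ> t"] by (simp add: o_def)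
  from this[of "\<lambda>w. \<Sum>a\<in>UNIV. (w - z a)\<^sup>2"] this[of "\<lambda>w. w"]
  have "(\<Sum>r<card I. \<Sum>a\<in>UNIV. ((t \<circ> \<sigma>) r - z a)\<^sup>2) = (\<Sum>r<card I. \<Sum>a\<in>UNIV. (t r - z a)\<^sup>2)"
    "(\<Sum>r<card I. (t \<circ> \<sigma>) r) = (\<Sum>r<card I. t r)" by simp_all
  moreover have "(\<Sum>(i, j)\<in>pairs (card I). ((t \<circ> \<sigma>) i - (t \<circ> \<sigma>) j)\<^sup>2) = (\<Sum>(i, j)\<in>pairs (card I). (t i - t j)\<^sup>2)"
    using sum_pairs_permute[OF \<sigma>, of "\<lambda>i j. (t i - t j)\<^sup>2"] by (simp add: power2_commute)
  ultimately show ?thesis by (simp only: quad_num_def)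
qed

section \<open>The numerator in independent variables (t, s) and (z, y, \<lambda>)\<close>

definition join :: "'a^'c::finite \<Rightarrow> 'a^'d::finite \<Rightarrow> 'a^('c + 'd)" where
  "join u x = (\<chi> c. case c of Inl c \<Rightarrow> u $ c | Inr c \<Rightarrow> x $ c)"

lemma join_nth [simp]: "join u x $ Inl c = u $ c" "join u x $ Inr d = x $ d"
  by (simp_all add: join_def)

lemma vec_eq_sumI: "(\<And>c. X $ Inl c = Y $ Inl c) \<Longrightarrow> (\<And>d. X $ Inr d = Y $ Inr d) \<Longrightarrow> X = Y"
  by (simp add: vec_eq_iff) (metis sum.exhaust)

lemma join_add: "join u x + join v y = join (u + v) (x + y)"
  by (rule vec_eq_sumI) simp_all

lemma join_cvec: "join (cvec m) (cvec m') = cvec (join m m')"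
  by (rule vec_eq_sumI) simp_all

lemma join_latvec: "join (latvec \<tau> m l) (latvec \<tau> m' l') = latvec \<tau> (join m m') (join l l')"
  by (rule vec_eq_sumI) simp_all

text \<open>The independent variables \<open>(t, s)\<close> are the \<open>Pt\<close>-coordinates of the first summand, while
  \<open>(z, y, \<lambda>)\<close> form the second; the coordinates \<open>Inl Yc\<close> and \<open>Inl Lc\<close> are dummies.\<close>

definition t_part :: "complex^('n::{finite,linorder} coord + 'n coord) \<Rightarrow> nat \<Rightarrow> complex" where
  "t_part X r = X $ Inl (Pt (nth_elem UNIV r))"

definition z_part :: "complex^('n::{finite,linorder} coord + 'n coord) \<Rightarrow> 'n \<Rightarrow> complex" where
  "z_part X a = X $ Inr (Pt a)"

definition alt_num_vec :: "complex \<Rightarrow> 'n::{finite,linorder} set \<Rightarrow> complex^('n coord + 'n coord) \<Rightarrow> complex" where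
  "alt_num_vec \<tau> I X = alt_num \<tau> I (t_part X) (z_part X) (X $ Inr Yc) (X $ Inr Lc)"

definition quad_num_vec :: "'n::{finite,linorder} set \<Rightarrow> complex^('n coord + 'n coord) \<Rightarrow> complex" where
  "quad_num_vec I X = quad_num I (t_part X) (z_part X) (X $ Inr Yc) (X $ Inr Lc)"

text \<open>By \<open>summand_form\<close> and \<open>quad_num_permute\<close> all permuted summands
  are sections for one and the same form, so they may be added.\<close>

lemma quasi_per_alt_num_vec:
  assumes \<tau>: "Im \<tau> > 0"
  shows "quasi_per \<tau> (quad_num_vec I) (alt_num_vec \<tau> I)"
  unfolding quad_num_vec_def[abs_def] alt_num_vec_def[abs_def] alt_num_def
proof (intro quasi_per_sum quasi_per_cmult)
  fix \<sigma> assume "\<sigma> \<in> {\<sigma>. \<sigma> permutes {..<card I}}"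
  then have \<sigma>: "\<sigma> permutes {..<card I}" by simp
  have "quasi_per \<tau> (\<lambda>X. (\<Sum>r<card I. (\<Sum>a | a < nth_elem I r. ((t_part X \<circ> \<sigma>) r - z_part X a + X $ Inr Yc)\<^sup>2) +
      (X $ Inr Lc + (t_part X \<circ> \<sigma>) r - z_part X (nth_elem I r) - of_int (w_wt (nth_elem I r) I) * X $ Inr Yc)\<^sup>2 +
      (\<Sum>a | a > nth_elem I r. ((t_part X \<circ> \<sigma>) r - z_part X a)\<^sup>2)) +
      (\<Sum>p\<in>pairs (card I). ((t_part X \<circ> \<sigma>) (fst p) - (t_part X \<circ> \<sigma>) (snd p) + X $ Inr Yc)\<^sup>2))
    (\<lambda>X. weight_num \<tau> I (t_part X \<circ> \<sigma>) (z_part X) (X $ Inr Yc) (X $ Inr Lc) * theta_dn \<tau> (card I) (t_part X \<circ> \<sigma>) (X $ Inr Yc))"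
    unfolding weight_num_def theta_dn_def case_prod_beta t_part_def z_part_def o_def
    by (intro quasi_per_mult quasi_per_prod quasi_per_theta[OF \<tau>] int_lin_intros)
  then show "quasi_per \<tau> (\<lambda>X. quad_num I (t_part X) (z_part X) (X $ Inr Yc) (X $ Inr Lc))
    (\<lambda>X. weight_num \<tau> I (t_part X \<circ> \<sigma>) (z_part X) (X $ Inr Yc) (X $ Inr Lc) * theta_dn \<tau> (card I) (t_part X \<circ> \<sigma>) (X $ Inr Yc))"
    unfolding summand_form[unfolded case_prod_beta] quad_num_permute[OF \<sigma>] .
qed

lemma entire_alt_num_vec: "Im \<tau> > 0 \<Longrightarrow> entire (alt_num_vec \<tau> I)"
  unfolding alt_num_vec_def[abs_def] alt_num_def weight_num_def theta_dn_def case_prod_beta t_part_def z_part_def o_def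
  by (intro entire_intros entire_theta) auto

lemma inj_on_nth_elem_UNIV: "k \<le> CARD('n) \<Longrightarrow> inj_on (nth_elem (UNIV :: 'n::{finite,linorder} set)) {..<k}"
  by (rule inj_on_subset[OF inj_on_nth_elem]) auto

text \<open>Translating t_j alone by a lattice vector makes it equal to t_i, and the factor picked
  up is nonzero.\<close>

lemma alt_num_vec_eq_0:
  fixes X :: "complex^('n::{finite,linorder} coord + 'n coord)"
  assumes \<tau>: "Im \<tau> > 0" and ij: "i < j" "j < card I" and lat: "t_part X i - t_part X j \<in> lattice \<tau>"
  shows "alt_num_vec \<tau> I X = 0"
proof -
  obtain m l :: int where ml: "t_part X i - t_part X j = of_int m + of_int l * \<tau>"
    using lat by (auto simp: lattice_def)
  have kn: "card I \<le> CARD('n)" by (rule card_mono) auto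
  define c :: "'n coord + 'n coord" where "c = Inl (Pt (nth_elem UNIV j))"
  have ne: "Inl (Pt (nth_elem UNIV i)) \<noteq> c"
    using inj_onD[OF inj_on_nth_elem_UNIV[OF kn], of i j] ij by (auto simp: c_def)
  define M :: "int^('n coord + 'n coord)" where "M = axis c m"
  define L :: "int^('n coord + 'n coord)" where "L = axis c l"
  have "t_part (X + latvec \<tau> M L) j = t_part X j + (of_int m + of_int l * \<tau>)"
    by (simp add: t_part_def M_def L_def c_def)
  moreover have "t_part (X + latvec \<tau> M L) i = t_part X i"
    using ne by (simp add: t_part_def M_def L_def axis_def)
  ultimately have "alt_num_vec \<tau> I (X + latvec \<tau> M L) = 0"
    unfolding alt_num_vec_def using ml ij by (intro alt_num_eq_0[of i j]) (auto simp: algebra_simps)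
  then show ?thesis using quasi_per_alt_num_vec[OF \<tau>, of I] by (auto simp: quasi_per_def)
qed

section \<open>Restriction and gluing factors\<close>

definition z_restr :: "'n::{finite,linorder} set \<Rightarrow> complex^'n coord \<Rightarrow> nat \<Rightarrow> complex" where
  "z_restr K x r = x $ Pt (nth_elem K r)"

text \<open>After the specialisation \<open>t = z\<^sub>K\<close> a summand vanishes unless the \<open>r\<close>-th variable is some
  \<open>z\<^sub>b\<close> with \<open>b \<le> i\<^sub>r\<close>; in that case all factors \<open>\<theta>(t\<^sub>j - t\<^sub>i + y)\<close> with \<open>i < j\<close> of the denominator
  occur in the numerator.\<close>

lemma weight_num_restrict:
  fixes I K :: "'n::{finite,linorder} set"
  assumes \<tau>: "Im \<tau> > 0" and K: "card K = card I" and \<sigma>: "\<sigma> permutes {..<card I}"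
  shows "\<exists>H. entire H \<and> (\<forall>x. weight_num \<tau> I (z_restr K x \<circ> \<sigma>) (\<lambda>a. x $ Pt a) (x $ Yc) (x $ Lc) =
    theta_up \<tau> (card I) (z_restr K x \<circ> \<sigma>) (x $ Yc) * H x)"
proof -
  define b where "b = (\<lambda>r. nth_elem K (\<sigma> r))"
  have \<sigma>k: "\<sigma> r < card I \<longleftrightarrow> r < card I" for r using permutes_in_image[OF \<sigma>, of r] by simp
  have t: "(z_restr K x \<circ> \<sigma>) r = x $ Pt (b r)" for x r by (simp add: z_restr_def b_def)
  show ?thesis
  proof (cases "\<forall>r<card I. b r \<le> nth_elem I r")
    case False
    then obtain r where r: "r < card I" "nth_elem I r < b r" by (auto simp: not_le)
    have *: "(\<Prod>a | a > nth_elem I r. theta \<tau> (x $ Pt (b r) - x $ Pt a)) = 0" for x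
      using r(2) by (intro prod_zero) (auto intro!: bexI[of _ "b r"])
    have "weight_num \<tau> I (z_restr K x \<circ> \<sigma>) (\<lambda>a. x $ Pt a) (x $ Yc) (x $ Lc) = 0" for x
      unfolding weight_num_def t using r(1) by (intro prod_zero bexI[of _ r]) (simp_all add: * del: prod_zero_iff)
    then show ?thesis by (intro exI[of _ "\<lambda>_. 0"]) (simp add: entire_const)
  next
    case True
    \<comment> \<open>The indices below i_j that no earlier variable has used: since b_i \<le> i_i <
      i_j for i < j, the factors at b_0, ..., b_{j-1} are the ones that cancel the
      denominator.\<close>
    define c where "c = (\<lambda>j. {a. a < nth_elem I j} - b ` {..<j})"
    have sub: "b ` {..<j} \<subseteq> {a. a < nth_elem I j}" if "j < card I" for j
    proof
      fix d assume "d \<in> b ` {..<j}"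
      then obtain i where i: "i < j" "d = b i" by auto
      have "b i \<le> nth_elem I i" using True i that by simp
      also have "\<dots> < nth_elem I j" by (rule nth_elem_mono) (use i that in auto)
      finally show "d \<in> {a. a < nth_elem I j}" by (simp add: i)
    qed
    have inj: "inj_on b {..<j}" if "j < card I" for j
    proof (rule inj_onI)
      fix u v assume uv: "u \<in> {..<j}" "v \<in> {..<j}" "b u = b v"
      then have "\<sigma> u = \<sigma> v"
        using inj_onD[OF inj_on_nth_elem, of K "\<sigma> u" "\<sigma> v"] that \<sigma>k[of u] \<sigma>k[of v] K by (auto simp: b_def)
      then show "u = v" using permutes_inj[OF \<sigma>] by (auto dest: injD)
    qed
    define H where "H = (\<lambda>x::complex^'n coord. \<Prod>r<card I. (\<Prod>a\<in>c r. theta \<tau> (x $ Pt (b r) - x $ Pt a + x $ Yc)) *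
      theta \<tau> (x $ Lc + x $ Pt (b r) - x $ Pt (nth_elem I r) - of_int (w_wt (nth_elem I r) I) * x $ Yc) *
      (\<Prod>a | a > nth_elem I r. theta \<tau> (x $ Pt (b r) - x $ Pt a)))"
    have "entire H" unfolding H_def by (intro entire_intros entire_theta \<tau>)
    moreover have "weight_num \<tau> I (z_restr K x \<circ> \<sigma>) (\<lambda>a. x $ Pt a) (x $ Yc) (x $ Lc) =
      theta_up \<tau> (card I) (z_restr K x \<circ> \<sigma>) (x $ Yc) * H x" for x
    proof -
      have "(\<Prod>a | a < nth_elem I j. theta \<tau> (x $ Pt (b j) - x $ Pt a + x $ Yc)) =
        (\<Prod>i<j. theta \<tau> (x $ Pt (b j) - x $ Pt (b i) + x $ Yc)) *
        (\<Prod>a\<in>c j. theta \<tau> (x $ Pt (b j) - x $ Pt a + x $ Yc))" if "j < card I" for j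
        using prod.subset_diff[OF sub[OF that], of "\<lambda>a. theta \<tau> (x $ Pt (b j) - x $ Pt a + x $ Yc)"]
        by (simp add: c_def prod.reindex[OF inj[OF that]] mult.commute)
      then have "weight_num \<tau> I (z_restr K x \<circ> \<sigma>) (\<lambda>a. x $ Pt a) (x $ Yc) (x $ Lc) =
        (\<Prod>j<card I. (\<Prod>i<j. theta \<tau> (x $ Pt (b j) - x $ Pt (b i) + x $ Yc)) *
          ((\<Prod>a\<in>c j. theta \<tau> (x $ Pt (b j) - x $ Pt a + x $ Yc)) *
      theta \<tau> (x $ Lc + x $ Pt (b j) - x $ Pt (nth_elem I j) - of_int (w_wt (nth_elem I j) I) * x $ Yc) *
      (\<Prod>a | a > nth_elem I j. theta \<tau> (x $ Pt (b j) - x $ Pt a))))"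
        unfolding weight_num_def t by (intro prod.cong) (simp_all add: mult.assoc)
      then show ?thesis
        unfolding prod.distrib[of _ _ "{..<card I}"] by (simp add: H_def prod.distrib theta_up_def z_restr_def b_def flip: prod_pairs_nested)
    qed
    ultimately show ?thesis by blast
  qed
qed

definition quad_vdm :: "nat \<Rightarrow> (nat \<Rightarrow> complex) \<Rightarrow> complex" where
  "quad_vdm k t = (\<Sum>(i, j)\<in>pairs k. (t i - t j)\<^sup>2)"

definition quad_sh :: "nat \<Rightarrow> (nat \<Rightarrow> complex) \<Rightarrow> complex \<Rightarrow> complex" where
  "quad_sh k t y = (\<Sum>(i, j)\<in>pairs k. (t j - t i + y)\<^sup>2 + (t i - t j + y)\<^sup>2)"

lemma sum_t_part:
  assumes "k \<le> CARD('n::{finite,linorder})"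
  shows "(\<Sum>r<k. g (t_part (join u x) r)) = (\<Sum>i | posn (i::'n) < k. g (u $ Pt i))"
  by (rule sum.reindex_bij_witness[of _ posn "nth_elem UNIV"])
    (use assms in \<open>auto simp: t_part_def posn_nth_elem_UNIV nth_elem_UNIV_posn\<close>)

text \<open>The two correction terms vanish when \<open>u\<close> is a rearrangement of \<open>x\<close>. Their factors of
  automorphy are nevertheless needed to compare two such rearrangements.\<close>

lemma form_join:
  fixes I :: "'n::{finite,linorder} set" and u x :: "complex^'n coord"
  assumes k: "card I = k"
  shows "quad_num I (t_part (join u x)) (z_part (join u x)) (x $ Yc) (x $ Lc) - quad_vdm k (t_part (join u x)) - quad_sh k (t_part (join u x)) (x $ Yc) =
    quad_form (N_kn k) u +
    2 * (\<Sum>i | posn i < k. u $ Pt i) * ((\<Sum>a\<in>UNIV. u $ Pt a) - (\<Sum>a\<in>UNIV. x $ Pt a) +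
       (x $ Lc - u $ Lc) + of_nat (CARD('n) - k) * (x $ Yc - u $ Yc)) +
    of_nat k * ((\<Sum>a\<in>UNIV. (x $ Pt a)\<^sup>2) - (\<Sum>a\<in>UNIV. (u $ Pt a)\<^sup>2)) +
    quad_rest I (\<lambda>a. x $ Pt a) (x $ Yc) (x $ Lc)"
proof -
  have kn: "k \<le> CARD('n)" unfolding k[symmetric] by (rule card_mono) auto
  define t where "t = t_part (join u x)"
  define A where "A = {i::'n. posn i < k}"
  define v where "v = (\<lambda>i. u $ Pt i)"
  define X where "X = (\<lambda>i. x $ Pt i)"
  have cA: "card A = k" unfolding A_def by (rule card_posn_less[OF kn])
  have st: "(\<Sum>r<k. g (t r)) = (\<Sum>i\<in>A. g (v i))" for g :: "complex \<Rightarrow> complex"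
    unfolding t_def A_def v_def by (rule sum_t_part[OF kn])
  have z_part: "z_part (join u x) = X" by (simp add: fun_eq_iff z_part_def X_def)
  have 1: "(\<Sum>r<k. \<Sum>a\<in>UNIV. (t r - X a)\<^sup>2) = (\<Sum>i\<in>A. \<Sum>a\<in>UNIV. (v i - X a)\<^sup>2)"
    by (rule st[of "\<lambda>w. \<Sum>a\<in>UNIV. (w - X a)\<^sup>2"])
  have 2: "2 * quad_vdm k t = (\<Sum>i\<in>A. \<Sum>j\<in>A. (v i - v j)\<^sup>2)"
  proof -
    have "2 * quad_vdm k t = (\<Sum>i<k. \<Sum>j<k. (t i - t j)\<^sup>2)" by (simp add: quad_vdm_def sum_square_diff_pairs)
    also have "\<dots> = (\<Sum>i<k. \<Sum>j\<in>A. (t i - v j)\<^sup>2)"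
      by (intro sum.cong refl) (rule st)
    also have "\<dots> = (\<Sum>i\<in>A. \<Sum>j\<in>A. (v i - v j)\<^sup>2)" by (rule st[of "\<lambda>w. \<Sum>j\<in>A. (w - v j)\<^sup>2"])
    finally show ?thesis .
  qed
  have 3: "(\<Sum>r<k. t r) = (\<Sum>i\<in>A. v i)" by (rule st)
  have 4: "quad_sh k t (x $ Yc) = 2 * quad_vdm k t + 2 * (\<Sum>p\<in>pairs k. (x $ Yc)\<^sup>2)"
    unfolding quad_sh_def quad_vdm_def sum_distrib_left sum.distrib[symmetric]
    by (intro sum.cong) (auto simp: power2_eq_square algebra_simps)
  have 5: "quad_form (N_kn k) u = 2 * (\<Sum>i\<in>A. v i * (u $ Lc + of_nat (CARD('n) - k) * u $ Yc)) +
     (\<Sum>i\<in>A. \<Sum>j\<in>- A. (v i - v j)\<^sup>2)"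
    unfolding quad_form_N_kn[OF kn] A_def v_def by (simp add: Compl_eq not_less)
  have 6: "(\<Sum>i\<in>A. \<Sum>j\<in>- A. (v i - v j)\<^sup>2) = (\<Sum>i\<in>A. \<Sum>j\<in>UNIV. (v i - v j)\<^sup>2) - (\<Sum>i\<in>A. \<Sum>j\<in>A. (v i - v j)\<^sup>2)"
    unfolding sum_subtractf[symmetric]
  proof (rule sum.cong[OF refl])
    fix i
    have "(\<Sum>j\<in>A \<union> - A. (v i - v j)\<^sup>2) = (\<Sum>j\<in>A. (v i - v j)\<^sup>2) + (\<Sum>j\<in>- A. (v i - v j)\<^sup>2)"
      by (rule sum.union_disjoint) auto
    then show "(\<Sum>j\<in>- A. (v i - v j)\<^sup>2) = (\<Sum>j\<in>UNIV. (v i - v j)\<^sup>2) - (\<Sum>j\<in>A. (v i - v j)\<^sup>2)" by simp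
  qed
  \<comment> \<open>Used once for the z and once for the coordinates of \<open>u\<close>; the
    difference yields the corrections in the sums and in the sums of squares.\<close>
  have 7: "(\<Sum>i\<in>A. \<Sum>a\<in>UNIV. (v i - g a)\<^sup>2) =
    of_nat CARD('n) * (\<Sum>i\<in>A. (v i)\<^sup>2) - 2 * (\<Sum>i\<in>A. v i) * (\<Sum>a\<in>UNIV. g a) + of_nat k * (\<Sum>a\<in>UNIV. (g a)\<^sup>2)"
    for g :: "'n \<Rightarrow> complex"
    by (simp add: power2_diff sum.distrib sum_subtractf cA sum_distrib_left sum_distrib_right mult_ac)
  have nk: "of_int (int CARD('n) - int k) = (of_nat (CARD('n) - k) :: complex)"
    using kn by (simp add: of_nat_diff)
  define c :: complex where "c = of_nat (CARD('n) - k)"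
  have "quad_num I t X (x $ Yc) (x $ Lc) - quad_vdm k t - quad_sh k t (x $ Yc) =
    (\<Sum>i\<in>A. \<Sum>a\<in>UNIV. (v i - X a)\<^sup>2) - (\<Sum>i\<in>A. \<Sum>j\<in>A. (v i - v j)\<^sup>2) +
    2 * (\<Sum>i\<in>A. v i) * (x $ Lc + c * x $ Yc) + quad_rest I X (x $ Yc) (x $ Lc)"
    unfolding quad_num_def k 1 3 4 nk c_def[symmetric] quad_vdm_def[symmetric] 2[symmetric] by (simp add: algebra_simps)
  also have "\<dots> = quad_form (N_kn k) u + ((\<Sum>i\<in>A. \<Sum>a\<in>UNIV. (v i - X a)\<^sup>2) - (\<Sum>i\<in>A. \<Sum>a\<in>UNIV. (v i - v a)\<^sup>2)) +
    2 * (\<Sum>i\<in>A. v i) * ((x $ Lc - u $ Lc) + c * (x $ Yc - u $ Yc)) + quad_rest I X (x $ Yc) (x $ Lc)"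
    unfolding 5 6 c_def[symmetric] sum_distrib_right[symmetric] by (simp add: algebra_simps)
  finally have fin: "quad_num I t X (x $ Yc) (x $ Lc) - quad_vdm k t - quad_sh k t (x $ Yc) = quad_form (N_kn k) u +
    2 * (\<Sum>i\<in>A. v i) * ((\<Sum>a\<in>UNIV. v a) - (\<Sum>a\<in>UNIV. X a) + (x $ Lc - u $ Lc) + c * (x $ Yc - u $ Yc)) +
    of_nat k * ((\<Sum>a\<in>UNIV. (X a)\<^sup>2) - (\<Sum>a\<in>UNIV. (v a)\<^sup>2)) + quad_rest I X (x $ Yc) (x $ Lc)"
    unfolding 7 by (simp add: algebra_simps)
  show ?thesis
    using fin unfolding z_part t_def[symmetric] unfolding X_def v_def A_def c_def .
qed

text \<open>The form of N / P in the independent variables.\<close>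

definition quad_weight :: "'n::{finite,linorder} set \<Rightarrow> complex^('n coord + 'n coord) \<Rightarrow> complex" where
  "quad_weight I X = quad_num_vec I X - quad_vdm (card I) (t_part X) - quad_sh (card I) (t_part X) (X $ Inr Yc)"

definition quad_rest_vec :: "'n::{finite,linorder} set \<Rightarrow> complex^'n coord \<Rightarrow> complex" where
  "quad_rest_vec I x = quad_rest I (\<lambda>a. x $ Pt a) (x $ Yc) (x $ Lc)"

text \<open>(z_K, z_K') is a rearrangement of z over the same y and \<lambda>, so the corrections in
  \<open>form_join\<close> vanish. Besides the twist only a form on the base remains, which is what
  admissibility asks for.\<close>

lemma quad_weight_join_chi_iota:
  "quad_weight I (join (chi_iota K x) x) = quad_form (N_kn (card I)) (chi_iota K x) + quad_rest_vec I x"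
  unfolding quad_weight_def quad_num_vec_def join_nth form_join[OF refl]
  using sum_chi_iota[of "\<lambda>w. w" K x] sum_chi_iota[of "\<lambda>w. w\<^sup>2" K x] by (simp add: quad_rest_vec_def)

lemma int_quad_quad_rest_vec: "int_quad (quad_rest_vec I)"
  unfolding quad_rest_vec_def[abs_def] quad_rest_def by (intro int_quad_intros int_lin_intros)

lemma even_sum_square:
  assumes "(\<Sum>c\<in>UNIV. p c) = (0::int)"
  shows "\<exists>N. (\<Sum>c\<in>UNIV. (p c)\<^sup>2) = 2 * N"
proof -
  have "(\<Sum>c\<in>UNIV. (p c)\<^sup>2) = (\<Sum>c\<in>UNIV. p c * (p c - 1)) + (\<Sum>c\<in>UNIV. p c)"
    unfolding sum.distrib[symmetric] by (rule sum.cong) (auto simp: power2_eq_square algebra_simps)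
  moreover have "even (\<Sum>c\<in>UNIV. p c * (p c - 1))" by (intro dvd_sum) auto
  ultimately show ?thesis using assms by (metis add.right_neutral evenE)
qed

text \<open>The translation moves (t, s) only, and both its ends are rearrangements of z. The factor
  of \<open>quad_weight\<close> differs from that of the twist by the exponential of the
  corrections: one part is an even integer by \<open>rearranged_translate_even\<close>, the other by
  \<open>even_sum_square\<close>, so the exponent is an integral multiple of 2 pi i.\<close>

lemma glue_factor:
  fixes I0 I J :: "'n::{finite,linorder} set" and x :: "complex^'n coord"
  assumes \<tau>: "Im \<tau> > 0" and k: "card I0 = k" and gl: "glued \<tau> k I J \<sigma> m l x"
  shows "quad_fac \<tau> (quad_weight I0) (join m 0) (join l 0) (join (perm_coord \<sigma> (chi_iota I x)) x) =
    twist \<tau> k m l (perm_coord \<sigma> (chi_iota I x))"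
proof -
  define v where "v = perm_coord \<sigma> (chi_iota I x)"
  have gl': "chi_iota J x = v + latvec \<tau> m l" and \<sigma>: "bij \<sigma>"
    using gl by (auto simp: glued_def v_def block_perms_def)
  have sv: "(\<Sum>c\<in>UNIV. h (v $ Pt c)) = (\<Sum>a\<in>UNIV. h (x $ Pt a))" for h :: "complex \<Rightarrow> complex"
  proof -
    have "(\<Sum>c\<in>UNIV. h (v $ Pt c)) = (\<Sum>c\<in>UNIV. h (chi_iota I x $ Pt c))"
      using sum.reindex_bij_betw[OF \<sigma>, of "\<lambda>c. h (chi_iota I x $ Pt c)"] by (simp add: v_def)
    then show ?thesis by (simp only: sum_chi_iota)
  qed
  have v': "chi_iota J x $ Pt c = v $ Pt c + (of_int (m $ Pt c) + of_int (l $ Pt c) * \<tau>)" for c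
    unfolding gl' by simp
  have "\<exists>N :: int. (\<Sum>c\<in>UNIV. 2 * of_int (l $ Pt c) * v $ Pt c + \<tau> * (of_int (l $ Pt c))\<^sup>2) = 2 * of_int N"
  proof (rule rearranged_translate_even[OF \<tau>, of "\<lambda>c. chi_iota J x $ Pt c" "\<lambda>c. v $ Pt c" "\<lambda>c. m $ Pt c"])
    fix h :: "complex \<Rightarrow> complex"
    show "(\<Sum>c\<in>UNIV. h (chi_iota J x $ Pt c)) = (\<Sum>c\<in>UNIV. h (v $ Pt c))"
      unfolding sv by (rule sum_chi_iota)
  qed (rule v')
  then obtain N1 :: int where N1: "(\<Sum>c\<in>UNIV. 2 * of_int (l $ Pt c) * v $ Pt c) + \<tau> * (\<Sum>c\<in>UNIV. (of_int (l $ Pt c))\<^sup>2) = 2 * of_int N1"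
    by (auto simp: sum.distrib sum_distrib_left)
  \<comment> \<open>Equal coordinate sums force the total translation to vanish, hence both integer
    totals, because \<tau> is not real.\<close>
  have "(\<Sum>c\<in>UNIV. chi_iota J x $ Pt c) = (\<Sum>c\<in>UNIV. v $ Pt c)"
    using sv[of "\<lambda>w. w"] sum_chi_iota[of "\<lambda>w. w" J x] by simp
  then have "of_int (\<Sum>c\<in>UNIV. m $ Pt c) + of_int (\<Sum>c\<in>UNIV. l $ Pt c) * \<tau> = 0"
    unfolding v' by (simp add: sum.distrib sum_distrib_right)
  from of_int_lattice_eq_0[OF \<tau> this]
  have s0: "(\<Sum>c\<in>UNIV. m $ Pt c) = 0" "(\<Sum>c\<in>UNIV. l $ Pt c) = 0" by auto
  have YL: "m $ Yc = 0" "l $ Yc = 0" "m $ Lc = 0" "l $ Lc = 0"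
    using glued_YL[OF gl] of_int_lattice_eq_0[OF \<tau>] by auto
  have vYL: "v $ Yc = x $ Yc" "v $ Lc = x $ Lc" by (simp_all add: v_def)
  obtain N2 where N2: "(\<Sum>c\<in>UNIV. ((m + l) $ Pt c)\<^sup>2) = 2 * N2"
    using even_sum_square[of "\<lambda>c. (m + l) $ Pt c"] s0 by (auto simp: sum.distrib)
  define S where "S = (\<Sum>c\<in>UNIV. (of_int (l $ Pt c))\<^sup>2 :: complex)"
  define T where "T = (\<Sum>c\<in>UNIV. 2 * of_int (l $ Pt c) * v $ Pt c)"
  have quad_rest: "quad_rest I0 (\<lambda>a. 0) 0 0 = 0" by (simp add: quad_rest_def)
  have F: "quad_weight I0 (join u w) = quad_form (N_kn k) u +
    2 * (\<Sum>i | posn i < k. u $ Pt i) * ((\<Sum>a\<in>UNIV. u $ Pt a) - (\<Sum>a\<in>UNIV. w $ Pt a) +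
       (w $ Lc - u $ Lc) + of_nat (CARD('n) - k) * (w $ Yc - u $ Yc)) +
    of_nat k * ((\<Sum>a\<in>UNIV. (w $ Pt a)\<^sup>2) - (\<Sum>a\<in>UNIV. (u $ Pt a)\<^sup>2)) +
    quad_rest I0 (\<lambda>a. w $ Pt a) (w $ Yc) (w $ Lc)" for u w
    using form_join[OF k, of u w] by (simp add: quad_weight_def quad_num_vec_def k)
  have sl: "(\<Sum>a\<in>UNIV. of_int (l $ Pt a)) = (0::complex)" "(\<Sum>a\<in>UNIV. of_int (m $ Pt a)) = (0::complex)"
    using s0 by (simp_all flip: of_int_sum)
  have F1: "quad_weight I0 (join (cvec l) 0) = quad_form (N_kn k) (cvec l) - of_nat k * S"
    unfolding F by (simp add: YL sl quad_rest S_def)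
  have F2: "quad_weight I0 (join (cvec m + cvec l) 0) = quad_form (N_kn k) (cvec m + cvec l) - of_nat k * (2 * of_int N2)"
  proof -
    have "(\<Sum>a\<in>UNIV. ((cvec m + cvec l) $ Pt a)\<^sup>2) = of_int (2 * N2)"
      unfolding N2[symmetric] by simp
    then show ?thesis unfolding F by (simp add: YL sl quad_rest sum.distrib)
  qed
  have F3: "quad_weight I0 (join v x) = quad_form (N_kn k) v + quad_rest I0 (\<lambda>a. x $ Pt a) (x $ Yc) (x $ Lc)"
    unfolding F using sv[of "\<lambda>w. w"] sv[of "\<lambda>w. w\<^sup>2"] by (simp add: vYL)
  have F4: "quad_weight I0 (join (v + cvec l) x) = quad_form (N_kn k) (v + cvec l) - of_nat k * (T + S) +
      quad_rest I0 (\<lambda>a. x $ Pt a) (x $ Yc) (x $ Lc)"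
  proof -
    have "(\<Sum>a\<in>UNIV. ((v + cvec l) $ Pt a)\<^sup>2) = (\<Sum>a\<in>UNIV. (v $ Pt a)\<^sup>2) + (T + S)"
      unfolding T_def S_def sum.distrib[symmetric]
      by (rule sum.cong) (auto simp: power2_eq_square algebra_simps)
    then show ?thesis unfolding F using sv[of "\<lambda>w. w"] sv[of "\<lambda>w. w\<^sup>2"] by (simp add: vYL YL sl sum.distrib algebra_simps)
  qed
  have c0: "cvec (0 :: int^'n coord) = 0" by (simp add: vec_eq_iff)
  have c: "cvec (join m (0 :: int^'n coord)) = join (cvec m) 0" "cvec (join l (0 :: int^'n coord)) = join (cvec l) 0"
    unfolding join_cvec[symmetric] by (simp_all add: c0)
  have "quad_fac \<tau> (quad_weight I0) (join m 0) (join l 0) (join v x) =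
    quad_fac \<tau> (quad_form (N_kn k)) m l v * exp (- (pi * \<i> * (of_nat k * (2 * of_int N2))) + pi * \<i> * of_nat k * (T + \<tau> * S))"
    unfolding quad_fac_def c join_add add_0_right F1 F2 F3 F4 mult_exp_exp
    by (rule arg_cong[of _ _ exp]) (simp add: algebra_simps)
  also have "- (pi * \<i> * (of_nat k * (2 * of_int N2))) + pi * \<i> * of_nat k * (T + \<tau> * S) =
    2 * of_int (int k * (N1 - N2)) * pi * \<i>"
    using N1 unfolding T_def[symmetric] S_def[symmetric] by (simp add: algebra_simps)
  also have "exp (2 * of_int (int k * (N1 - N2)) * pi * \<i>) = (1 :: complex)"
    by (rule exp_integer_2pi) simp
  finally show ?thesis by (simp add: twist_eq_quad_fac v_def)
qed

section \<open>Cancelling the denominators\<close>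

lemma theta_not_0_at:
  assumes "Im \<tau> > 0"
  obtains z where "theta \<tau> (a + z) \<noteq> 0"
  using theta_not_0[OF assms] by (metis add_diff_cancel_left' diff_add_cancel add.commute)

lemma theta_vdm_nonzero:
  fixes c :: "nat \<Rightarrow> 'p::finite"
  assumes \<tau>: "Im \<tau> > 0" and c: "inj_on c {..<k}"
  shows "\<exists>x :: complex^'p. theta_vdm \<tau> k (\<lambda>r. x $ c r) \<noteq> 0"
  unfolding theta_vdm_def case_prod_beta
proof (rule entire_prod_nonzero[OF finite_pairs])
  fix p assume p: "p \<in> pairs k"
  show "entire (\<lambda>x. theta \<tau> (x $ c (fst p) - x $ c (snd p)))"
    by (intro entire_theta \<tau> entire_intros)
  obtain z where z: "theta \<tau> z \<noteq> 0" using theta_not_0[OF \<tau>] .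
  have "c (fst p) \<noteq> c (snd p)" using p inj_onD[OF c, of "fst p" "snd p"] by (auto simp: pairs_def)
  then show "\<exists>x. theta \<tau> (x $ c (fst p) - x $ c (snd p)) \<noteq> 0"
    using z by (intro exI[of _ "axis (c (fst p)) z"]) (simp add: axis_def)
qed

text \<open>For fixed t every factor is a translate of theta in y alone, so no choice of t and z
  forces the product to vanish.\<close>

lemma theta_sh_nonzero:
  fixes x :: "complex^'n::finite coord"
  assumes \<tau>: "Im \<tau> > 0"
  shows "\<exists>x'. (\<forall>j. x' $ Pt j = x $ Pt j) \<and> theta_sh \<tau> k t (x' $ Yc) \<noteq> 0"
proof -
  have "\<exists>w :: complex^'n coord. (\<Prod>p\<in>pairs k. theta \<tau> (t (snd p) - t (fst p) + w $ Yc) * theta \<tau> (t (fst p) - t (snd p) + w $ Yc)) \<noteq> 0"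
  proof (rule entire_prod_nonzero[OF finite_pairs])
    fix p
    show "entire (\<lambda>w :: complex^'n coord. theta \<tau> (t (snd p) - t (fst p) + w $ Yc) * theta \<tau> (t (fst p) - t (snd p) + w $ Yc))"
      by (intro entire_intros entire_theta \<tau>)
    have nz: "\<exists>w :: complex^'n coord. theta \<tau> (d + w $ Yc) \<noteq> 0" for d
    proof -
      obtain z where z: "theta \<tau> (d + z) \<noteq> 0" using theta_not_0_at[OF \<tau>, of d] .
      then show ?thesis by (intro exI[of _ "axis Yc z"]) simp
    qed
    have e: "entire (\<lambda>w :: complex^'n coord. theta \<tau> (d + w $ Yc))" for d
      by (intro entire_intros entire_theta \<tau>)
    obtain v w :: "complex^'n coord" where
      "theta \<tau> (t (snd p) - t (fst p) + v $ Yc) \<noteq> 0" "theta \<tau> (t (fst p) - t (snd p) + w $ Yc) \<noteq> 0"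
      using nz by meson
    from entire_mult_nonzero[OF e e this]
    show "\<exists>w :: complex^'n coord. theta \<tau> (t (snd p) - t (fst p) + w $ Yc) * theta \<tau> (t (fst p) - t (snd p) + w $ Yc) \<noteq> 0" .
  qed
  then obtain w :: "complex^'n coord" where w: "theta_sh \<tau> k t (w $ Yc) \<noteq> 0"
    by (auto simp: theta_sh_def case_prod_beta)
  define x' :: "complex^'n coord" where "x' = (\<chi> c. case c of Pt j \<Rightarrow> x $ Pt j | _ \<Rightarrow> w $ c)"
  show ?thesis using w by (intro exI[of _ x']) (simp add: x'_def)
qed

lemma continuous_forms:
  "continuous_on UNIV (quad_num_vec I)"
  "continuous_on UNIV (\<lambda>X. quad_vdm k (t_part X))" "continuous_on UNIV (\<lambda>X. quad_sh k (t_part X) (X $ Inr Yc))"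
  unfolding quad_num_vec_def[abs_def] quad_num_def quad_rest_def quad_vdm_def quad_sh_def t_part_def z_part_def case_prod_beta by (intro continuous_intros)+

lemma quasi_per_theta_vdm_t_part: "Im \<tau> > 0 \<Longrightarrow> quasi_per \<tau> (\<lambda>X. quad_vdm k (t_part X)) (\<lambda>X. theta_vdm \<tau> k (t_part X))"
  unfolding quad_vdm_def theta_vdm_def t_part_def case_prod_beta
  by (intro quasi_per_prod quasi_per_theta int_lin_intros)

lemma quasi_per_theta_sh_t_part: "Im \<tau> > 0 \<Longrightarrow> quasi_per \<tau> (\<lambda>X. quad_sh k (t_part X) (X $ Inr Yc)) (\<lambda>X. theta_sh \<tau> k (t_part X) (X $ Inr Yc))"
  unfolding quad_sh_def theta_sh_def t_part_def case_prod_beta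
  by (intro quasi_per_prod quasi_per_mult quasi_per_theta int_lin_intros)

lemma entire_theta_vdm: "Im \<tau> > 0 \<Longrightarrow> entire (\<lambda>x. theta_vdm \<tau> k (\<lambda>r. x $ c r))"
  unfolding theta_vdm_def case_prod_beta by (intro entire_intros entire_theta)

lemma entire_theta_sh: "Im \<tau> > 0 \<Longrightarrow> entire (\<lambda>x. theta_sh \<tau> k (\<lambda>r. x $ c r) (x $ d))"
  unfolding theta_sh_def case_prod_beta by (intro entire_intros entire_theta)

text \<open>Through \<open>posn\<close>, a block permutation of [n] induces a permutation of the
  numbering of the t-variables.\<close>

lemma t_part_perm_coord:
  fixes u x :: "complex^'n::{finite,linorder} coord"
  assumes \<sigma>: "\<sigma> \<in> block_perms k" and k: "k \<le> CARD('n)"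
  obtains \<sigma>' where "\<sigma>' permutes {..<k}"
    "\<And>u x :: complex^'n coord. \<And>r. r < k \<Longrightarrow> t_part (join (perm_coord \<sigma> u) x) r = (t_part (join u x) \<circ> \<sigma>') r"
proof
  define \<sigma>' where "\<sigma>' = (\<lambda>r. if r < k then posn (\<sigma> (nth_elem UNIV r)) else r)"
  have lt: "\<sigma>' r < k" if "r < k" for r
    using \<sigma> that k by (simp add: \<sigma>'_def block_perms_def posn_nth_elem_UNIV)
  have "inj_on \<sigma>' {..<k}"
  proof (rule inj_onI)
    fix r s assume rs: "r \<in> {..<k}" "s \<in> {..<k}" "\<sigma>' r = \<sigma>' s"
    then have "\<sigma> (nth_elem UNIV r) = \<sigma> (nth_elem UNIV s)"
      using inj_posn[where 'a='n] by (auto simp: \<sigma>'_def dest: injD)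
    then have "nth_elem (UNIV :: 'n set) r = nth_elem UNIV s"
      using \<sigma> by (auto simp: block_perms_def bij_def dest: injD)
    then show "r = s" using inj_onD[OF inj_on_nth_elem_UNIV[OF k]] rs by blast
  qed
  moreover from this have "\<sigma>' ` {..<k} = {..<k}" using lt by (intro endo_inj_surj) auto
  ultimately have "bij_betw \<sigma>' {..<k} {..<k}" by (simp add: bij_betw_def)
  then show "\<sigma>' permutes {..<k}" by (rule bij_imp_permutes) (simp add: \<sigma>'_def)
  show "t_part (join (perm_coord \<sigma> u) x) r = (t_part (join u x) \<circ> \<sigma>') r" if "r < k" for u x :: "complex^'n coord" and r
    using that by (simp add: t_part_def \<sigma>'_def nth_elem_UNIV_posn)
qed

text \<open>Numerator and \<open>theta_vdm\<close> acquire the same sign when t is permuted, so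
  their quotient is symmetric wherever \<open>theta_vdm\<close> is nonzero, and then everywhere by
  density.\<close>

lemma numerator_extension:
  fixes I :: "'n::{finite,linorder} set"
  assumes \<tau>: "Im \<tau> > 0"
  obtains N where "entire N" "\<And>X. alt_num_vec \<tau> I X = theta_vdm \<tau> (card I) (t_part X) * N X"
    "quasi_per \<tau> (\<lambda>X. quad_num_vec I X - quad_vdm (card I) (t_part X)) N"
    "\<And>\<sigma> u x. \<sigma> \<in> block_perms (card I) \<Longrightarrow> N (join (perm_coord \<sigma> u) x) = N (join u x)"
proof -
  define k where "k = card I"
  have kn: "k \<le> CARD('n)" unfolding k_def by (rule card_mono) auto
  define c :: "nat \<Rightarrow> 'n coord + 'n coord" where "c = (\<lambda>r. Inl (Pt (nth_elem UNIV r)))"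
  have c: "inj_on c {..<k}"
    using inj_on_nth_elem_UNIV[OF kn] by (auto simp: inj_on_def c_def)
  have tXc: "t_part X = (\<lambda>r. X $ c r)" for X :: "complex^('n coord + 'n coord)"
    by (simp add: fun_eq_iff t_part_def c_def)
  obtain N where N: "entire N" "\<And>X. alt_num_vec \<tau> I X = theta_vdm \<tau> k (t_part X) * N X"
  proof (rule vandermonde_theta_dvd[OF \<tau> c entire_alt_num_vec[OF \<tau>, of I]])
    show "alt_num_vec \<tau> I X = 0" if "i < j" "j < k" "X $ c i - X $ c j \<in> lattice \<tau>" for i j X
      using alt_num_vec_eq_0[OF \<tau> that(1), of I X] that by (simp add: tXc k_def)
  qed (auto simp: theta_vdm_def tXc intro: that)
  have eD: "entire (\<lambda>X :: complex^('n coord + 'n coord). theta_vdm \<tau> k (t_part X))"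
    unfolding tXc by (rule entire_theta_vdm[OF \<tau>])
  obtain X0 :: "complex^('n coord + 'n coord)" where X0: "theta_vdm \<tau> k (t_part X0) \<noteq> 0"
    using theta_vdm_nonzero[OF \<tau> c] unfolding tXc by blast
  have tqN: "quasi_per \<tau> (\<lambda>X. quad_num_vec I X - quad_vdm k (t_part X)) N"
  proof (rule quasi_per_cancel[OF N(1) eD X0 continuous_forms(1,2) quasi_per_theta_vdm_t_part[OF \<tau>]])
    show "quasi_per \<tau> (quad_num_vec I) (\<lambda>X. N X * theta_vdm \<tau> k (t_part X))"
      using quasi_per_alt_num_vec[OF \<tau>, of I] N(2) by (simp add: mult.commute quasi_per_def)
  qed
  have sym: "N (join (perm_coord \<sigma> u) x) = N (join u x)" if \<sigma>: "\<sigma> \<in> block_perms k" for \<sigma> u x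
  proof -
    obtain \<sigma>' where \<sigma>': "\<sigma>' permutes {..<k}"
      "\<And>u x :: complex^'n coord. \<And>r. r < k \<Longrightarrow> t_part (join (perm_coord \<sigma> u) x) r = (t_part (join u x) \<circ> \<sigma>') r"
      using t_part_perm_coord[OF \<sigma> kn] by blast
    define p where "p = (\<lambda>X :: complex^('n coord + 'n coord). \<chi> c. X $ Inl c)"
    define q where "q = (\<lambda>X :: complex^('n coord + 'n coord). \<chi> c. X $ Inr c)"
    \<comment> \<open>The permutation of (t, s) as a linear map on all independent variables, needed
      because the density argument runs over the whole space.\<close>
    define \<Phi> where "\<Phi> = (\<lambda>X. join (perm_coord \<sigma> (p X)) (q X))"
    have pq: "join (p X) (q X) = X" for X by (rule vec_eq_sumI) (simp_all add: p_def q_def)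
    have e\<Phi>: "entire (\<lambda>X. N (\<Phi> X))"
    proof (rule entire_compose[OF N(1)])
      fix d :: "'n coord + 'n coord"
      show "entire (\<lambda>X. \<Phi> X $ d)"
      proof (cases d)
        case (Inl a)
        then show ?thesis by (cases a) (simp_all add: \<Phi>_def p_def entire_nth)
      qed (simp add: \<Phi>_def q_def entire_nth)
    qed
    have "N (\<Phi> X) = N X" for X
    proof (rule eq_off_zeros[OF eD X0, of UNIV])
      fix X :: "complex^('n coord + 'n coord)" assume nz: "theta_vdm \<tau> k (t_part X) \<noteq> 0"
      have t: "t_part (\<Phi> X) r = (t_part X \<circ> \<sigma>') r" if "r < k" for r
        using \<sigma>'(2)[OF that, of "p X" "q X"] unfolding pq \<Phi>_def .
      have z: "z_part (\<Phi> X) = z_part X" "\<Phi> X $ Inr d = X $ Inr d" for d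
        by (simp_all add: fun_eq_iff z_part_def \<Phi>_def q_def)
      have "alt_num_vec \<tau> I (\<Phi> X) = perm_sgn k \<sigma>' * alt_num_vec \<tau> I X"
        unfolding alt_num_vec_def z using alt_num_cong[of I "t_part (\<Phi> X)" "t_part X \<circ> \<sigma>'"] t alt_num_permute[of \<sigma>' I \<tau> "t_part X"] \<sigma>'(1)
        by (simp add: k_def)
      moreover have "theta_vdm \<tau> k (t_part (\<Phi> X)) = perm_sgn k \<sigma>' * theta_vdm \<tau> k (t_part X)"
        using pairs_cong_prod(1)[of k "t_part (\<Phi> X)" "t_part X \<circ> \<sigma>'"] t theta_vdm_permute[OF \<sigma>'(1)] by simp
      ultimately show "N (\<Phi> X) = N X"
        using N(2)[of X] N(2)[of "\<Phi> X"] nz perm_sgn_nonzero[of k \<sigma>'] by simp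
    qed (use holo_on_continuous[OF N(1)] holo_on_continuous[OF e\<Phi>] in auto)
    moreover have "p (join u x) = u" "q (join u x) = x" by (simp_all add: p_def q_def)
    ultimately show ?thesis by (metis \<Phi>_def)
  qed
  show ?thesis using that[OF N(1)] N(2) tqN sym by (simp add: k_def)
qed

lemma t_part_join_chi_iota:
  fixes K :: "'n::{finite,linorder} set"
  assumes "r < card K"
  shows "t_part (join (chi_iota K x) x) r = z_restr K x r"
proof -
  have "card K \<le> CARD('n)" by (rule card_mono) auto
  then have "posn (nth_elem (UNIV :: 'n set) r) = r" using assms by (intro posn_nth_elem_UNIV) simp
  then show ?thesis using assms by (simp add: t_part_def z_restr_def chi_idx_def)
qed

text \<open>On the hyperplanes \<open>z\<^sub>a = z\<^sub>b\<close> the product of the \<open>\<theta>(t\<^sub>i - t\<^sub>j + y)\<close> is not identically zero, because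
  of the free variable \<open>y\<close>; this is why the two kinds of denominators can be cancelled
  independently.\<close>

lemma restricted_quotient:
  fixes I K :: "'n::{finite,linorder} set"
  assumes \<tau>: "Im \<tau> > 0" and K: "card K = card I" and N: "entire N"
    and alt_num_vec: "\<And>X. alt_num_vec \<tau> I X = theta_vdm \<tau> (card I) (t_part X) * N X"
  obtains G where "entire G"
    "\<And>x. N (join (chi_iota K x) x) = theta_sh \<tau> (card I) (z_restr K x) (x $ Yc) * G x"
proof -
  define k where "k = card I"
  define h where "h = (\<lambda>x :: complex^'n coord. join (chi_iota K x) x)"
  define D where "D = (\<lambda>x. theta_vdm \<tau> k (z_restr K x))"
  define P where "P = (\<lambda>x. theta_sh \<tau> k (z_restr K x) (x $ Yc))"
  define A where "A = (\<lambda>x. alt_num_vec \<tau> I (h x))"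
  have z_restr: "z_restr K x = (\<lambda>r. x $ Pt (nth_elem K r))" for x by (simp add: fun_eq_iff z_restr_def)
  have eh: "entire (\<lambda>x. h x $ c)" for c
  proof (cases c)
    case (Inl a)
    then show ?thesis by (cases a) (simp_all add: h_def entire_nth)
  qed (simp add: h_def entire_nth)
  have eN: "entire (\<lambda>x. N (h x))" by (rule entire_compose[OF N eh])
  have eP: "entire P" unfolding P_def z_restr by (rule entire_theta_sh[OF \<tau>])
  have eD: "entire D" unfolding D_def z_restr by (rule entire_theta_vdm[OF \<tau>])
  have inj: "inj_on (\<lambda>r. Pt (nth_elem K r)) {..<k}"
    using inj_on_nth_elem[of K] K by (auto simp: inj_on_def k_def)
  obtain x0 where x0: "D x0 \<noteq> 0" using theta_vdm_nonzero[OF \<tau> inj] unfolding D_def z_restr by blast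
  have AD: "A x = D x * N (h x)" for x
    unfolding A_def D_def alt_num_vec using pairs_cong_prod(1)[of k "t_part (h x)" "z_restr K x" \<tau>] t_part_join_chi_iota[of _ K x]
    by (simp add: h_def k_def K)
  have "\<exists>H. \<forall>\<sigma>. \<sigma> permutes {..<k} \<longrightarrow> entire (H \<sigma>) \<and> (\<forall>x. weight_num \<tau> I (z_restr K x \<circ> \<sigma>) (\<lambda>a. x $ Pt a) (x $ Yc) (x $ Lc) =
    theta_up \<tau> k (z_restr K x \<circ> \<sigma>) (x $ Yc) * H \<sigma> x)"
    using weight_num_restrict[OF \<tau> K] unfolding k_def by metis
  then obtain H where H: "\<And>\<sigma>. \<sigma> permutes {..<k} \<Longrightarrow> entire (H \<sigma>)"
    "\<And>\<sigma> x. \<sigma> permutes {..<k} \<Longrightarrow> weight_num \<tau> I (z_restr K x \<circ> \<sigma>) (\<lambda>a. x $ Pt a) (x $ Yc) (x $ Lc) =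
    theta_up \<tau> k (z_restr K x \<circ> \<sigma>) (x $ Yc) * H \<sigma> x" by blast
  define B where "B = (\<lambda>x. \<Sum>\<sigma> | \<sigma> permutes {..<k}. perm_sgn k \<sigma> * H \<sigma> x)"
  have eB: "entire B" unfolding B_def by (intro entire_intros) (simp add: H(1))
  have AB: "A x = P x * B x" for x
  proof -
    have "A x = alt_num \<tau> I (z_restr K x) (\<lambda>a. x $ Pt a) (x $ Yc) (x $ Lc)"
      unfolding A_def alt_num_vec_def using alt_num_cong[of I "t_part (h x)" "z_restr K x"] t_part_join_chi_iota[of _ K x]
      by (simp add: h_def K z_part_def[abs_def])
    also have "\<dots> = (\<Sum>\<sigma> | \<sigma> permutes {..<k}. P x * (perm_sgn k \<sigma> * H \<sigma> x))"
      unfolding alt_num_def k_def[symmetric]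
    proof (rule sum.cong[OF refl])
      fix \<sigma> assume "\<sigma> \<in> {\<sigma>. \<sigma> permutes {..<k}}"
      then have \<sigma>: "\<sigma> permutes {..<k}" by simp
      have "P x = theta_up \<tau> k (z_restr K x \<circ> \<sigma>) (x $ Yc) * theta_dn \<tau> k (z_restr K x \<circ> \<sigma>) (x $ Yc)"
        unfolding P_def theta_sh_eq[symmetric] by (rule theta_sh_permute[OF \<sigma>, symmetric])
      then show "perm_sgn k \<sigma> * (weight_num \<tau> I (z_restr K x \<circ> \<sigma>) (\<lambda>a. x $ Pt a) (x $ Yc) (x $ Lc) * theta_dn \<tau> k (z_restr K x \<circ> \<sigma>) (x $ Yc)) =
        P x * (perm_sgn k \<sigma> * H \<sigma> x)"
        unfolding H(2)[OF \<sigma>] by simp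
    qed
    finally show ?thesis by (simp add: B_def sum_distrib_left)
  qed
  have van: "B y = 0" if ij: "i < j" "j < k" and lat: "y $ Pt (nth_elem K i) - y $ Pt (nth_elem K j) \<in> lattice \<tau>" for i j y
  proof -
    define a where "a = nth_elem K i"
    define b where "b = nth_elem K j"
    have ab: "a \<noteq> b" using inj_onD[OF inj_on_nth_elem, of K i j] ij K by (auto simp: a_def b_def k_def)
    define \<gamma> where "\<gamma> = y $ Pt a - y $ Pt b"
    define \<pi> where "\<pi> = (\<lambda>x::complex^'n coord. \<chi> d. if d = Pt a then x $ Pt b + \<gamma> else x $ d)"
    have \<pi>: "entire (\<lambda>x. \<pi> x $ d)" for d
      by (cases "d = Pt a") (auto simp: \<pi>_def intro!: entire_intros)
    have \<pi>y: "\<pi> y = y" by (auto simp: \<pi>_def vec_eq_iff \<gamma>_def)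
    obtain z0 where z0: "theta \<tau> z0 \<noteq> 0" using theta_not_0[OF \<tau>] .
    \<comment> \<open>Here all z are 0 or the lattice point \<gamma>, so every difference lies in
      the lattice while y = \<open>z0\<close> does not: no factor of \<open>P\<close>
      vanishes.\<close>
    define w where "w = \<pi> (axis Yc z0)"
    have wc: "w $ Pt d = (if d = a then \<gamma> else 0)" "w $ Yc = z0" for d
      by (auto simp: w_def \<pi>_def axis_def)
    have "theta \<tau> (w $ Pt d - w $ Pt e + w $ Yc) \<noteq> 0" for d e
    proof
      assume "theta \<tau> (w $ Pt d - w $ Pt e + w $ Yc) = 0"
      then have *: "w $ Pt d - w $ Pt e + z0 \<in> lattice \<tau>" using theta_eq_0_iff[OF \<tau>] by (simp add: wc)
      have "w $ Pt d - w $ Pt e \<in> lattice \<tau>"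
        using lat lattice_minus[OF lat] lattice_0 by (auto simp: wc \<gamma>_def a_def b_def)
      from lattice_diff[OF * this] show False using z0 theta_eq_0_iff[OF \<tau>] by simp
    qed
    then have Pw: "P (\<pi> (axis Yc z0)) \<noteq> 0"
      unfolding P_def theta_sh_def z_restr w_def[symmetric] by (simp add: prod_zero_iff case_prod_beta)
    \<comment> \<open>\<open>P * B\<close> and \<open>D * N\<close> are the same restricted
      numerator, and \<open>D\<close> vanishes on the hyperplane.\<close>
    have P0: "P (\<pi> x) * B (\<pi> x) = P (\<pi> x) * 0" for x
    proof -
      have "\<pi> x $ Pt a - \<pi> x $ Pt b = \<gamma>" using ab by (simp add: \<pi>_def)
      then have "theta \<tau> (\<pi> x $ Pt a - \<pi> x $ Pt b) = 0"
        using lat theta_eq_0_iff[OF \<tau>] by (simp add: \<gamma>_def a_def b_def)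
      then have "D (\<pi> x) = 0"
        unfolding D_def theta_vdm_def z_restr prod_zero_iff[OF finite_pairs] using ij
        by (intro bexI[of _ "(i, j)"]) (auto simp: a_def b_def pairs_def)
      then show ?thesis using AB[of "\<pi> x"] AD[of "\<pi> x"] by simp
    qed
    have "B (\<pi> y) = 0"
      using entire_mult_cancel[OF entire_compose[OF eP \<pi>] Pw entire_compose[OF eB \<pi>] entire_const P0] .
    then show "B y = 0" by (simp add: \<pi>y)
  qed
  obtain G where G: "entire G" "\<And>x. B x = D x * G x"
  proof (rule vandermonde_theta_dvd[OF \<tau> inj eB])
    show "B x = 0" if "i < j" "j < k" "x $ Pt (nth_elem K i) - x $ Pt (nth_elem K j) \<in> lattice \<tau>" for i j x
      by (rule van[OF that])
  qed (auto simp: D_def theta_vdm_def z_restr intro: that)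
  have "N (h x) = P x * G x" for x
  proof (rule entire_mult_cancel[OF eD x0 eN])
    show "entire (\<lambda>x. P x * G x)" using eP G(1) by (rule entire_mult)
    show "D x * N (h x) = D x * (P x * G x)" for x
      using AB[of x] unfolding AD G(2) by (simp only: mult_ac)
  qed
  then show ?thesis using that[OF G(1)] by (simp add: h_def P_def k_def)
qed

lemma quasi_per_join_chi_iota:
  assumes "quasi_per \<tau> Q f"
  shows "quasi_per \<tau> (\<lambda>x. Q (join (chi_iota K x) x)) (\<lambda>x. f (join (chi_iota K x) x))"
  by (rule quasi_per_compose[OF assms, of _ "\<lambda>m. join (chi_iota K m) m"])
    (simp_all add: chi_iota_add chi_iota_latvec chi_iota_cvec flip: join_add join_latvec join_cvec)

lemma continuous_join_chi_iota: "continuous_on S (\<lambda>x. join (chi_iota K x) x)"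
proof (rule continuous_on_vecI)
  fix c
  show "continuous_on S (\<lambda>x. join (chi_iota K x) x $ c)"
  proof (cases c)
    case (Inl a)
    then show ?thesis by (cases a) (auto intro!: continuous_intros)
  qed (auto intro!: continuous_intros)
qed

definition quad_psi :: "'n::{finite,linorder} set \<Rightarrow> complex^'n coord \<Rightarrow> complex" where
  "quad_psi I x = (\<Sum>j\<in>I. (x $ Lc - of_int (w_wt j I + 1) * x $ Yc)\<^sup>2 + (x $ Lc - of_int (w_wt j I) * x $ Yc)\<^sup>2)"

text \<open>Writes each coefficient as a single integer cast, so that the arguments of theta are
  visibly integral linear forms.\<close>

lemma psi_of_int: "psi \<tau> I y lam = (\<Prod>j\<in>I. theta \<tau> (lam - of_int (w_wt j I + 1) * y) * theta \<tau> (lam - of_int (w_wt j I) * y))"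
  by (simp add: psi_def)

lemma int_quad_quad_psi: "int_quad (quad_psi I)"
  unfolding quad_psi_def[abs_def] by (intro int_quad_intros int_lin_intros)

lemma quasi_per_psi: "Im \<tau> > 0 \<Longrightarrow> quasi_per \<tau> (quad_psi I) (\<lambda>x. psi \<tau> I (x $ Yc) (x $ Lc))"
  unfolding quad_psi_def[abs_def] psi_of_int by (intro quasi_per_prod quasi_per_mult quasi_per_theta int_lin_intros)

lemma entire_psi: "Im \<tau> > 0 \<Longrightarrow> entire (\<lambda>x. psi \<tau> I (x $ Yc) (x $ Lc))"
  unfolding psi_of_int by (intro entire_intros entire_theta)

text \<open>At y = 0 all factors reduce to theta(\<lambda>).\<close>

lemma psi_nonzero:
  fixes I :: "'n::{finite,linorder} set"
  assumes "Im \<tau> > 0"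
  obtains x :: "complex^'n coord" where "psi \<tau> I (x $ Yc) (x $ Lc) \<noteq> 0"
proof -
  obtain z where "theta \<tau> z \<noteq> 0" using theta_not_0[OF assms] .
  then show ?thesis by (intro that[of "axis Lc z"]) (simp add: psi_def axis_def)
qed

text \<open>Here \<open>G K\<close> is the restriction of N divided by that of P. Since all
  restrictions come from one N, gluing needs only the transformation laws of N and P and a division
  by P; hence it is claimed where P is nonzero, and \<open>admissible_mero_sectI\<close> removes
  this restriction.\<close>

lemma weight_entire_extension:
  fixes I :: "'n::{finite,linorder} set"
  assumes \<tau>: "Im \<tau> > 0" and k: "card I = k"
  obtains G where
    "\<And>K. card K = k \<Longrightarrow> entire (G K)"
    "\<And>K. card K = k \<Longrightarrow> quasi_per \<tau> (\<lambda>x. quad_rest_vec I x + quad_form (N_kn k) (chi_iota K x)) (G K)"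
    "\<And>K x. card K = k \<Longrightarrow> psi \<tau> I (x $ Yc) (x $ Lc) * (theta_vdm \<tau> k (z_restr K x) * theta_sh \<tau> k (z_restr K x) (x $ Yc)) \<noteq> 0 \<Longrightarrow>
       c_w_plus \<tau> I K x = G K x / psi \<tau> I (x $ Yc) (x $ Lc)"
    "\<And>J K \<sigma> m l x. card J = k \<Longrightarrow> card K = k \<Longrightarrow> glued \<tau> k J K \<sigma> m l x \<Longrightarrow>
       theta_sh \<tau> k (z_restr J x) (x $ Yc) \<noteq> 0 \<Longrightarrow>
       G K x = twist \<tau> k m l (perm_coord \<sigma> (chi_iota J x)) * G J x"
proof -
  have kn: "k \<le> CARD('n)" unfolding k[symmetric] by (rule card_mono) auto
  obtain N where N: "entire N" "\<And>X. alt_num_vec \<tau> I X = theta_vdm \<tau> k (t_part X) * N X"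
    "quasi_per \<tau> (\<lambda>X. quad_num_vec I X - quad_vdm k (t_part X)) N"
    "\<And>\<sigma> u x. \<sigma> \<in> block_perms k \<Longrightarrow> N (join (perm_coord \<sigma> u) x) = N (join u x)"
    using numerator_extension[OF \<tau>, of I] unfolding k by blast
  have "\<exists>g. entire g \<and> (\<forall>x. N (join (chi_iota K x) x) = theta_sh \<tau> k (z_restr K x) (x $ Yc) * g x)" if K: "card K = k" for K
    using restricted_quotient[OF \<tau> _ N(1), of K I] N(2) K k by metis
  then obtain G where G: "\<And>K. card K = k \<Longrightarrow> entire (G K)"
    "\<And>K x. card K = k \<Longrightarrow> N (join (chi_iota K x) x) = theta_sh \<tau> k (z_restr K x) (x $ Yc) * G K x"
    by metis
  define PX where "PX = (\<lambda>X :: complex^('n coord + 'n coord). theta_sh \<tau> k (t_part X) (X $ Inr Yc))"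
  have PX: "PX (join (chi_iota K x) x) = theta_sh \<tau> k (z_restr K x) (x $ Yc)" if "card K = k" for K x
    unfolding PX_def join_nth by (rule pairs_cong_prod) (simp add: t_part_join_chi_iota that)
  have z_restr: "z_restr K x = (\<lambda>r. x $ Pt (nth_elem K r))" for K x by (simp add: fun_eq_iff z_restr_def)
  have tqG: "quasi_per \<tau> (\<lambda>x. quad_rest_vec I x + quad_form (N_kn k) (chi_iota K x)) (G K)" if K: "card K = k" for K
  proof -
    define h where "h = (\<lambda>x :: complex^'n coord. join (chi_iota K x) x)"
    have cont: "continuous_on UNIV (\<lambda>x. F (h x))" if "continuous_on UNIV F" for F :: "complex^('n coord + 'n coord) \<Rightarrow> complex"
      unfolding h_def by (rule continuous_on_compose2[OF that continuous_join_chi_iota]) auto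
    have eP: "entire (\<lambda>x. PX (h x))"
      unfolding h_def PX[OF K] z_restr by (rule entire_theta_sh[OF \<tau>])
    obtain x' where "PX (h x') \<noteq> 0"
    proof -
      obtain x0 :: "complex^'n coord" where x0: "\<forall>j. x0 $ Pt j = 0 $ Pt j" "theta_sh \<tau> k (\<lambda>_. 0) (x0 $ Yc) \<noteq> 0"
        using theta_sh_nonzero[OF \<tau>, of 0] by blast
      then have "z_restr K x0 = (\<lambda>_. 0)" by (simp add: z_restr)
      then show ?thesis using x0(2) by (intro that[of x0]) (simp add: h_def PX[OF K])
    qed
    note nz = this
    have "quasi_per \<tau> (\<lambda>x. (quad_num_vec I (h x) - quad_vdm k (t_part (h x))) - quad_sh k (t_part (h x)) (h x $ Inr Yc)) (G K)"
    proof (rule quasi_per_cancel[OF G(1)[OF K] eP nz])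
      show "continuous_on UNIV (\<lambda>x. quad_num_vec I (h x) - quad_vdm k (t_part (h x)))"
        by (intro continuous_on_diff cont[OF continuous_forms(1)] cont[OF continuous_forms(2)])
      show "continuous_on UNIV (\<lambda>x. quad_sh k (t_part (h x)) (h x $ Inr Yc))"
        by (rule cont[OF continuous_forms(3)])
      show "quasi_per \<tau> (\<lambda>x. quad_sh k (t_part (h x)) (h x $ Inr Yc)) (\<lambda>x. PX (h x))"
        unfolding h_def PX_def by (rule quasi_per_join_chi_iota[OF quasi_per_theta_sh_t_part[OF \<tau>]])
      have "(\<lambda>x. N (h x)) = (\<lambda>x. G K x * PX (h x))"
        using G(2)[OF K] PX[OF K] by (simp add: h_def mult.commute)
      then show "quasi_per \<tau> (\<lambda>x. quad_num_vec I (h x) - quad_vdm k (t_part (h x))) (\<lambda>x. G K x * PX (h x))"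
        using quasi_per_join_chi_iota[OF N(3), of K] by (simp add: h_def)
    qed
    then show ?thesis
    proof (rule quasi_per_cong)
      fix x
      show "quad_num_vec I (h x) - quad_vdm k (t_part (h x)) - quad_sh k (t_part (h x)) (h x $ Inr Yc) =
        quad_rest_vec I x + quad_form (N_kn k) (chi_iota K x)"
        using quad_weight_join_chi_iota[of I K x] by (simp add: quad_weight_def k h_def)
    qed
  qed
  have val: "c_w_plus \<tau> I K x = G K x / psi \<tau> I (x $ Yc) (x $ Lc)"
    if K: "card K = k" and nz: "psi \<tau> I (x $ Yc) (x $ Lc) * (theta_vdm \<tau> k (z_restr K x) * theta_sh \<tau> k (z_restr K x) (x $ Yc)) \<noteq> 0" for K x
  proof -
    define h where "h = join (chi_iota K x) x"
    have D: "theta_vdm \<tau> k (t_part h) = theta_vdm \<tau> k (z_restr K x)"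
      unfolding h_def by (rule pairs_cong_prod) (simp add: t_part_join_chi_iota K)
    have "alt_num \<tau> I (z_restr K x) (\<lambda>a. x $ Pt a) (x $ Yc) (x $ Lc) = alt_num_vec \<tau> I h"
      unfolding alt_num_vec_def using alt_num_cong[of I "t_part h" "z_restr K x"] t_part_join_chi_iota[of _ K x]
      by (simp add: h_def K k z_part_def[abs_def])
    also have "\<dots> = theta_vdm \<tau> k (z_restr K x) * (theta_sh \<tau> k (z_restr K x) (x $ Yc) * G K x)"
      unfolding N(2) D using G(2)[OF K] by (simp add: h_def)
    finally have A: "alt_num \<tau> I (z_restr K x) (\<lambda>a. x $ Pt a) (x $ Yc) (x $ Lc) = \<dots>" .
    have "(\<Sum>\<sigma> | \<sigma> permutes {..<card I}. w_summand \<tau> I (z_restr K x \<circ> \<sigma>) (\<lambda>a. x $ Pt a) (x $ Yc) (x $ Lc)) = G K x"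
      using sum_w_summand[of \<tau> I "z_restr K x" "x $ Yc" "\<lambda>a. x $ Pt a" "x $ Lc"] nz unfolding A k by simp
    then show ?thesis by (simp add: c_w_plus_def w_plus_def z_restr)
  qed
  have glue: "G K x = twist \<tau> k m l (perm_coord \<sigma> (chi_iota J x)) * G J x"
    if J: "card J = k" and K: "card K = k" and gl: "glued \<tau> k J K \<sigma> m l x" and nz: "theta_sh \<tau> k (z_restr J x) (x $ Yc) \<noteq> 0"
    for J K \<sigma> m l x
  proof -
    define v where "v = join (perm_coord \<sigma> (chi_iota J x)) x"
    define M :: "int^('n coord + 'n coord)" where "M = join m 0"
    define L :: "int^('n coord + 'n coord)" where "L = join l 0"
    have \<sigma>: "\<sigma> \<in> block_perms k" using gl by (simp add: glued_def)
    have l0: "latvec \<tau> (0 :: int^'n coord) 0 = 0" by (simp add: vec_eq_iff)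
    \<comment> \<open>Over the same (z, y, \<lambda>), the points for \<open>K\<close> and
      \<open>J\<close> differ by a permutation and a lattice translation of (t, s) alone.\<close>
    have hK: "join (chi_iota K x) x = v + latvec \<tau> M L"
      using gl unfolding v_def M_def L_def join_latvec[symmetric] join_add l0 by (simp add: glued_def)
    obtain \<sigma>' where \<sigma>': "\<sigma>' permutes {..<k}"
      "\<And>u x :: complex^'n coord. \<And>r. r < k \<Longrightarrow> t_part (join (perm_coord \<sigma> u) x) r = (t_part (join u x) \<circ> \<sigma>') r"
      using t_part_perm_coord[OF \<sigma> kn] by blast
    have theta_sh: "PX v = PX (join (chi_iota J x) x)"
    proof -
      have "PX v = theta_sh \<tau> k (t_part (join (chi_iota J x) x) \<circ> \<sigma>') (x $ Yc)"
        unfolding PX_def v_def join_nth by (rule pairs_cong_prod) (rule \<sigma>'(2))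
      then show ?thesis by (simp add: theta_sh_permute[OF \<sigma>'(1)] PX_def)
    qed
    have "N (v + latvec \<tau> M L) = quad_fac \<tau> (\<lambda>X. quad_num_vec I X - quad_vdm k (t_part X)) M L v * N v"
      using N(3) by (simp add: quasi_per_def)
    moreover have "PX (v + latvec \<tau> M L) = quad_fac \<tau> (\<lambda>X. quad_sh k (t_part X) (X $ Inr Yc)) M L v * PX v"
    proof -
      have "quasi_per \<tau> (\<lambda>X. quad_sh k (t_part X) (X $ Inr Yc)) PX" unfolding PX_def by (rule quasi_per_theta_sh_t_part[OF \<tau>])
      then show ?thesis by (simp add: quasi_per_def)
    qed
    moreover have "N v = PX v * G J x"
      unfolding theta_sh PX[OF J] G(2)[OF J, symmetric] unfolding v_def by (rule N(4)[OF \<sigma>])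
    moreover have "N (v + latvec \<tau> M L) = PX (v + latvec \<tau> M L) * G K x"
      unfolding hK[symmetric] PX[OF K] by (rule G(2)[OF K])
    moreover have "PX v \<noteq> 0" unfolding theta_sh PX[OF J] by (rule nz)
    ultimately have "G K x = quad_fac \<tau> (\<lambda>X. quad_num_vec I X - quad_vdm k (t_part X)) M L v /
        quad_fac \<tau> (\<lambda>X. quad_sh k (t_part X) (X $ Inr Yc)) M L v * G J x"
      by (simp add: field_simps)
    also have "\<dots> = quad_fac \<tau> (quad_weight I) M L v * G J x"
      unfolding quad_weight_def[abs_def] k by (simp add: quad_fac_diff)
    also have "quad_fac \<tau> (quad_weight I) M L v = twist \<tau> k m l (perm_coord \<sigma> (chi_iota J x))"
      unfolding M_def L_def v_def by (rule glue_factor[OF \<tau> k gl])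
    finally show ?thesis .
  qed
  show ?thesis by (rule that[OF G(1) tqG val glue])
qed

lemma holo_sect_entire:
  assumes "entire f" "quasi_per \<tau> Q f"
  shows "holo_sect \<tau> (quad_fac \<tau> Q) f"
proof -
  have refl: "gen_eq U g g" for U :: "(complex^'a) set" and g by (simp add: gen_eq_def)
  have "mero f"
    unfolding mero_def
    by (intro allI exI[of _ UNIV] exI[of _ f] exI[of _ "\<lambda>_. 1"]) (simp add: assms(1) entire_const refl)
  moreover have "regular_at f x" for x
    unfolding regular_at_def by (intro exI[of _ UNIV] exI[of _ f]) (simp add: assms(1) refl)
  ultimately show ?thesis
    using assms(2) by (simp add: holo_sect_def mero_sect_def quasi_per_def refl)
qed

text \<open>Multiplication by psi_I changes the bundle, so the second claim comes with a bundle
  \<open>M\<close> of which psi_I is a holomorphic section; the product is then a section for the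
  tensor product.\<close>

theorem proposition5p9:
  fixes \<tau> :: complex and k :: nat and I :: "'n::{finite,linorder} set"
  assumes "Im \<tau> > 0" and "card I = k"
  shows "\<exists>L\<^sub>I M :: 'n coord factor.
           line_bundle \<tau> L\<^sub>I \<and> admissible_mero_sect \<tau> k L\<^sub>I (c_w_plus \<tau> I) \<and>
           line_bundle \<tau> M \<and> holo_sect \<tau> M (\<lambda>x. psi \<tau> I (x $ Yc) (x $ Lc)) \<and>
           admissible_holo_sect \<tau> k (L\<^sub>I \<otimes>\<^sub>L M)
             (\<lambda>J x. psi \<tau> I (x $ Yc) (x $ Lc) * c_w_plus \<tau> I J x)"
proof -
  note \<tau> = assms(1)
  define \<psi> where "\<psi> = (\<lambda>x :: complex^'n coord. psi \<tau> I (x $ Yc) (x $ Lc))"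
  define D where "D = (\<lambda>(K :: 'n set) x. theta_vdm \<tau> k (z_restr K x))"
  define P where "P = (\<lambda>(K :: 'n set) x. theta_sh \<tau> k (z_restr K x) (x $ Yc))"
  \<comment> \<open>Off the zeros of \<open>H\<close> no denominator in the formula for
    \<open>c_w_plus\<close> vanishes, so the formula can be taken literally there.\<close>
  define H where "H = (\<lambda>K x. \<psi> x * (D K x * P K x))"
  \<comment> \<open>The form of \<open>L\<^sub>I\<close>: the numerator contributes
    \<open>quad_rest_vec I\<close> over the base, and division by \<psi> subtracts
    \<open>quad_psi I\<close>.\<close>
  define Q where "Q = (\<lambda>x. quad_rest_vec I x - quad_psi I x)"
  obtain G where G1: "\<And>K. card K = k \<Longrightarrow> entire (G K)"
    "\<And>K. card K = k \<Longrightarrow> quasi_per \<tau> (\<lambda>x. quad_rest_vec I x + quad_form (N_kn k) (chi_iota K x)) (G K)"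
    "\<And>K x. card K = k \<Longrightarrow> psi \<tau> I (x $ Yc) (x $ Lc) * (theta_vdm \<tau> k (z_restr K x) * theta_sh \<tau> k (z_restr K x) (x $ Yc)) \<noteq> 0 \<Longrightarrow>
       c_w_plus \<tau> I K x = G K x / psi \<tau> I (x $ Yc) (x $ Lc)"
    "\<And>J K \<sigma> m l x. card J = k \<Longrightarrow> card K = k \<Longrightarrow> glued \<tau> k J K \<sigma> m l x \<Longrightarrow>
       theta_sh \<tau> k (z_restr J x) (x $ Yc) \<noteq> 0 \<Longrightarrow>
       G K x = twist \<tau> k m l (perm_coord \<sigma> (chi_iota J x)) * G J x"
  proof (rule weight_entire_extension[OF assms], goal_cases)
    case (1 G)
    show ?case by (rule 1(1)[OF 1(2-5)])
  qed
  have G3: "c_w_plus \<tau> I K x = G K x / \<psi> x" if "card K = k" "H K x \<noteq> 0" for K x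
    using that(2) unfolding H_def D_def P_def \<psi>_def by (rule G1(3)[OF that(1)])
  have G4: "G K x = twist \<tau> k m l (perm_coord \<sigma> (chi_iota J x)) * G J x"
    if "card J = k" "card K = k" "glued \<tau> k J K \<sigma> m l x" "P J x \<noteq> 0" for J K \<sigma> m l x
    using that(4) unfolding P_def by (rule G1(4)[OF that(1-3)])
  note G = G1(1,2) G3 G4
  have z_restr: "z_restr K x = (\<lambda>r. x $ Pt (nth_elem K r))" for K and x :: "complex^'n coord"
    by (simp add: fun_eq_iff z_restr_def)
  have eD: "entire (D K)" and eP: "entire (P K)" for K
    unfolding D_def P_def z_restr by (rule entire_theta_vdm[OF \<tau>], rule entire_theta_sh[OF \<tau>])
  have e\<psi>: "entire \<psi>" unfolding \<psi>_def by (rule entire_psi[OF \<tau>])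
  obtain x0 where x0: "\<psi> x0 \<noteq> 0" using psi_nonzero[OF \<tau>, of I] unfolding \<psi>_def by blast
  have nzP: "\<exists>x'. (\<forall>j. x' $ Pt j = x $ Pt j) \<and> P K x' \<noteq> 0" for K x
  proof -
    obtain x' where x': "\<forall>j. x' $ Pt j = x $ Pt j" "theta_sh \<tau> k (z_restr K x) (x' $ Yc) \<noteq> 0"
      using theta_sh_nonzero[OF \<tau>] by blast
    moreover have "z_restr K x' = z_restr K x" using x'(1) by (simp add: z_restr)
    ultimately show ?thesis by (auto simp: P_def)
  qed
  have nzH: "\<exists>a. H K a \<noteq> 0" if K: "card K = k" for K
  proof -
    have "inj_on (\<lambda>r. Pt (nth_elem K r)) {..<k}"
      using inj_on_nth_elem[of K] K by (auto simp: inj_on_def)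
    then obtain a where a: "D K a \<noteq> 0" using theta_vdm_nonzero[OF \<tau>] unfolding D_def z_restr by blast
    obtain b where "P K b \<noteq> 0" using nzP by blast
    from entire_mult_nonzero[OF eD eP a this] obtain c where "D K c * P K c \<noteq> 0" by blast
    from entire_mult_nonzero[OF e\<psi> entire_mult[OF eD eP] x0 this] show ?thesis by (simp add: H_def)
  qed
  have eH: "entire (H K)" for K unfolding H_def by (intro entire_mult e\<psi> eD eP)
  have qL: "int_quad Q" unfolding Q_def by (intro int_quad_diff int_quad_quad_rest_vec int_quad_quad_psi)
  have L: "admissible_mero_sect \<tau> k (quad_fac \<tau> Q) (c_w_plus \<tau> I)"
  proof (rule admissible_mero_sectI[where G = G and H = H and W = P, OF \<tau> qL G(1) _ e\<psi> x0 _ _ eH nzH _ eP nzP])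
    show "quasi_per \<tau> (quad_psi I) \<psi>" unfolding \<psi>_def by (rule quasi_per_psi[OF \<tau>])
    show "quasi_per \<tau> (\<lambda>x. Q x + quad_psi I x + quad_form (N_kn k) (chi_iota K x)) (G K)" if "card K = k" for K
      using G(2)[OF that] by (simp add: Q_def)
    show "\<psi> x = \<psi> y" if "x $ Yc = y $ Yc" "x $ Lc = y $ Lc" for x y using that by (simp add: \<psi>_def)
  qed (use G(3,4) in blast)+
  \<comment> \<open>The same criterion with denominator 1: after multiplication by \<psi> the
    section is represented by the entire functions \<open>G K\<close> themselves.\<close>
  have M: "admissible_mero_sect \<tau> k (quad_fac \<tau> (quad_rest_vec I)) (\<lambda>J x. \<psi> x * c_w_plus \<tau> I J x)"
  proof (rule admissible_mero_sectI[where G = G and H = H and W = P, OF \<tau> int_quad_quad_rest_vec G(1) _ entire_const[of 1] _ quasi_per_const _ eH nzH _ eP nzP])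
    show "quasi_per \<tau> (\<lambda>x. quad_rest_vec I x + 0 + quad_form (N_kn k) (chi_iota K x)) (G K)" if "card K = k" for K
      using G(2)[OF that] by simp
    show "\<psi> x * c_w_plus \<tau> I K x = G K x / 1" if "card K = k" "H K x \<noteq> 0" for K x
      using G(3)[OF that] that(2) by (simp add: H_def)
  qed (use G(4) in auto)
  have reg: "regular_at (\<lambda>x. \<psi> x * c_w_plus \<tau> I K x) x" if K: "card K = k" for K x
  proof -
    obtain a where "H K a \<noteq> 0" using nzH[OF K] ..
    then have "gen_eq UNIV (\<lambda>x. \<psi> x * c_w_plus \<tau> I K x) (G K)"
      by (rule gen_eqI[OF eH]) (use G(3)[OF K] in \<open>auto simp: H_def\<close>)
    then show ?thesis unfolding regular_at_def using G(1)[OF K] by blast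
  qed
  have "quad_fac \<tau> Q \<otimes>\<^sub>L quad_fac \<tau> (quad_psi I) = quad_fac \<tau> (quad_rest_vec I)"
    by (simp add: tensor_def fun_eq_iff Q_def flip: quad_fac_add)
  then have "admissible_holo_sect \<tau> k (quad_fac \<tau> Q \<otimes>\<^sub>L quad_fac \<tau> (quad_psi I)) (\<lambda>J x. \<psi> x * c_w_plus \<tau> I J x)"
    using M reg by (simp add: admissible_holo_sect_def)
  moreover have "holo_sect \<tau> (quad_fac \<tau> (quad_psi I)) \<psi>"
    unfolding \<psi>_def by (intro holo_sect_entire entire_psi quasi_per_psi \<tau>)
  ultimately show ?thesis
    using L int_quad_line_bundle[OF qL] int_quad_line_bundle[OF int_quad_quad_psi] unfolding \<psi>_def by blast
qed

end
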